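(* Let $D\subseteq\mathbb{C}$ be a domain, let $k\ge 1$ and $q\geq 1$ be integers, and let $a_0,a_1,\ldots,a_k$ be holomorphic functions on $D$ with $a_k(z)\neq 0$ for all $z\in D$. For a holomorphic function $f$ on $D$ put $$L_k(f)(z):=a_k(z)f^{(k)}(z)+a_{k-1}(z)f^{(k-1)}(z)+\cdots+a_1(z)f'(z)+a_0(z)f(z).$$ Let $\mathcal{F}$ be a family of holomorphic functions on $D$ such that, for every $f\in\mathcal{F}$, all zeros of $f$ have multiplicity at least $k$. Let $a,b$ be holomorphic functions on $D$ such that for all $z\in D$: (1) $b(z)\neq 0$; (2) $a(z)\neq b(z)$ and $b(z)-L_k(a)(z)\neq 0$. Suppose that for each $f\in\mathcal{F}$ there exist points $z_1^{(f)},z_2^{(f)},\ldots,z_{N_f}^{(f)}$ in $D$, with $N_f\leq q$, such that for all $z\in D\setminus\{z_1^{(f)},\ldots,z_{N_f}^{(f)}\}$: (i) $f(z)=a(z)$ if and only if $L_k(f)(z)=a(z)$; (ii) $f(z)=b(z)$ whenever $L_k(f)(z)=b(z)$. Then $\mathcal{F}$ is a quasi-normal family of order at most $q$ in $D$.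
   Context: A family $\mathcal{F}$ of holomorphic functions on a domain $D$ is called quasi-normal on $D$ if every sequence $\{f_n\}$ of functions in $\mathcal{F}$ has a subsequence which converges uniformly on compact subsets of $D\setminus E$, where $E\subset D$ is a set (which may depend on the sequence) with no accumulation points in $D$. Convergence here includes the possibility that the subsequence tends to $\infty$ uniformly on compact subsets. If $E$ can always be taken to satisfy $|E|\leq q$, then $\mathcal{F}$ is called quasi-normal of order (at most) $q$ in $D$. *)

theory Defs
  imports "HOL-Complex_Analysis.Complex_Analysis"
begin

definition linear_diff_op ::
    "(nat \<Rightarrow> complex \<Rightarrow> complex) \<Rightarrow> nat \<Rightarrow> (complex \<Rightarrow> complex) \<Rightarrow> complex \<Rightarrow> complex" where
  "linear_diff_op c k f z = (\<Sum>j\<le>k. c j z * (deriv ^^ j) f z)"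

(* The first disjunct gives a zero of a function vanishing identically near it infinite
   multiplicity; zorder is unspecified there. *)
definition zeros_mult_ge :: "nat \<Rightarrow> (complex \<Rightarrow> complex) \<Rightarrow> complex set \<Rightarrow> bool" where
  "zeros_mult_ge k f D \<longleftrightarrow>
     (\<forall>z\<in>D. f z = 0 \<longrightarrow> (\<forall>\<^sub>F w in nhds z. f w = 0) \<or> int k \<le> zorder f z)"

(* The second disjunct is locally uniform convergence to infinity. *)
definition converges_on_compacts :: "complex set \<Rightarrow> (nat \<Rightarrow> complex \<Rightarrow> complex) \<Rightarrow> bool" where
  "converges_on_compacts U f \<longleftrightarrow>
     (\<exists>g. \<forall>K. compact K \<longrightarrow> K \<subseteq> U \<longrightarrow> uniform_limit K f g sequentially) \<or>
     (\<forall>K. compact K \<longrightarrow> K \<subseteq> U \<longrightarrow> (\<forall>B. \<forall>\<^sub>F n in sequentially. \<forall>z\<in>K. B < cmod (f n z)))"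

(* Only the values on D of the functions matter. For finite E the condition on
   accumulation points is automatic; it is kept so that dropping the cardinality bound
   gives the definition of quasi-normality without an order. *)
definition quasi_normal_of_order_le ::
    "nat \<Rightarrow> complex set \<Rightarrow> (complex \<Rightarrow> complex) set \<Rightarrow> bool" where
  "quasi_normal_of_order_le q D \<F> \<longleftrightarrow>
     (\<forall>f :: nat \<Rightarrow> complex \<Rightarrow> complex. range f \<subseteq> \<F> \<longrightarrow>
        (\<exists>r E. strict_mono (r :: nat \<Rightarrow> nat) \<and> E \<subseteq> D \<and> (\<forall>z\<in>D. \<not> z islimpt E) \<and>
               finite E \<and> card E \<le> q \<and> converges_on_compacts (D - E) (f \<circ> r)))"

end

theory Submission
  imports Defs "HOL-Library.Diagonal_Subsequence"
begin

text \<open>The exceptional points are disposed of by compactness: after passing to a subsequence, each of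
  the at most \<open>q\<close> exceptional points of \<open>f n\<close> converges or leaves every compact subset of the plane.
  With \<open>E\<close> the set of their limits in \<open>D\<close>, every point of \<open>D - E\<close> has a neighbourhood in which almost
  all \<open>f n\<close> satisfy the hypotheses without exception. So it suffices to prove normality there; a
  diagonal argument over a countable base and the connectedness of \<open>D - E\<close> then give a subsequence that
  converges on the whole of \<open>D - E\<close> or tends to infinity there.

  Normality is proved by rescaling, \<open>\<zeta> \<mapsto> f n (z n + \<rho> n \<zeta>) / \<mu> n\<close>, as in the lemma of Zalcman and Pang.
  The difficulty is that \<open>a\<close> may vanish at the point in question to any order, so no fixed power
  of \<open>\<rho>\<close> is the right factor \<open>\<mu>\<close>. The factor used here is the weight
  \<open>\<rho> ^ k + (\<Sum>j<k. \<bar>(deriv ^^ j) a z\<bar> * \<rho> ^ j)\<close>, the size of \<open>a\<close> on the scale \<open>\<rho>\<close>. With it the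
  rescalings of \<open>a\<close> converge, by Taylor's formula, to a polynomial \<open>A\<close>, and \<open>\<rho> ^ k / \<mu>\<close> converges to a
  number \<open>\<kappa>\<close>, not both zero. The multiplicity of the zeros of \<open>f n\<close>, together with \<open>f n = a\<close>
  implying \<open>L f n = a\<close> where \<open>a\<close> vanishes, makes the rescaled spherical derivative of each single
  function small at small scales; a critical scale therefore exists, and Marty's criterion produces
  a nonconstant entire limit \<open>G\<close> (\<open>rescaling_limit\<close>).

  The bound for the derivative of \<open>G\<close> implies exponential type
  (\<open>exponential_growth_if_spherical_derivative_bounded\<close>): the value of \<open>ln \<bar>h\<bar>\<close> at a point where
  \<open>\<bar>h\<bar> > 1\<close> is controlled, through Harnack's inequality, by its gradient at the nearest point where
  \<open>\<bar>h\<bar> = 1\<close>. By Hurwitz's theorem the hypotheses on \<open>a\<close> and \<open>b\<close>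
  show that the \<open>k\<close>-th derivative of \<open>G\<close> omits a value or is constant, so \<open>G\<close> is a polynomial or
  of the form \<open>p + B exp (v \<zeta>)\<close> with a polynomial \<open>p\<close>. The former contradicts the normalisation of \<open>G\<close> at the
  origin. The latter has infinitely many zeros if \<open>p \<noteq> 0\<close>, by Picard's great theorem
  (\<open>infinite_zeros_poly_plus_exp\<close>), and each of them would be a zero of a fixed nonzero polynomial; the case \<open>p = 0\<close>, which remains for \<open>k \<ge> 2\<close>, is
  excluded by the points where \<open>G = A\<close> (\<open>normal_near_point_order_ge_2\<close>). For \<open>k = 1\<close> the argument is applied to \<open>f n - a\<close> instead
  of \<open>f n\<close>, with \<open>\<mu> = \<rho>\<close> (\<open>normal_near_point_order_1\<close>).\<close>

section \<open>Growth of functions with bounded spherical derivative\<close>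

text \<open>A Harnack inequality. Since \<open>ln \<bar>h\<bar>\<close> is the real part of a branch of the logarithm, which maps
  the disc into the right half-plane, it follows from the Schwarz lemma after a Cayley transform.\<close>

lemma ln_norm_Harnack:
  fixes h :: "complex \<Rightarrow> complex"
  assumes hol: "h holomorphic_on ball z d" and gt: "\<And>w. w \<in> ball z d \<Longrightarrow> 1 < norm (h w)"
    and w: "w \<in> ball z d"
  shows "ln (norm (h z)) * (d - dist z w) / (4 * d) \<le> ln (norm (h w))"
proof -
  have d: "0 < d" using w by (metis dist_not_less_zero less_trans linorder_neqE_linordered_idom mem_ball)
  obtain \<phi> where \<phi>: "\<phi> holomorphic_on ball z d" "\<And>w. w \<in> ball z d \<Longrightarrow> h w = exp (\<phi> w)"
    by (rule contractible_imp_holomorphic_log [OF hol]) (use gt in \<open>force simp: convex_imp_contractible\<close>)+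
  have Re: "Re (\<phi> v) = ln (norm (h v))" and Re_pos: "0 < Re (\<phi> v)" if "v \<in> ball z d" for v
  proof -
    show *: "Re (\<phi> v) = ln (norm (h v))" using \<phi>(2)[OF that] by simp
    show "0 < Re (\<phi> v)" using gt[OF that] * by (simp add: ln_gt_zero)
  qed
  have z: "z \<in> ball z d" using d by simp
  \<comment> \<open>a Cayley transform of \<open>\<phi>\<close>, mapping the unit disc into itself and fixing 0\<close>
  define m where "m \<zeta> = (\<phi> (z + of_real d * \<zeta>) - \<phi> z) / (\<phi> (z + of_real d * \<zeta>) + cnj (\<phi> z))" for \<zeta>
  have inb: "z + of_real d * \<zeta> \<in> ball z d" if "norm \<zeta> < 1" for \<zeta>
    using that d by (simp add: dist_norm norm_mult)
  have ident: "(norm (x + cnj y))\<^sup>2 - (norm (x - y))\<^sup>2 = 4 * Re x * Re y" for x y :: complex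
    unfolding cmod_power2 by (simp add: power2_eq_square algebra_simps)
  have nz: "\<phi> v + cnj (\<phi> z) \<noteq> 0" if "v \<in> ball z d" for v
  proof -
    have "Re (\<phi> v + cnj (\<phi> z)) > 0" using Re_pos[OF that] Re_pos[OF z] by simp
    then show ?thesis by (metis less_irrefl zero_complex.simps(1))
  qed
  have less: "norm (\<phi> v - \<phi> z) < norm (\<phi> v + cnj (\<phi> z))" if "v \<in> ball z d" for v
  proof -
    have "(norm (\<phi> v - \<phi> z))\<^sup>2 < (norm (\<phi> v + cnj (\<phi> z)))\<^sup>2"
      using ident[of "\<phi> v" "\<phi> z"] mult_pos_pos[OF Re_pos[OF that] Re_pos[OF z]] by simp
    then show ?thesis by (simp add: power2_less_imp_less)
  qed
  have "m holomorphic_on ball 0 1"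
  proof -
    have "(\<phi> \<circ> (\<lambda>\<zeta>. z + of_real d * \<zeta>)) holomorphic_on ball 0 1"
      by (rule holomorphic_on_compose_gen [OF _ \<phi>(1)]) (use inb in \<open>auto intro!: holomorphic_intros\<close>)
    then have "(\<lambda>\<zeta>. \<phi> (z + of_real d * \<zeta>)) holomorphic_on ball 0 1" by (simp add: o_def)
    then show ?thesis unfolding m_def
      by (intro holomorphic_intros) (use inb nz in auto)
  qed
  moreover have "m 0 = 0" by (simp add: m_def)
  moreover have "norm (m \<zeta>) < 1" if "norm \<zeta> < 1" for \<zeta>
    using less[OF inb[OF that]] nz[OF inb[OF that]] by (simp add: m_def norm_divide divide_simps)
  moreover define \<xi> where "\<xi> = (w - z) / of_real d"
  define s where "s = norm \<xi>"
  have s: "s = dist z w / d" using d by (simp add: s_def \<xi>_def norm_divide dist_norm norm_minus_commute)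
  have s01: "0 \<le> s" "s < 1" using w d by (auto simp: s)
  ultimately have "norm (m \<xi>) \<le> s"
    using Schwarz_Lemma(1)[of m \<xi>] s01 s_def by auto
  moreover have wx: "z + of_real d * \<xi> = w" using d by (simp add: \<xi>_def)
  ultimately have le: "norm (\<phi> w - \<phi> z) \<le> s * norm (\<phi> w + cnj (\<phi> z))"
    using nz[OF w] by (simp add: m_def norm_divide divide_simps)
  define p P where "p = Re (\<phi> w)" and "P = Re (\<phi> z)"
  have pP: "0 < p" "0 < P" using Re_pos w z by (auto simp: p_def P_def)
  have "(norm (\<phi> w - \<phi> z))\<^sup>2 \<le> s\<^sup>2 * (norm (\<phi> w + cnj (\<phi> z)))\<^sup>2"
    using power_mono[OF le, of 2] by (simp add: power_mult_distrib)
  then have 1: "(1 - s\<^sup>2) * (norm (\<phi> w + cnj (\<phi> z)))\<^sup>2 \<le> 4 * p * P"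
    using ident[of "\<phi> w" "\<phi> z"] by (simp add: p_def P_def algebra_simps)
  have "P \<le> norm (\<phi> w + cnj (\<phi> z))"
    using complex_Re_le_cmod[of "\<phi> w + cnj (\<phi> z)"] pP by (simp add: p_def P_def)
  then have "P\<^sup>2 \<le> (norm (\<phi> w + cnj (\<phi> z)))\<^sup>2" using pP by (simp add: power_mono)
  then have "(1 - s\<^sup>2) * P\<^sup>2 \<le> (1 - s\<^sup>2) * (norm (\<phi> w + cnj (\<phi> z)))\<^sup>2"
    using s01 by (intro mult_left_mono) (auto simp: power_le_one)
  with 1 have "((1 - s\<^sup>2) * P) * P \<le> (4 * p) * P" by (simp add: power2_eq_square mult.assoc)
  then have 2: "(1 - s\<^sup>2) * P \<le> 4 * p" using pP mult_le_cancel_right_pos by blast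
  have "s\<^sup>2 \<le> s" using s01 by (simp add: power2_eq_square mult_left_le_one_le)
  then have "(1 - s) * P \<le> (1 - s\<^sup>2) * P" using pP by (intro mult_right_mono) auto
  with 2 have "(1 - s) * P \<le> 4 * p" by simp
  then have "P * (1 - s) / 4 \<le> p" by (simp add: mult.commute)
  moreover have "P * (1 - s) / 4 = P * (d - dist z w) / (4 * d)"
    using d by (simp add: s divide_simps)
  ultimately show ?thesis using Re w z by (simp add: p_def P_def)
qed

text \<open>A Hopf-type estimate: by Harnack's inequality \<open>ln \<bar>h\<bar>\<close> grows at least linearly away from a
  boundary point of the disc at which it vanishes, so its gradient there controls its value at the
  centre.\<close>

lemma ln_norm_le_deriv_at_boundary:
  fixes h :: "complex \<Rightarrow> complex"
  assumes hol: "h holomorphic_on ball z d" and gt: "\<And>w. w \<in> ball z d \<Longrightarrow> 1 < norm (h w)"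
    and d: "0 < d" and \<xi>: "dist z \<xi> = d" "norm (h \<xi>) \<le> 1" and D: "(h has_field_derivative h') (at \<xi>)"
  shows "ln (norm (h z)) \<le> 4 * d * norm h'"
proof -
  define w where "w s = \<xi> + of_real s * (z - \<xi>)" for s :: real
  have zx: "norm (z - \<xi>) = d" using \<xi> by (simp add: dist_norm)
  then have "z - \<xi> \<noteq> 0" using d by auto
  have lim: "filterlim w (at \<xi>) (at_right 0)"
    unfolding filterlim_at
  proof
    show "\<forall>\<^sub>F s in at_right 0. w s \<in> UNIV \<and> w s \<noteq> \<xi>"
      using \<open>z - \<xi> \<noteq> 0\<close> by (auto simp: w_def eventually_at intro!: exI[of _ 1])
    have "((\<lambda>s. \<xi> + of_real s * (z - \<xi>)) \<longlongrightarrow> \<xi> + of_real 0 * (z - \<xi>)) (at_right 0)"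
      by (intro tendsto_intros)
    then show "(w \<longlongrightarrow> \<xi>) (at_right 0)" by (simp add: w_def[abs_def])
  qed
  have "((\<lambda>v. (h v - h \<xi>) / (v - \<xi>)) \<longlongrightarrow> h') (at \<xi>)"
    using D by (simp add: has_field_derivative_iff)
  then have L: "((\<lambda>s. norm ((h (w s) - h \<xi>) / (w s - \<xi>))) \<longlongrightarrow> norm h') (at_right 0)"
    by (intro tendsto_norm filterlim_compose[OF _ lim])
  have "\<forall>\<^sub>F s in at_right 0. ln (norm (h z)) / (4 * d) \<le> norm ((h (w s) - h \<xi>) / (w s - \<xi>))"
  proof -
    have *: "ln (norm (h z)) / (4 * d) \<le> norm ((h (w s) - h \<xi>) / (w s - \<xi>))" if s: "0 < s" "s < 1" for s
    proof -
      have "z - w s = of_real (1 - s) * (z - \<xi>)" by (simp add: w_def algebra_simps)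
      then have dz: "dist z (w s) = (1 - s) * d"
        using s zx by (simp add: dist_norm norm_mult flip: of_real_diff)
      then have wb: "w s \<in> ball z d" using s d by (simp add: mult_less_cancel_right1)
      have "ln (norm (h z)) * (d - dist z (w s)) / (4 * d) \<le> ln (norm (h (w s)))"
        by (rule ln_norm_Harnack[OF hol gt wb])
      also have "d - dist z (w s) = s * d" by (simp add: dz algebra_simps)
      also have "ln (norm (h (w s))) \<le> norm (h (w s)) - 1"
        using gt[OF wb] by (intro ln_le_minus_one) auto
      also have "\<dots> \<le> norm (h (w s) - h \<xi>)"
        using \<xi>(2) norm_triangle_ineq2[of "h (w s)" "h \<xi>"] by linarith
      finally have "ln (norm (h z)) * (s * d) / (4 * d) \<le> norm (h (w s) - h \<xi>)" .
      moreover have "norm (w s - \<xi>) = s * d" using s zx by (simp add: w_def norm_mult)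
      ultimately show ?thesis using s d by (simp add: norm_divide field_simps)
    qed
    show ?thesis unfolding eventually_at by (rule exI[of _ 1]) (use * in \<open>auto simp: dist_norm\<close>)
  qed
  then have "ln (norm (h z)) / (4 * d) \<le> norm h'"
    using tendsto_lowerbound[OF L] by auto
  then show ?thesis using d by (simp add: field_simps)
qed

text \<open>A variant of the theorem of Clunie and Hayman. Around a point \<open>z\<close> with \<open>\<bar>h z\<bar> > 1\<close> take the
  largest disc on which \<open>\<bar>h\<bar> > 1\<close>; its radius is at most \<open>\<bar>z\<bar>\<close>. If its boundary meets the set
  where \<open>\<bar>h\<bar> \<le> 1\<close>, the Hopf-type estimate applies at the contact point. Otherwise the disc reaches
  the inner boundary, near which \<open>h\<close> is bounded, and Harnack's inequality suffices.\<close>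

lemma exponential_growth_if_spherical_derivative_bounded:
  fixes h :: "complex \<Rightarrow> complex"
  assumes hol: "h holomorphic_on {z. R < norm z}" and R: "0 \<le> R" and C: "0 \<le> C"
    and bd: "\<And>z. R < norm z \<Longrightarrow> norm (deriv h z) \<le> C * (1 + (norm (h z))\<^sup>2)"
  shows "\<exists>K\<ge>0. \<forall>z. R + 1 \<le> norm z \<longrightarrow> norm (h z) \<le> exp (K * norm z)"
proof -
  have op: "open {z::complex. R < norm z}"
    by (intro open_Collect_less continuous_intros)
  have cont: "continuous_on {z. R < norm z} h" by (rule holomorphic_on_imp_continuous_on[OF hol])
  have "compact (h ` sphere 0 (R + 1))"
    by (intro compact_continuous_image continuous_on_subset[OF cont]) auto
  then have "bounded (h ` sphere 0 (R + 1))" by (rule compact_imp_bounded)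
  then obtain M0 where "\<forall>x \<in> h ` sphere 0 (R + 1). norm x \<le> M0" unfolding bounded_iff by blast
  then have M0: "\<And>z. norm z = R + 1 \<Longrightarrow> norm (h z) \<le> M0" by simp
  define M where "M = max 1 M0"
  have M: "1 \<le> M" "\<And>z. norm z = R + 1 \<Longrightarrow> norm (h z) \<le> M" using M0 by (force simp: M_def)+
  define K where "K = 8 * C + 4 * ln M"
  have lnM: "0 \<le> ln M" using M by simp
  have "norm (h z) \<le> exp (K * norm z)" if z: "R + 1 \<le> norm z" for z
  proof (cases "norm (h z) \<le> 1")
    case True
    then show ?thesis using C lnM by (smt (verit) K_def mult_nonneg_nonneg norm_ge_zero one_le_exp_iff)
  next
    case hz: False
    have D0: "1 \<le> norm z - R" using z by simp
    have sub: "ball z (norm z - R) \<subseteq> {z. R < norm z}"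
    proof
      fix w assume "w \<in> ball z (norm z - R)"
      then have "norm (z - w) < norm z - R" by (simp add: dist_norm)
      then show "w \<in> {z. R < norm z}" using norm_triangle_ineq2[of z w] by simp
    qed
    have "ln (norm (h z)) \<le> K * norm z"
    proof (cases "\<exists>\<xi>1 \<in> ball z (norm z - R). norm (h \<xi>1) \<le> 1")
      case True
      then obtain \<xi>1 where \<xi>1: "\<xi>1 \<in> ball z (norm z - R)" "norm (h \<xi>1) \<le> 1" by auto
      define S where "S = {w \<in> cball z (dist z \<xi>1). norm (h w) \<le> 1}"
      have csub: "cball z (dist z \<xi>1) \<subseteq> ball z (norm z - R)" using \<xi>1 by auto
      have "closed S" unfolding S_def
        by (intro continuous_on_closed_Collect_le continuous_intros continuous_on_subset[OF cont]
            order_trans[OF csub sub] closed_cball)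
      moreover have "S \<subseteq> cball z (dist z \<xi>1)" by (auto simp: S_def)
      ultimately have "compact S" using bounded_subset[OF bounded_cball] compact_eq_bounded_closed by blast
      moreover have "S \<noteq> {}" using \<xi>1 by (auto simp: S_def)
      moreover have "continuous_on S (dist z)" by (intro continuous_intros)
      ultimately obtain \<xi> where \<xi>: "\<xi> \<in> S" "\<And>w. w \<in> S \<Longrightarrow> dist z \<xi> \<le> dist z w"
        using continuous_attains_inf[of S "dist z"] by blast
      have \<xi>b: "\<xi> \<in> ball z (norm z - R)" "norm (h \<xi>) \<le> 1" using \<xi> csub by (auto simp: S_def)
      have gt: "1 < norm (h w)" if "w \<in> ball z (dist z \<xi>)" for w
      proof (rule ccontr)
        assume "\<not> 1 < norm (h w)"
        then have "w \<in> S" using that \<xi>(1) by (auto simp: S_def)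
        then show False using \<xi>(2)[of w] that by simp
      qed
      have dp: "0 < dist z \<xi>" using \<xi>b hz by auto
      have R\<xi>: "R < norm \<xi>" using \<xi>b sub by auto
      have "(h has_field_derivative deriv h \<xi>) (at \<xi>)"
        using holomorphic_derivI[OF hol op, of \<xi>] R\<xi> by simp
      moreover have "ball z (dist z \<xi>) \<subseteq> {z. R < norm z}"
        using \<xi>b(1) subset_ball[of "dist z \<xi>" "norm z - R" z] sub by auto
      ultimately have "ln (norm (h z)) \<le> 4 * dist z \<xi> * norm (deriv h \<xi>)"
        using ln_norm_le_deriv_at_boundary[of h z "dist z \<xi>" \<xi>] gt dp \<xi>b hol holomorphic_on_subset by blast
      also have "norm (deriv h \<xi>) \<le> C * (1 + (norm (h \<xi>))\<^sup>2)" by (rule bd[OF R\<xi>])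
      also have "\<dots> \<le> C * (1 + 1)"
        using \<xi>b C by (intro mult_left_mono add_left_mono) (auto simp: power_le_one)
      finally have "ln (norm (h z)) \<le> 8 * C * dist z \<xi>" using dp by (simp add: mult_left_mono algebra_simps)
      also have "\<dots> \<le> 8 * C * norm z" using \<xi>b C R by (intro mult_left_mono) auto
      also have "\<dots> \<le> K * norm z" using lnM by (intro mult_right_mono) (auto simp: K_def)
      finally show ?thesis .
    next
      case False
      \<comment> \<open>the point of the circle of radius \<open>R + 1\<close> closest to \<open>z\<close>; there \<open>h\<close> is bounded by \<open>M\<close>\<close>
      define w where "w = of_real ((R + 1) / norm z) * z"
      have z0: "0 < norm z" using z R by linarith
      have nw: "norm w = R + 1" using z0 R by (simp add: w_def norm_mult norm_divide)
      have "z - w = of_real (1 - (R + 1) / norm z) * z" by (simp add: w_def algebra_simps)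
      then have "norm (z - w) = \<bar>1 - (R + 1) / norm z\<bar> * norm z" by (simp only: norm_mult norm_of_real)
      also have "\<dots> = norm z - (R + 1)" using z z0 by (simp add: abs_mult_pos' field_simps)
      finally have dw: "dist z w = norm z - (R + 1)" by (simp add: dist_norm)
      have "ln (norm (h z)) * ((norm z - R) - dist z w) / (4 * (norm z - R)) \<le> ln (norm (h w))"
        by (rule ln_norm_Harnack) (use False hol sub holomorphic_on_subset dw in \<open>auto simp: not_le\<close>)
      also have "ln (norm (h w)) \<le> ln M"
      proof -
        have "w \<in> ball z (norm z - R)" using dw by simp
        then have "1 < norm (h w)" using False by (auto simp: not_le)
        then show ?thesis using M(2)[OF nw] by (subst ln_le_cancel_iff) auto
      qed
      finally have "ln (norm (h z)) / (4 * (norm z - R)) \<le> ln M" by (simp add: dw)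
      then have "ln (norm (h z)) \<le> 4 * ln M * (norm z - R)" using D0 by (simp add: field_simps)
      also have "\<dots> \<le> 4 * ln M * norm z" using R lnM by (intro mult_left_mono) auto
      also have "\<dots> \<le> K * norm z" using C by (intro mult_right_mono) (auto simp: K_def)
      finally show ?thesis .
    qed
    then have "exp (ln (norm (h z))) \<le> exp (K * norm z)" by simp
    moreover have "exp (ln (norm (h z))) = norm (h z)" by (rule exp_ln) (use hz in linarith)
    ultimately show ?thesis by simp
  qed
  moreover have "0 \<le> K" using C lnM by (simp add: K_def)
  ultimately show ?thesis by blast
qed

section \<open>Entire functions of exponential type with an omitted derivative value\<close>

text \<open>A form of the Borel--Caratheodory theorem.\<close>

lemma entire_affine_if_Re_le_affine:
  fixes \<phi> :: "complex \<Rightarrow> complex"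
  assumes hol: "\<phi> holomorphic_on UNIV" and le: "\<And>z. Re (\<phi> z) \<le> K * (1 + norm z)"
  shows "\<exists>u v. \<forall>z. \<phi> z = u + v * z"
proof -
  define \<psi> where "\<psi> z = \<phi> z - \<phi> 0" for z
  define L where "L = \<bar>K\<bar> + \<bar>Re (\<phi> 0)\<bar> + 1"
  have L: "0 < L" by (simp add: L_def add_nonneg_pos)
  have hol\<psi>: "\<psi> holomorphic_on S" for S
    unfolding \<psi>_def by (intro holomorphic_intros holomorphic_on_subset[OF hol]) auto
  have Re\<psi>: "Re (\<psi> z) < L * (1 + norm z)" for z
  proof -
    have "K * (1 + norm z) \<le> \<bar>K\<bar> * (1 + norm z)" by (intro mult_right_mono) auto
    moreover have "(\<bar>Re (\<phi> 0)\<bar> + 1) * 1 \<le> (\<bar>Re (\<phi> 0)\<bar> + 1) * (1 + norm z)" by (intro mult_left_mono) auto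
    moreover have "L * (1 + norm z) = \<bar>K\<bar> * (1 + norm z) + (\<bar>Re (\<phi> 0)\<bar> + 1) * (1 + norm z)"
      by (simp add: L_def algebra_simps)
    ultimately show ?thesis using le[of z] by (simp add: \<psi>_def)
  qed
  have bd: "norm (\<psi> z) \<le> 6 * L * norm z ^ 1" if z: "1 \<le> norm z" for z
  proof -
    define r where "r = 2 * norm z"
    define M where "M = L * (1 + r)"
    have r: "0 < r" using z by (auto simp: r_def)
    have M: "0 < M" using L r by (simp add: M_def)
    have ReM: "Re (\<psi> (of_real r * \<zeta>)) < M" if "norm \<zeta> < 1" for \<zeta>
    proof -
      have "norm (of_real r * \<zeta>) \<le> r" using that r by (simp add: norm_mult mult_left_le)
      then have "L * (1 + norm (of_real r * \<zeta>)) \<le> M" unfolding M_def using L by (intro mult_left_mono) auto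
      then show ?thesis using Re\<psi>[of "of_real r * \<zeta>"] by simp
    qed
    \<comment> \<open>\<open>y \<mapsto> y / (2 M - y)\<close> maps the half-plane \<open>Re y < M\<close> onto the unit disc\<close>
    define f where "f \<zeta> = \<psi> (of_real r * \<zeta>) / (2 * of_real M - \<psi> (of_real r * \<zeta>))" for \<zeta>
    have nz: "2 * of_real M - \<psi> (of_real r * \<zeta>) \<noteq> 0" if "norm \<zeta> < 1" for \<zeta>
    proof
      assume "2 * of_real M - \<psi> (of_real r * \<zeta>) = 0"
      then have "Re (2 * of_real M - \<psi> (of_real r * \<zeta>)) = 0" by simp
      then show False using ReM[OF that] M by simp
    qed
    have "(\<psi> \<circ> (\<lambda>\<zeta>. of_real r * \<zeta>)) holomorphic_on ball 0 1"
      by (rule holomorphic_on_compose_gen[OF _ hol\<psi>[of UNIV]]) (auto intro!: holomorphic_intros)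
    then have "f holomorphic_on ball 0 1" unfolding f_def o_def
      by (intro holomorphic_intros) (use nz in auto)
    moreover have "f 0 = 0" by (simp add: f_def \<psi>_def)
    moreover have "norm (f \<zeta>) < 1" if "norm \<zeta> < 1" for \<zeta>
    proof -
      have "(norm (2 * of_real M - y))\<^sup>2 - (norm y)\<^sup>2 = 4 * M * (M - Re y)" for y
        unfolding cmod_power2 by (simp add: power2_eq_square algebra_simps)
      moreover have "0 < 4 * M * (M - Re (\<psi> (of_real r * \<zeta>)))" using ReM[OF that] M by simp
      ultimately have "(norm (\<psi> (of_real r * \<zeta>)))\<^sup>2 < (norm (2 * of_real M - \<psi> (of_real r * \<zeta>)))\<^sup>2"
        by (metis diff_gt_0_iff_gt)
      then have "norm (\<psi> (of_real r * \<zeta>)) < norm (2 * of_real M - \<psi> (of_real r * \<zeta>))"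
        by (simp add: power2_less_imp_less)
      then show ?thesis using nz[OF that] by (simp add: f_def norm_divide divide_simps)
    qed
    moreover define \<xi> where "\<xi> = z / of_real r"
    have n\<xi>: "norm \<xi> = 1 / 2" using z by (auto simp: \<xi>_def r_def norm_divide divide_simps)
    ultimately have "norm (f \<xi>) \<le> 1/2" using Schwarz_Lemma(1)[of f \<xi>] by auto
    moreover have rx: "of_real r * \<xi> = z" using r by (simp add: \<xi>_def)
    ultimately have "norm (\<psi> z) \<le> norm (2 * of_real M - \<psi> z) / 2"
      using nz[of \<xi>] n\<xi> by (simp add: f_def norm_divide divide_simps)
    also have "\<dots> \<le> (2 * M + norm (\<psi> z)) / 2"
      using norm_triangle_ineq4[of "2 * of_real M" "\<psi> z"] M by (simp add: norm_mult)
    finally have "norm (\<psi> z) \<le> 2 * M" by (simp add: field_simps)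
    also have "\<dots> \<le> 6 * L * norm z" using z L by (simp add: M_def r_def algebra_simps)
    finally show ?thesis by simp
  qed
  have L1: "\<psi> z = (\<Sum>k\<le>1. (deriv ^^ k) \<psi> 0 / fact k * z ^ k)" for z
    by (rule Liouville_polynomial[OF hol\<psi> bd])
  have aff: "\<psi> z = \<psi> 0 + deriv \<psi> 0 * z" for z using L1[of z] by simp
  have "\<phi> z = \<phi> 0 + deriv \<psi> 0 * z" for z
  proof -
    have "\<phi> z = \<phi> 0 + \<psi> z" "\<psi> 0 = 0" by (simp_all add: \<psi>_def)
    then show ?thesis using aff[of z] by (simp only: add_0)
  qed
  then show ?thesis by blast
qed

text \<open>A zero-free entire function of exponential type is the exponential of an affine function.\<close>

lemma higher_deriv_eq_const_plus_exp:
  fixes G :: "complex \<Rightarrow> complex"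
  assumes hol: "G holomorphic_on UNIV" and bd: "\<And>z. norm (G z) \<le> B * exp (K * norm z)"
    and K: "0 \<le> K" and nz: "\<And>z. (deriv ^^ k) G z \<noteq> \<beta>"
  shows "\<exists>u v. \<forall>z. (deriv ^^ k) G z = \<beta> + exp (u + v * z)"
proof -
  define F where "F z = (deriv ^^ k) G z - \<beta>" for z
  have holF: "F holomorphic_on UNIV"
    unfolding F_def by (intro holomorphic_intros holomorphic_higher_deriv hol) auto
  have "contractible (UNIV :: complex set)" by (simp add: convex_imp_contractible)
  then obtain \<phi> where \<phi>: "\<phi> holomorphic_on UNIV" "\<And>z. F z = exp (\<phi> z)"
    using contractible_imp_holomorphic_log[OF holF] nz by (metis F_def UNIV_I right_minus_eq)
  have B: "0 \<le> B" using order_trans[OF norm_ge_zero bd[of 0]] by simp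
  define B2 where "B2 = fact k * B * exp K + norm \<beta> + 1"
  have B2: "1 \<le> B2" using B by (simp add: B2_def)
  have "Re (\<phi> z) \<le> (ln B2 + K) * (1 + norm z)" for z
  proof -
    have "norm ((deriv ^^ k) G z) \<le> fact k * (B * exp (K * (norm z + 1))) / 1 ^ k"
    proof (rule Cauchy_inequality)
      show "G holomorphic_on ball z 1" "continuous_on (cball z 1) G"
        using hol holomorphic_on_subset holomorphic_on_imp_continuous_on continuous_on_subset by blast+
      fix x assume "norm (z - x) = 1"
      then have "norm x \<le> norm z + 1" using norm_triangle_ineq3[of z x] by linarith
      then have "K * norm x \<le> K * (norm z + 1)" using K by (rule mult_left_mono)
      then show "norm (G x) \<le> B * exp (K * (norm z + 1))"
        using bd[of x] B by (smt (verit) exp_le_cancel_iff mult_left_mono)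
    qed simp
    then have "norm (F z) \<le> fact k * B * exp K * exp (K * norm z) + norm \<beta>"
      using norm_triangle_ineq4[of "(deriv ^^ k) G z" \<beta>]
      by (simp add: F_def exp_add distrib_left mult_ac)
    also have "\<dots> \<le> (fact k * B * exp K + norm \<beta>) * exp (K * norm z)"
      using K by (simp add: distrib_right mult_left_mono[of 1 _ "norm \<beta>", simplified])
    also have "\<dots> \<le> B2 * exp (K * norm z)" by (intro mult_right_mono) (auto simp: B2_def)
    finally have "exp (Re (\<phi> z)) \<le> B2 * exp (K * norm z)" by (simp add: \<phi>(2))
    also have "\<dots> = exp (ln B2 + K * norm z)" using B2 by (simp add: exp_add)
    finally have "Re (\<phi> z) \<le> ln B2 + K * norm z" by simp
    also have "\<dots> \<le> (ln B2 + K) * (1 + norm z)" using B2 K by (simp add: algebra_simps)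
    finally show ?thesis .
  qed
  then obtain u v where "\<And>z. \<phi> z = u + v * z" using entire_affine_if_Re_le_affine[OF \<phi>(1)] by metis
  then show ?thesis using \<phi>(2) by (metis F_def add.commute diff_add_cancel)
qed

lemma entire_polynomial_if_higher_deriv_0:
  fixes F :: "complex \<Rightarrow> complex"
  assumes hol: "F holomorphic_on UNIV" and 0: "\<And>z. (deriv ^^ Suc k) F z = 0"
  shows "\<exists>p. F = poly p"
proof -
  define c where "c i = (deriv ^^ i) F 0 / fact i" for i
  define p where "p = (\<Sum>i\<le>k. monom (c i) i)"
  have "(deriv ^^ (j + Suc k)) F = (\<lambda>z. 0)" for j
  proof (induction j)
    case 0
    show ?case using assms(2) by auto
  next
    case (Suc j)
    have "(deriv ^^ (Suc j + Suc k)) F = deriv ((deriv ^^ (j + Suc k)) F)" by simp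
    also have "\<dots> = (\<lambda>z. 0)" by (simp only: Suc deriv_const)
    finally show ?case .
  qed
  then have c0: "c i = 0" if "i > k" for i
    using that by (metis c_def add.commute divide_eq_0_iff less_iff_Suc_add add_Suc_right add_Suc)
  have "F z = poly p z" for z
  proof -
    have "(\<lambda>n. c n * (z - 0) ^ n) sums F z" unfolding c_def
      by (rule holomorphic_power_series[of F 0 "norm z + 1"]) (use hol holomorphic_on_subset in auto)
    moreover have "(\<lambda>n. c n * (z - 0) ^ n) sums (\<Sum>n\<le>k. c n * (z - 0) ^ n)"
      by (rule sums_finite) (auto simp: c0)
    ultimately have "F z = (\<Sum>n\<le>k. c n * z ^ n)" using sums_unique2 by fastforce
    then show ?thesis by (simp add: p_def poly_sum poly_monom)
  qed
  then show ?thesis by blast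
qed

lemma higher_deriv_poly: "(deriv ^^ n) (poly p) = poly ((pderiv ^^ n) p)" for p :: "complex poly"
proof (induction n)
  case (Suc n)
  have "deriv (poly q) = poly (pderiv q)" for q :: "complex poly"
    by (auto intro!: DERIV_imp_deriv poly_DERIV)
  with Suc show ?case by simp
qed auto

lemma higher_deriv_const_exp: "(deriv ^^ n) (\<lambda>z. B * exp (v * z)) = (\<lambda>z. B * v ^ n * exp (v * z))"
  for B v :: complex
proof (induction n)
  case (Suc n)
  have "deriv (\<lambda>z. B * v ^ n * exp (v * z)) z = B * v ^ Suc n * exp (v * z)" for z
    by (rule DERIV_imp_deriv) (auto intro!: derivative_eq_intros)
  then show ?case by (simp add: Suc fun_eq_iff)
qed auto

lemma entire_eq_poly_plus_exp:
  fixes G :: "complex \<Rightarrow> complex"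
  assumes hol: "G holomorphic_on UNIV" and eq: "\<And>z. (deriv ^^ k) G z = \<beta> + exp (u + v * z)" and v: "v \<noteq> 0"
  obtains p B where "B \<noteq> 0" "\<And>z. G z = poly p z + B * exp (v * z)" "\<And>z. (deriv ^^ k) (poly p) z = \<beta>"
proof -
  define B where "B = exp u / v ^ k"
  define F where "F z = G z - B * exp (v * z)" for z
  have holF: "F holomorphic_on UNIV" unfolding F_def by (intro holomorphic_intros hol)
  have "(deriv ^^ k) F z = (deriv ^^ k) G z - (deriv ^^ k) (\<lambda>z. B * exp (v * z)) z" for z
    unfolding F_def by (rule higher_deriv_diff[of _ UNIV]) (auto intro!: holomorphic_intros hol)
  then have "(deriv ^^ k) F z = \<beta>" for z
    using v fun_cong[OF higher_deriv_const_exp[of k B v], of z] by (simp add: eq B_def exp_add)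
  then have "(deriv ^^ k) F = (\<lambda>z. \<beta>)" by auto
  then have "(deriv ^^ Suc k) F z = 0" for z by simp
  then obtain p where p: "F = poly p"
    using entire_polynomial_if_higher_deriv_0[OF holF] by blast
  show ?thesis
  proof (rule that[of B p])
    show "B \<noteq> 0" using v by (simp add: B_def)
    show "G z = poly p z + B * exp (v * z)" for z using fun_cong[OF p, of z] by (simp add: F_def diff_eq_eq)
    show "(deriv ^^ k) (poly p) z = \<beta>" for z using \<open>(deriv ^^ k) F = (\<lambda>z. \<beta>)\<close> by (simp add: p)
  qed
qed

lemma poly_norm_upper_bound:
  fixes p :: "complex poly"
  assumes "1 \<le> norm z" "degree p \<le> n"
  shows "norm (poly p z) \<le> (\<Sum>i\<le>degree p. norm (coeff p i)) * norm z ^ n"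
proof -
  have "norm (poly p z) \<le> (\<Sum>i\<le>degree p. norm (coeff p i * z ^ i))"
    unfolding poly_altdef by (rule norm_sum)
  also have "\<dots> \<le> (\<Sum>i\<le>degree p. norm (coeff p i) * norm z ^ n)"
    using assms by (intro sum_mono) (auto simp: norm_mult norm_power intro!: mult_left_mono power_increasing)
  finally show ?thesis by (simp add: sum_distrib_right)
qed

lemma poly_norm_lower_bound:
  fixes p :: "complex poly"
  assumes "p \<noteq> 0"
  shows "\<exists>c>0. \<exists>R\<ge>1. \<forall>z. R \<le> norm z \<longrightarrow> c * norm z ^ degree p \<le> norm (poly p z)"
proof -
  define d where "d = degree p"
  define l where "l = norm (lead_coeff p)"
  have l: "0 < l" using assms by (simp add: l_def)
  define S where "S = (\<Sum>i<d. norm (coeff p i))"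
  have S: "0 \<le> S" by (simp add: S_def sum_nonneg)
  have "l / 2 * norm z ^ d \<le> norm (poly p z)" if z: "max 1 (2 * S / l) \<le> norm z" for z
  proof -
    have z1: "1 \<le> norm z" using z by simp
    have "poly p z = lead_coeff p * z ^ d + (\<Sum>i<d. coeff p i * z ^ i)"
      unfolding poly_altdef d_def by (simp add: lessThan_Suc_atMost[symmetric])
    then have "norm (poly p z) \<ge> norm (lead_coeff p * z ^ d) - norm (\<Sum>i<d. coeff p i * z ^ i)"
      by (metis add_diff_cancel_right' norm_triangle_ineq4 diff_le_eq)
    moreover have "norm (\<Sum>i<d. coeff p i * z ^ i) \<le> l / 2 * norm z ^ d"
    proof (cases d)
      case (Suc m)
      have "norm (\<Sum>i<d. coeff p i * z ^ i) \<le> (\<Sum>i<d. norm (coeff p i * z ^ i))" by (rule norm_sum)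
      also have "\<dots> \<le> (\<Sum>i<d. norm (coeff p i) * norm z ^ m)"
        using z1 Suc by (intro sum_mono) (auto simp: norm_mult norm_power intro!: mult_left_mono power_increasing)
      also have "\<dots> = S * norm z ^ m" by (simp add: S_def sum_distrib_right)
      also have "\<dots> \<le> (l / 2 * norm z) * norm z ^ m"
        using z l by (intro mult_right_mono) (auto simp: field_simps)
      finally show ?thesis by (simp add: Suc mult_ac)
    qed (use l in auto)
    ultimately show ?thesis by (simp add: l_def norm_mult norm_power)
  qed
  then show ?thesis using l
    by (intro exI[of _ "l/2"] conjI exI[of _ "max 1 (2 * S / l)"] allI impI) (auto simp: d_def)
qed

lemma poly_eq_const_if_no_zeros:
  fixes p :: "complex poly"
  assumes "\<And>z. poly p z \<noteq> 0" shows "\<exists>c. p = [:c:]"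
proof (cases "degree p = 0")
  case True
  then show ?thesis by (metis degree_eq_zeroE)
next
  case False
  then have "degree p \<in> {1..degree p}" "coeff p (degree p) \<noteq> 0" by auto
  then obtain z where "(\<Sum>i\<le>degree p. coeff p i * z ^ i) = 0"
    using fundamental_theorem_of_algebra[of "coeff p" "degree p"] by blast
  then show ?thesis using assms[of z] by (simp add: poly_altdef)
qed

lemma exp_not_polynomial:
  assumes "\<And>z. exp (v * z) = poly q z" shows "v = (0::complex)"
proof -
  have "poly q z \<noteq> 0" for z by (subst assms[symmetric]) simp
  then obtain c where c: "q = [:c:]" using poly_eq_const_if_no_zeros by blast
  have "exp (v * z) = c" for z by (subst assms) (simp add: c)
  then have "(\<lambda>z. exp (v * z)) = (\<lambda>z. c)" by blast
  moreover have "((\<lambda>z. exp (v * z)) has_field_derivative v) (at 0)"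
    by (auto intro!: derivative_eq_intros)
  ultimately have "((\<lambda>z. c) has_field_derivative v) (at 0)" by simp
  then show ?thesis using DERIV_const DERIV_unique by blast
qed

text \<open>The function \<open>w \<mapsto> p (1 / w) exp (- v / w)\<close> has an essential singularity at the origin, since
  otherwise \<open>exp\<close> would be a polynomial. By Picard's great theorem it takes all values but one
  infinitely often, and the exceptional value is 0.\<close>

lemma infinite_zeros_poly_plus_exp:
  fixes p :: "complex poly"
  assumes p: "p \<noteq> 0" and B: "B \<noteq> 0" and v: "v \<noteq> 0"
  shows "infinite {z. poly p z + B * exp (v * z) = 0}"
proof -
  define f where "f w = poly p (1 / w) * exp (- v / w)" for w
  have holf: "f holomorphic_on UNIV - {0}"
    unfolding f_def by (auto intro!: holomorphic_intros)
  have finv: "f (1 / z) = poly p z * exp (- v * z)" for z by (simp add: f_def)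
  have bdd: "\<exists>K R. 1 \<le> R \<and> (\<forall>z. R \<le> norm z \<longrightarrow> norm (g (1 / z)) \<le> K)"
    if lim: "(g \<longlongrightarrow> l) (at 0)" for g :: "complex \<Rightarrow> complex" and l
  proof -
    have "\<forall>\<^sub>F w in at 0. dist (g w) l < 1" using tendstoD[OF lim] by simp
    then obtain \<delta> where \<delta>: "\<delta> > 0" "\<And>w. w \<noteq> 0 \<Longrightarrow> norm w < \<delta> \<Longrightarrow> dist (g w) l < 1"
      by (auto simp: eventually_at)
    have "norm (g (1 / z)) \<le> norm l + 1" if "max 1 (2 / \<delta>) \<le> norm z" for z
    proof -
      have z: "0 < norm z" using that by linarith
      have "2 \<le> norm z * \<delta>" using that \<delta>(1) by (simp add: field_simps)
      then have "norm (1 / z) < \<delta>" using z by (simp add: norm_divide divide_simps mult.commute)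
      then have "norm (g (1/z) - l) < 1" using \<delta>(2)[of "1/z"] z by (auto simp: dist_norm)
      then show ?thesis using norm_triangle_ineq2[of "g (1/z)" l] by linarith
    qed
    then show ?thesis by (intro exI[of _ "norm l + 1"] exI[of _ "max 1 (2 / \<delta>)"]) auto
  qed
  have "\<not> (f \<longlongrightarrow> l) (at 0)" for l
  proof
    assume "(f \<longlongrightarrow> l) (at 0)"
    then obtain K R where KR: "1 \<le> R" "\<And>z. R \<le> norm z \<Longrightarrow> norm (poly p z * exp (- v * z)) \<le> K"
      using bdd[of f l] finv by metis
    define F where "F z = poly p z * exp (- v * z)" for z
    have "F holomorphic_on UNIV" unfolding F_def by (intro holomorphic_intros)
    then have "F z = (\<Sum>k\<le>0. (deriv ^^ k) F 0 / fact k * z ^ k)" for z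
      by (rule Liouville_polynomial[of F R K 0]) (use KR in \<open>auto simp: F_def\<close>)
    then have c: "F z = F 0" for z by simp
    have "F 0 \<noteq> 0"
    proof
      assume "F 0 = 0"
      then have "poly p z = 0" for z using c[of z] by (simp add: F_def)
      then have "p = 0" by (metis poly_0 poly_eq_poly_eq_iff ext)
      then show False using p by simp
    qed
    moreover have "poly p z = F 0 * exp (v * z)" for z using c[of z] by (simp add: F_def exp_minus field_simps)
    ultimately have "exp (v * z) = poly (smult (1 / F 0) p) z" for z by simp
    then show False using exp_not_polynomial v by blast
  qed
  moreover have "\<not> ((inverse \<circ> f) \<longlongrightarrow> l) (at 0)" for l
  proof
    assume "((inverse \<circ> f) \<longlongrightarrow> l) (at 0)"
    then obtain K R where KR: "1 \<le> R" "\<And>z. R \<le> norm z \<Longrightarrow> norm (inverse (poly p z * exp (- v * z))) \<le> K"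
      using bdd[of "inverse \<circ> f" l] finv by (metis o_apply)
    obtain R' where R': "\<And>z. R' \<le> norm z \<Longrightarrow> poly p z \<noteq> 0"
    proof -
      obtain c R where "c > 0" "R \<ge> 1" "\<And>z. R \<le> norm z \<Longrightarrow> c * norm z ^ degree p \<le> norm (poly p z)"
        using poly_norm_lower_bound[OF p] by blast
      then have "poly p z \<noteq> 0" if "R \<le> norm z" for z
        using that by (smt (verit) norm_zero zero_less_mult_iff zero_less_power)
      then show ?thesis using that by blast
    qed
    define S where "S = (\<Sum>i\<le>degree p. norm (coeff p i))"
    have "norm (exp (v * z)) \<le> (K * S) * norm z ^ degree p" if z: "max R R' \<le> norm z" for z
    proof -
      have nz: "norm (poly p z) > 0" using R' z by simp
      have "norm (exp (v * z)) / norm (poly p z) \<le> K"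
        using KR(2)[of z] z by (simp add: norm_mult norm_inverse exp_minus norm_divide field_simps)
      then have "norm (exp (v * z)) \<le> K * norm (poly p z)" using nz by (simp add: field_simps)
      also have "\<dots> \<le> K * (S * norm z ^ degree p)"
        using poly_norm_upper_bound[of z p "degree p"] z KR order_trans[OF norm_ge_zero KR(2)[of z]]
        by (intro mult_left_mono) (auto simp: S_def)
      finally show ?thesis by simp
    qed
    moreover have "(\<lambda>z. exp (v * z)) holomorphic_on UNIV" by (intro holomorphic_intros)
    ultimately have "exp (v * z) = (\<Sum>k\<le>degree p. (deriv ^^ k) (\<lambda>z. exp (v * z)) 0 / fact k * z ^ k)" for z
      using Liouville_polynomial[of "\<lambda>z. exp (v * z)" "max R R'" "K * S" "degree p" z] by blast
    also have "\<dots> z = poly (\<Sum>k\<le>degree p. monom ((deriv ^^ k) (\<lambda>z. exp (v * z)) 0 / fact k) k) z" for z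
      by (simp only: poly_sum poly_monom)
    finally show False using exp_not_polynomial v by blast
  qed
  ultimately obtain a where a: "\<And>w. w \<noteq> a \<Longrightarrow> infinite {x. x \<in> UNIV - {0} \<and> f x = w}"
    using great_Picard_infinite[of UNIV 0 f] holf by auto
  have "{x. x \<in> UNIV - {0} \<and> f x = 0} \<subseteq> (\<lambda>z. 1 / z) ` {z. poly p z = 0}"
    by (auto simp: f_def intro!: image_eqI[of _ "\<lambda>z. 1/z" "1/_"])
  then have "finite {x. x \<in> UNIV - {0} \<and> f x = 0}"
    using poly_roots_finite[OF p] finite_surj by blast
  then have "a = 0" using a by metis
  then have inf: "infinite {x. x \<in> UNIV - {0} \<and> f x = - B}" using a B by simp
  have "{x. x \<in> UNIV - {0} \<and> f x = - B} \<subseteq> (\<lambda>z. 1 / z) ` {z. poly p z + B * exp (v * z) = 0}"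
  proof clarsimp
    fix x assume x: "x \<noteq> 0" "f x = - B"
    then have "poly p (1/x) * exp (- v / x) * exp (v / x) = - B * exp (v / x)" by (simp add: f_def)
    then have "poly p (1/x) = - B * exp (v / x)" by (simp add: mult.assoc exp_add[symmetric])
    then have "poly p (1/x) + B * exp (v * (1/x)) = 0" by simp
    then show "x \<in> (/) 1 ` {z. poly p z + B * exp (v * z) = 0}"
      by (intro image_eqI[of _ _ "1/x"]) auto
  qed
  then show ?thesis using inf finite_surj by blast
qed

section \<open>Locally uniform convergence on the plane\<close>

text \<open>The members of the sequences are rescalings of functions that live on a fixed domain, so each
  of them is defined on a disc only, and these discs exhaust the plane.\<close>

definition plane_limit :: "(nat \<Rightarrow> complex \<Rightarrow> complex) \<Rightarrow> (complex \<Rightarrow> complex) \<Rightarrow> bool" where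
  "plane_limit P Q \<longleftrightarrow>
     (\<forall>R. (\<forall>\<^sub>F n in sequentially. P n holomorphic_on ball 0 R) \<and> uniform_limit (cball 0 R) P Q sequentially)"

lemma plane_limit_holomorphic:
  assumes "plane_limit P Q" shows "Q holomorphic_on S"
proof -
  have "Q holomorphic_on ball 0 (norm z + 1)" for z
  proof -
    have "\<forall>\<^sub>F n in sequentially. P n holomorphic_on ball 0 (norm z + 2)"
      using assms unfolding plane_limit_def by blast
    then have "\<forall>\<^sub>F n in sequentially. continuous_on (cball 0 (norm z + 1)) (P n) \<and> P n holomorphic_on ball 0 (norm z + 1)"
    proof eventually_elim
      case (elim n)
      have "cball 0 (norm z + 1) \<subseteq> ball (0::complex) (norm z + 2)" "ball 0 (norm z + 1) \<subseteq> ball (0::complex) (norm z + 2)" by auto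
      then show ?case using elim holomorphic_on_imp_continuous_on holomorphic_on_subset continuous_on_subset by blast
    qed
    moreover have "uniform_limit (cball 0 (norm z + 1)) P Q sequentially"
      using assms unfolding plane_limit_def by blast
    ultimately show ?thesis using holomorphic_uniform_limit by (metis trivial_limit_sequentially)
  qed
  then have "Q field_differentiable at z" for z
    using holomorphic_on_imp_differentiable_at[of Q "ball 0 (norm z + 1)" z] by auto
  then show ?thesis by (simp add: holomorphic_on_def field_differentiable_at_within)
qed

lemma plane_limit_tendsto: "plane_limit P Q \<Longrightarrow> (\<lambda>n. P n z) \<longlonglongrightarrow> Q z"
  unfolding plane_limit_def
  using tendsto_uniform_limitI[where S = "cball 0 (norm z)" and x = z] by auto

lemma plane_limit_bounded: "plane_limit P Q \<Longrightarrow> bounded (Q ` cball 0 R)"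
  by (intro compact_imp_bounded compact_continuous_image holomorphic_on_imp_continuous_on plane_limit_holomorphic) auto

lemma plane_limit_cong:
  assumes "plane_limit P Q" and "\<And>R. \<forall>\<^sub>F n in sequentially. \<forall>z \<in> ball 0 R. P n z = P' n z"
  shows "plane_limit P' Q"
  unfolding plane_limit_def
proof (intro allI conjI)
  fix R
  have "\<forall>\<^sub>F n in sequentially. P n holomorphic_on ball 0 R" using assms(1) unfolding plane_limit_def by blast
  then show "\<forall>\<^sub>F n in sequentially. P' n holomorphic_on ball 0 R"
    using assms(2)[of R] by eventually_elim (metis holomorphic_transform)
  have "\<forall>\<^sub>F n in sequentially. \<forall>z \<in> cball 0 R. P n z = P' n z"
    using assms(2)[of "R + 1"] by eventually_elim auto
  then show "uniform_limit (cball 0 R) P' Q sequentially"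
    using assms(1) uniform_limit_cong[of "cball 0 R" P P' sequentially Q Q] unfolding plane_limit_def by auto
qed

lemma plane_limit_const: "c \<longlonglongrightarrow> c0 \<Longrightarrow> plane_limit (\<lambda>n z. c n) (\<lambda>z. c0)"
  unfolding plane_limit_def by (auto simp: uniform_limit_iff tendsto_iff)

lemma plane_limit_fixed: "Q holomorphic_on UNIV \<Longrightarrow> plane_limit (\<lambda>n. Q) Q"
  unfolding plane_limit_def
  by (intro allI conjI always_eventually uniform_limit_const) (use holomorphic_on_subset in blast)

lemma plane_limit_add:
  assumes "plane_limit P Q" "plane_limit P' Q'"
  shows "plane_limit (\<lambda>n z. P n z + P' n z) (\<lambda>z. Q z + Q' z)"
  using assms unfolding plane_limit_def
  by (auto intro!: uniform_limit_add intro: eventually_elim2 holomorphic_on_add)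

lemma plane_limit_diff:
  assumes "plane_limit P Q" "plane_limit P' Q'"
  shows "plane_limit (\<lambda>n z. P n z - P' n z) (\<lambda>z. Q z - Q' z)"
  using assms unfolding plane_limit_def
  by (auto intro!: uniform_limit_minus intro: eventually_elim2 holomorphic_on_diff)

lemma plane_limit_mult:
  assumes P: "plane_limit P Q" and P': "plane_limit P' Q'"
  shows "plane_limit (\<lambda>n z. P n z * P' n z) (\<lambda>z. Q z * Q' z)"
  unfolding plane_limit_def
proof (intro allI conjI)
  fix R
  have "\<forall>\<^sub>F n in sequentially. P n holomorphic_on ball 0 R" "\<forall>\<^sub>F n in sequentially. P' n holomorphic_on ball 0 R"
    using P P' unfolding plane_limit_def by blast+
  then show "\<forall>\<^sub>F n in sequentially. (\<lambda>z. P n z * P' n z) holomorphic_on ball 0 R"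
    by eventually_elim (rule holomorphic_on_mult)
  show "uniform_limit (cball 0 R) (\<lambda>n z. P n z * P' n z) (\<lambda>z. Q z * Q' z) sequentially"
    using P P' by (intro uniform_lim_mult plane_limit_bounded) (auto simp: plane_limit_def)
qed

lemma plane_limit_sum:
  "(\<And>i. i \<in> I \<Longrightarrow> plane_limit (P i) (Q i)) \<Longrightarrow> plane_limit (\<lambda>n z. \<Sum>i\<in>I. P i n z) (\<lambda>z. \<Sum>i\<in>I. Q i z)"
  by (induction I rule: infinite_finite_induct) (auto intro!: plane_limit_add plane_limit_const)

lemma plane_limit_deriv:
  assumes PQ: "plane_limit P Q" shows "plane_limit (\<lambda>n. deriv (P n)) (deriv Q)"
  unfolding plane_limit_def
proof (intro allI conjI)
  fix R
  have "\<forall>\<^sub>F n in sequentially. P n holomorphic_on ball 0 R" using PQ unfolding plane_limit_def by blast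
  then show "\<forall>\<^sub>F n in sequentially. deriv (P n) holomorphic_on ball 0 R"
    by eventually_elim (simp add: holomorphic_deriv)
  show "uniform_limit (cball 0 R) (\<lambda>n. deriv (P n)) (deriv Q) sequentially"
  proof (rule uniform_limitI)
    fix e :: real assume e: "0 < e"
    have "\<forall>\<^sub>F n in sequentially. P n holomorphic_on ball 0 (R + 2)" using PQ unfolding plane_limit_def by blast
    moreover have "\<forall>\<^sub>F n in sequentially. \<forall>z\<in>cball 0 (R + 1). dist (P n z) (Q z) < e / 2"
      using PQ e unfolding plane_limit_def by (intro uniform_limitD) auto
    ultimately show "\<forall>\<^sub>F n in sequentially. \<forall>z\<in>cball 0 R. dist (deriv (P n) z) (deriv Q z) < e"
    proof eventually_elim
      case (elim n)
      show ?case
      proof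
        fix z :: complex assume z: "z \<in> cball 0 R"
        have sub: "cball z 1 \<subseteq> cball 0 (R + 1)"
        proof
          fix x assume "x \<in> cball z 1"
          then show "x \<in> cball 0 (R + 1)"
            using z norm_triangle_ineq2[of x z] by (simp add: dist_norm norm_minus_commute)
        qed
        define F where "F w = P n w - Q w" for w
        have hol: "F holomorphic_on ball 0 (R + 2)" unfolding F_def
          by (intro holomorphic_intros elim plane_limit_holomorphic[OF PQ])
        have sub2: "cball z 1 \<subseteq> ball 0 (R + 2)" using sub by fastforce
        then have zin: "z \<in> ball 0 (R + 2)" by (rule subsetD) simp
        have "norm ((deriv ^^ 1) F z) \<le> fact 1 * (e / 2) / 1 ^ 1"
        proof (rule Cauchy_inequality)
          show "F holomorphic_on ball z 1" using hol sub2 ball_subset_cball holomorphic_on_subset by blast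
          show "continuous_on (cball z 1) F"
            using hol sub2 holomorphic_on_imp_continuous_on continuous_on_subset by blast
          fix x assume "norm (z - x) = 1"
          then have "x \<in> cball z 1" by (simp add: dist_norm)
          then have "x \<in> cball 0 (R + 1)" using sub by blast
          then show "norm (F x) \<le> e / 2" using elim(2) by (force simp: F_def dist_norm)
        qed simp
        moreover have "deriv F z = deriv (P n) z - deriv Q z" unfolding F_def
          by (intro deriv_diff holomorphic_on_imp_differentiable_at[OF elim(1)]
              holomorphic_on_imp_differentiable_at[OF plane_limit_holomorphic[OF PQ, of UNIV]] open_ball open_UNIV zin UNIV_I)
        ultimately show "dist (deriv (P n) z) (deriv Q z) < e" using e by (simp add: dist_norm)
      qed
    qed
  qed
qed

lemma plane_limit_higher_deriv:
  "plane_limit P Q \<Longrightarrow> plane_limit (\<lambda>n. (deriv ^^ j) (P n)) ((deriv ^^ j) Q)"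
  by (induction j) (auto dest: plane_limit_deriv)

lemma plane_limit_rescaled_coefficient:
  assumes hol: "f holomorphic_on S" and S: "open S" "z0 \<in> S"
    and z: "z \<longlonglongrightarrow> z0" and \<rho>: "\<rho> \<longlonglongrightarrow> (0::real)"
  shows "plane_limit (\<lambda>n \<zeta>. f (z n + of_real (\<rho> n) * \<zeta>)) (\<lambda>\<zeta>. f z0)"
proof -
  obtain e where e: "e > 0" "ball z0 e \<subseteq> S" using S openE by blast
  have near: "\<forall>\<^sub>F n in sequentially. \<forall>\<zeta> \<in> cball 0 R. dist (z n + of_real (\<rho> n) * \<zeta>) z0 < d" if d: "0 < d" for R d
  proof -
    define R' where "R' = \<bar>R\<bar> + 1"
    have R': "R' > 0" by (simp add: R'_def add_nonneg_pos)
    have "\<forall>\<^sub>F n in sequentially. dist (z n) z0 < d / 2" using tendstoD[OF z, of "d/2"] d by simp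
    moreover have "\<forall>\<^sub>F n in sequentially. dist (\<rho> n) 0 < d / (2 * R')" using tendstoD[OF \<rho>, of "d / (2 * R')"] d R' by simp
    ultimately show ?thesis
    proof eventually_elim
      case (elim n)
      show ?case
      proof
        fix \<zeta> :: complex assume "\<zeta> \<in> cball 0 R"
        then have "norm \<zeta> \<le> R'" by (auto simp: R'_def)
        then have "norm (of_real (\<rho> n) * \<zeta>) \<le> \<bar>\<rho> n\<bar> * R'" by (simp add: norm_mult mult_left_mono)
        also have "\<dots> < d / 2" using elim(2) R' by (simp add: field_simps)
        finally have "norm (of_real (\<rho> n) * \<zeta>) < d / 2" .
        moreover have eq: "z n + of_real (\<rho> n) * \<zeta> - z0 = (z n - z0) + of_real (\<rho> n) * \<zeta>" by simp
        ultimately show "dist (z n + of_real (\<rho> n) * \<zeta>) z0 < d"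
          using elim(1) norm_triangle_ineq[of "z n - z0" "of_real (\<rho> n) * \<zeta>"] unfolding dist_norm eq by linarith
      qed
    qed
  qed
  show ?thesis unfolding plane_limit_def
  proof (intro allI conjI)
    fix R
    show "\<forall>\<^sub>F n in sequentially. (\<lambda>\<zeta>. f (z n + of_real (\<rho> n) * \<zeta>)) holomorphic_on ball 0 R"
      using near[OF e(1), of R]
    proof eventually_elim
      case (elim n)
      have "(f \<circ> (\<lambda>\<zeta>. z n + of_real (\<rho> n) * \<zeta>)) holomorphic_on ball 0 R"
        by (rule holomorphic_on_compose_gen[OF _ hol]) (use elim e in \<open>auto intro!: holomorphic_intros simp: subset_iff dist_commute\<close>)
      then show ?case by (simp add: o_def)
    qed
    have "continuous (at z0) f"
      using hol S holomorphic_on_imp_continuous_on continuous_on_eq_continuous_at by blast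
    then show "uniform_limit (cball 0 R) (\<lambda>n \<zeta>. f (z n + of_real (\<rho> n) * \<zeta>)) (\<lambda>\<zeta>. f z0) sequentially"
    proof (intro uniform_limitI)
      fix r :: real assume "0 < r" "continuous (at z0) f"
      then obtain d where d: "d > 0" "\<And>y. dist y z0 < d \<Longrightarrow> dist (f y) (f z0) < r"
        unfolding continuous_at_eps_delta by (metis dist_commute)
      show "\<forall>\<^sub>F n in sequentially. \<forall>\<zeta>\<in>cball 0 R. dist (f (z n + of_real (\<rho> n) * \<zeta>)) (f z0) < r"
        using near[OF d(1), of R] by eventually_elim (use d(2) in blast)
    qed
  qed
qed

lemma uniform_limit_subseq:
  assumes "uniform_limit K f g sequentially" "filterlim h sequentially sequentially"
  shows "uniform_limit K (\<lambda>n. f (h n)) g sequentially"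
  using assms(1) unfolding uniform_limit_iff by (auto intro: eventually_compose_filterlim[OF _ assms(2)])

text \<open>The form in which Hurwitz's theorem is used: if all zeros of \<open>P n\<close> are zeros of \<open>Q n\<close>, then all
  zeros of the limit of \<open>P\<close> are zeros of the limit of \<open>Q\<close>.\<close>

lemma plane_limit_zeros_transfer:
  assumes P: "plane_limit P P0" and Q: "plane_limit Q Q0"
    and imp: "\<And>R. \<forall>\<^sub>F n in sequentially. \<forall>\<zeta> \<in> ball 0 R. P n \<zeta> = 0 \<longrightarrow> Q n \<zeta> = 0"
    and z: "P0 \<zeta>0 = 0" and nz: "P0 \<zeta>1 \<noteq> 0"
  shows "Q0 \<zeta>0 = 0"
proof (rule ccontr)
  assume q: "Q0 \<zeta>0 \<noteq> 0"
  have "isCont Q0 \<zeta>0"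
    using plane_limit_holomorphic[OF Q, of UNIV] holomorphic_on_imp_continuous_on continuous_on_eq_continuous_at by blast
  then obtain d where d: "d > 0" "\<And>y. dist y \<zeta>0 < d \<Longrightarrow> dist (Q0 y) (Q0 \<zeta>0) < norm (Q0 \<zeta>0) / 2"
    using q unfolding continuous_at_eps_delta by (metis dist_commute half_gt_zero zero_less_norm_iff)
  define R where "R = norm \<zeta>0 + d"
  have sub: "ball \<zeta>0 d \<subseteq> ball 0 R"
  proof
    fix x assume "x \<in> ball \<zeta>0 d"
    then show "x \<in> ball 0 R"
      using norm_triangle_ineq2[of x \<zeta>0] by (simp add: R_def dist_norm norm_minus_commute)
  qed
  have "\<forall>\<^sub>F n in sequentially. \<forall>y\<in>cball 0 R. dist (Q n y) (Q0 y) < norm (Q0 \<zeta>0) / 2"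
    using Q q unfolding plane_limit_def by (intro uniform_limitD) auto
  moreover have "\<forall>\<^sub>F n in sequentially. P n holomorphic_on ball 0 R" using P unfolding plane_limit_def by blast
  ultimately have "\<forall>\<^sub>F n in sequentially. P n holomorphic_on ball \<zeta>0 d \<and> (\<forall>y\<in>ball \<zeta>0 d. P n y \<noteq> 0)"
    using imp[of R]
  proof eventually_elim
    case (elim n)
    have "P n y \<noteq> 0" if y: "y \<in> ball \<zeta>0 d" for y
    proof
      assume "P n y = 0"
      then have "Q n y = 0" using elim(3) y sub by blast
      moreover have "y \<in> cball 0 R" using y sub by fastforce
      ultimately have "norm (Q0 y) < norm (Q0 \<zeta>0) / 2" using elim(1) by force
      moreover have "norm (Q0 \<zeta>0) - norm (Q0 y) < norm (Q0 \<zeta>0) / 2"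
        using d(2)[of y] y norm_triangle_ineq3[of "Q0 y" "Q0 \<zeta>0"] by (auto simp: dist_norm norm_minus_commute)
      ultimately show False by linarith
    qed
    then show ?case using elim(2) sub holomorphic_on_subset by blast
  qed
  then obtain N where N: "\<And>n. n \<ge> N \<Longrightarrow> P n holomorphic_on ball \<zeta>0 d \<and> (\<forall>y\<in>ball \<zeta>0 d. P n y \<noteq> 0)"
    unfolding eventually_sequentially by blast
  have holP0: "P0 holomorphic_on S" for S using plane_limit_holomorphic[OF P] .
  have "\<not> P0 constant_on ball \<zeta>0 d"
  proof
    assume "P0 constant_on ball \<zeta>0 d"
    then have "P0 w = 0" if "w \<in> ball \<zeta>0 d" for w
      using z that d by (metis centre_in_ball constant_on_def)
    then have "P0 \<zeta>1 = 0"
      using analytic_continuation_open[of "ball \<zeta>0 d" UNIV P0 "\<lambda>_. 0" \<zeta>1] d holP0 by auto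
    then show False using nz by simp
  qed
  have "P0 \<zeta>0 \<noteq> 0"
  proof (rule Hurwitz_no_zeros[of "ball \<zeta>0 d" "\<lambda>n. P (n + N)" P0 \<zeta>0])
    fix K assume K: "compact K" "K \<subseteq> ball \<zeta>0 d"
    then have "K \<subseteq> cball 0 R" using sub by fastforce
    moreover have "uniform_limit (cball 0 R) P P0 sequentially" using P unfolding plane_limit_def by blast
    ultimately have "uniform_limit K P P0 sequentially" by (rule uniform_limit_on_subset[rotated])
    then show "uniform_limit K (\<lambda>n. P (n + N)) P0 sequentially"
      by (rule uniform_limit_subseq) (rule filterlim_add_const_nat_at_top)
  qed (use N holP0 d \<open>\<not> P0 constant_on ball \<zeta>0 d\<close> in \<open>auto\<close>)
  then show False using z by simp
qed

section \<open>Normality\<close>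

definition uniform_limit_or_infinity :: "complex set \<Rightarrow> (nat \<Rightarrow> complex \<Rightarrow> complex) \<Rightarrow> bool" where
  "uniform_limit_or_infinity U f \<longleftrightarrow>
     (\<exists>g. uniform_limit U f g sequentially) \<or> (\<forall>B. \<forall>\<^sub>F n in sequentially. \<forall>z\<in>U. B < norm (f n z))"

lemma uniform_limit_or_infinity_mono:
  assumes "uniform_limit_or_infinity U f" "V \<subseteq> U"
  shows "uniform_limit_or_infinity V f"
proof -
  have "\<forall>\<^sub>F n in sequentially. \<forall>z\<in>V. B < norm (f n z)"
    if "\<forall>\<^sub>F n in sequentially. \<forall>z\<in>U. B < norm (f n z)" for B
    using that by eventually_elim (use assms(2) in blast)
  then show ?thesis
    using assms uniform_limit_on_subset unfolding uniform_limit_or_infinity_def by blast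
qed

lemma uniform_limit_or_infinity_subseq:
  assumes "uniform_limit_or_infinity U f" "strict_mono h"
  shows "uniform_limit_or_infinity U (f \<circ> h)"
proof -
  have h: "filterlim h sequentially sequentially" by (rule filterlim_subseq[OF assms(2)])
  show ?thesis
    using assms(1) uniform_limit_subseq[OF _ h] eventually_compose_filterlim[OF _ h]
    unfolding uniform_limit_or_infinity_def o_def by blast
qed

lemma uniform_limit_or_infinity_shift:
  assumes "uniform_limit_or_infinity U (\<lambda>n. f (n + k))"
  shows "uniform_limit_or_infinity U f"
proof -
  from assms consider g where "uniform_limit U (\<lambda>n. f (n + k)) g sequentially"
    | "\<forall>B. \<forall>\<^sub>F n in sequentially. \<forall>z\<in>U. B < norm (f (n + k) z)"
    unfolding uniform_limit_or_infinity_def by blast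
  then show ?thesis
  proof cases
    case 1
    have "\<forall>\<^sub>F n in sequentially. \<forall>x\<in>U. dist (f n x) (g x) < e" if "0 < e" for e
      using uniform_limitD[OF 1 that] eventually_sequentially_seg[of "\<lambda>n. \<forall>x\<in>U. dist (f n x) (g x) < e" k] by simp
    then show ?thesis unfolding uniform_limit_or_infinity_def uniform_limit_iff by blast
  next
    case 2
    have "\<forall>\<^sub>F n in sequentially. \<forall>z\<in>U. B < norm (f n z)" for B
      using 2[rule_format, of B] eventually_sequentially_seg[of "\<lambda>n. \<forall>z\<in>U. B < norm (f n z)" k] by simp
    then show ?thesis unfolding uniform_limit_or_infinity_def by blast
  qed
qed

text \<open>The spherical derivative bounds the gradient of \<open>1 / (1 + \<bar>g\<bar>\<^sup>2)\<close>, which is, up to an affine change,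
  the height of the stereographic projection of \<open>g\<close>. Working with this real function avoids the chordal metric.\<close>

lemma spherical_height_Lipschitz:
  fixes g :: "complex \<Rightarrow> complex"
  assumes hol: "g holomorphic_on ball z d"
    and C: "\<And>w. w \<in> ball z d \<Longrightarrow> norm (deriv g w) \<le> C * (1 + (norm (g w))\<^sup>2)"
    and w: "w \<in> ball z d"
  shows "\<bar>1 / (1 + (norm (g w))\<^sup>2) - 1 / (1 + (norm (g z))\<^sup>2)\<bar> \<le> C * dist w z"
proof -
  define u where "u w = 1 / (1 + g w \<bullet> g w)" for w
  define u' where "u' x h = - (2 * (g x \<bullet> (deriv g x * h))) / (1 + g x \<bullet> g x)\<^sup>2" for x h
  have pos: "1 + g x \<bullet> g x > 0" for x by (simp add: add_pos_nonneg)
  have "norm (u w - u z) \<le> C * norm (w - z)"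
  proof (rule differentiable_bound[of "ball z d" u u'])
    fix x assume x: "x \<in> ball z d"
    have "(g has_field_derivative deriv g x) (at x within ball z d)"
      using holomorphic_derivI[OF hol open_ball x] by (rule DERIV_subset) auto
    then have D: "(g has_derivative (\<lambda>h. deriv g x * h)) (at x within ball z d)"
      by (simp add: has_field_derivative_def)
    have "1 + g x \<bullet> g x \<noteq> 0" using pos[of x] by simp
    then show "(u has_derivative u' x) (at x within ball z d)"
      unfolding u_def u'_def
      by (auto intro!: derivative_eq_intros D simp: fun_eq_iff inner_commute power2_eq_square field_simps)
    show "onorm (u' x) \<le> C"
    proof (rule onorm_le)
      fix h
      define G where "G = norm (g x)"
      have gg: "g x \<bullet> g x = G\<^sup>2" by (simp add: G_def power2_norm_eq_inner)
      have p2: "0 < 1 + G\<^sup>2" by (simp add: add_pos_nonneg)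
      have "\<bar>g x \<bullet> (deriv g x * h)\<bar> \<le> G * norm (deriv g x * h)"
        unfolding G_def by (rule Cauchy_Schwarz_ineq2)
      also have "\<dots> = G * (norm (deriv g x) * norm h)" by (simp add: norm_mult)
      also have "\<dots> \<le> G * (C * (1 + G\<^sup>2) * norm h)"
        using C[OF x] by (intro mult_left_mono mult_right_mono) (auto simp: G_def)
      finally have "2 * \<bar>g x \<bullet> (deriv g x * h)\<bar> \<le> 2 * (G * (C * (1 + G\<^sup>2) * norm h))"
        by (rule mult_left_mono) simp
      then have 1: "2 * \<bar>g x \<bullet> (deriv g x * h)\<bar> \<le> (2 * G) * (C * norm h) * (1 + G\<^sup>2)"
        by (simp only: mult_ac)
      have C0: "0 \<le> C * norm h"
        using order_trans[OF norm_ge_zero C[OF x]] p2 by (simp add: G_def zero_le_mult_iff)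
      have "2 * G \<le> 1 + G\<^sup>2" using sum_squares_bound[of 1 G] by (simp add: power2_eq_square)
      then have "(2 * G) * (C * norm h) * (1 + G\<^sup>2) \<le> (1 + G\<^sup>2) * (C * norm h) * (1 + G\<^sup>2)"
        using C0 p2 by (intro mult_right_mono) auto
      with 1 have "2 * \<bar>g x \<bullet> (deriv g x * h)\<bar> \<le> (C * norm h) * (1 + G\<^sup>2)\<^sup>2"
        by (simp only: power2_eq_square mult_ac)
      then show "norm (u' x h) \<le> C * norm h"
        using p2 by (simp add: u'_def gg abs_mult divide_simps)
    qed
  qed (use w in \<open>auto intro: le_less_trans[OF zero_le_dist]\<close>)
  then show ?thesis by (simp add: u_def power2_norm_eq_inner dist_norm)
qed

lemma Montel_uniform_on_smaller_ball:
  fixes f :: "nat \<Rightarrow> complex \<Rightarrow> complex"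
  assumes hol: "\<And>n. f n holomorphic_on ball z e" and bd: "\<And>n w. w \<in> ball z e \<Longrightarrow> norm (f n w) \<le> B" and e: "e > 0"
  obtains g t where "g holomorphic_on ball z e" "strict_mono (t :: nat \<Rightarrow> nat)"
    "\<And>K. compact K \<Longrightarrow> K \<subseteq> ball z e \<Longrightarrow> uniform_limit K (f \<circ> t) g sequentially"
proof (rule Montel[of "ball z e" "{h. h holomorphic_on ball z e \<and> (\<forall>w\<in>ball z e. norm (h w) \<le> B)}" f])
  fix K assume "K \<subseteq> ball z e"
  then show "\<exists>B'. \<forall>h\<in>{h. h holomorphic_on ball z e \<and> (\<forall>w\<in>ball z e. norm (h w) \<le> B)}. \<forall>w\<in>K. norm (h w) \<le> B'"
    by (intro exI[of _ B]) auto
qed (use assms that in auto)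

text \<open>Marty's criterion. A bound on the spherical derivative prevents \<open>\<bar>f n\<bar>\<close> from crossing from 1
  to 2 or to 1/2 within a disc of fixed size, so on that disc either infinitely many \<open>f n\<close> or
  infinitely many reciprocals are bounded by 2, and Montel's theorem applies.\<close>

lemma Marty_criterion:
  fixes f :: "nat \<Rightarrow> complex \<Rightarrow> complex"
  assumes d: "0 < d"
    and ev: "\<forall>\<^sub>F n in sequentially. f n holomorphic_on ball z d \<and>
               (\<forall>w\<in>ball z d. norm (deriv (f n) w) \<le> C * (1 + (norm (f n w))\<^sup>2))"
  shows "\<exists>s e. strict_mono (s :: nat \<Rightarrow> nat) \<and> 0 < e \<and> uniform_limit_or_infinity (ball z e) (f \<circ> s)"
proof -
  obtain N where N: "\<And>n. n \<ge> N \<Longrightarrow> f n holomorphic_on ball z d"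
    "\<And>n w. n \<ge> N \<Longrightarrow> w \<in> ball z d \<Longrightarrow> norm (deriv (f n) w) \<le> C * (1 + (norm (f n w))\<^sup>2)"
    using ev unfolding eventually_sequentially by blast
  have zd: "z \<in> ball z d" using d by simp
  have "0 \<le> C * (1 + (norm (f N z))\<^sup>2)" using order_trans[OF norm_ge_zero N(2)[of N z]] zd by simp
  then have C: "0 \<le> C" by (simp add: zero_le_mult_iff) (smt (verit) zero_le_power2)
  define e where "e = min d (1 / (4 * (C + 1)))"
  have e: "0 < e" "e \<le> d" using d C by (auto simp: e_def)
  have height: "\<bar>1 / (1 + (norm (f n w))\<^sup>2) - 1 / (1 + (norm (f n z))\<^sup>2)\<bar> \<le> 1 / 4" if "n \<ge> N" "w \<in> ball z e" for n w
  proof -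
    have wd: "w \<in> ball z d" using that e by auto
    have "dist w z \<le> 1 / (4 * (C + 1))" using that by (auto simp: e_def dist_commute)
    then have "C * dist w z \<le> (C + 1) * (1 / (4 * (C + 1)))" using C by (intro mult_mono) auto
    also have "\<dots> = 1 / 4" using C by simp
    finally show ?thesis
      using spherical_height_Lipschitz[OF N(1)[OF that(1)] N(2)[OF that(1)] wd] by linarith
  qed
  have small: "norm (f n w) \<le> 2" if "n \<ge> N" "w \<in> ball z e" "norm (f n z) \<le> 1" for n w
  proof -
    have "1 / 2 \<le> 1 / (1 + (norm (f n z))\<^sup>2)"
      using that(3) by (intro divide_left_mono) (auto simp: power_le_one add_pos_nonneg)
    then have "1 / 4 \<le> 1 / (1 + (norm (f n w))\<^sup>2)" using height[OF that(1,2)] by linarith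
    moreover have "0 < 1 + (norm (f n w))\<^sup>2" by (simp add: add_pos_nonneg)
    ultimately have "(norm (f n w))\<^sup>2 \<le> 2\<^sup>2" by (simp add: field_simps)
    then show ?thesis by (rule power2_le_imp_le) simp
  qed
  have large: "1 / 2 \<le> norm (f n w)" if "n \<ge> N" "w \<in> ball z e" "1 \<le> norm (f n z)" for n w
  proof -
    have "1 / (1 + (norm (f n z))\<^sup>2) \<le> 1 / 2"
      using that(3) by (intro divide_left_mono) (auto simp: add_pos_nonneg)
    then have "1 / (1 + (norm (f n w))\<^sup>2) \<le> 3 / 4" using height[OF that(1,2)] by linarith
    moreover have "0 < 1 + (norm (f n w))\<^sup>2" by (simp add: add_pos_nonneg)
    ultimately have "(1/2)\<^sup>2 \<le> (norm (f n w))\<^sup>2" by (simp add: field_simps)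
    then show ?thesis by (rule power2_le_imp_le) simp
  qed
  have sub: "cball z (e / 2) \<subseteq> ball z e" using e by auto
  have "infinite {n. n \<ge> N}" by (simp add: infinite_Ici flip: atLeast_def)
  moreover have "{n. n \<ge> N} = {n. n \<ge> N \<and> norm (f n z) \<le> 1} \<union> {n. n \<ge> N \<and> 1 \<le> norm (f n z)}" by auto
  ultimately consider "infinite {n. n \<ge> N \<and> norm (f n z) \<le> 1}" | "infinite {n. n \<ge> N \<and> 1 \<le> norm (f n z)}"
    by (metis finite_UnI)
  then show ?thesis
  proof cases
    case 1
    obtain s :: "nat \<Rightarrow> nat" where s: "strict_mono s" "\<forall>n. s n \<in> {n. n \<ge> N \<and> norm (f n z) \<le> 1}"
      using infinite_enumerate[OF 1] by blast
    obtain g t where gt: "strict_mono t" "\<And>K. compact K \<Longrightarrow> K \<subseteq> ball z e \<Longrightarrow> uniform_limit K ((\<lambda>n. f (s n)) \<circ> t) g sequentially"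
    proof (rule Montel_uniform_on_smaller_ball[of "\<lambda>n. f (s n)" z e 2])
      show "f (s n) holomorphic_on ball z e" for n
        using N(1)[of "s n"] s(2) subset_ball[OF e(2)] holomorphic_on_subset by blast
    qed (use s small e in auto)
    have "uniform_limit (cball z (e/2)) (f \<circ> (s \<circ> t)) g sequentially"
      using gt(2)[OF compact_cball sub] by (simp add: o_def)
    then have "uniform_limit_or_infinity (ball z (e/2)) (f \<circ> (s \<circ> t))"
      unfolding uniform_limit_or_infinity_def using uniform_limit_on_subset ball_subset_cball by blast
    then show ?thesis using s(1) gt(1) e(1) strict_mono_o by (metis half_gt_zero)
  next
    case 2
    obtain s :: "nat \<Rightarrow> nat" where s: "strict_mono s" "\<forall>n. s n \<in> {n. n \<ge> N \<and> 1 \<le> norm (f n z)}"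
      using infinite_enumerate[OF 2] by blast
    define F where "F n w = inverse (f (s n) w)" for n w
    have nz: "f (s n) w \<noteq> 0" if "w \<in> ball z e" for n w
      using large[OF _ that, of "s n"] s(2) by auto
    have holF: "F n holomorphic_on ball z e" for n
      unfolding F_def using N(1)[of "s n"] s(2) subset_ball[OF e(2)] nz
      by (intro holomorphic_on_inverse) (auto intro: holomorphic_on_subset)
    have bdF: "norm (F n w) \<le> 2" if "w \<in> ball z e" for n w
    proof -
      have "1 / 2 \<le> norm (f (s n) w)" using large[OF _ that, of "s n"] s(2) by auto
      then have "inverse (norm (f (s n) w)) \<le> inverse (1 / 2)" by (intro le_imp_inverse_le) auto
      then show ?thesis by (simp add: F_def norm_inverse)
    qed
    obtain h t where ht: "h holomorphic_on ball z e" "strict_mono t"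
      "\<And>K. compact K \<Longrightarrow> K \<subseteq> ball z e \<Longrightarrow> uniform_limit K (F \<circ> t) h sequentially"
      using Montel_uniform_on_smaller_ball[of F z e 2] holF bdF e(1) by blast
    have lim: "uniform_limit (cball z (e/2)) (F \<circ> t) h sequentially" by (rule ht(3)[OF compact_cball sub])
    have "uniform_limit_or_infinity (cball z (e/2)) (f \<circ> (s \<circ> t))"
    proof (cases "\<exists>w \<in> ball z e. h w = 0")
      case True
      then obtain w where w: "w \<in> ball z e" "h w = 0" by auto
      have "h constant_on ball z e"
      proof (rule ccontr)
        assume "\<not> h constant_on ball z e"
        then have "h w \<noteq> 0"
          by (intro Hurwitz_no_zeros[of "ball z e" "F \<circ> t" h w]) (use holF ht w nz in \<open>auto simp: F_def\<close>)
        then show False using w by simp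
      qed
      then have h0: "h v = 0" if "v \<in> ball z e" for v using w that by (metis constant_on_def)
      have "\<forall>\<^sub>F n in sequentially. \<forall>v\<in>cball z (e/2). B < norm (f (s (t n)) v)" for B
      proof -
        have "\<forall>\<^sub>F n in sequentially. \<forall>v\<in>cball z (e/2). dist ((F \<circ> t) n v) (h v) < 1 / (\<bar>B\<bar> + 1)"
          by (rule uniform_limitD[OF lim]) (simp add: add_nonneg_pos)
        then show ?thesis
        proof eventually_elim
          case (elim n)
          show ?case
          proof
            fix v assume v: "v \<in> cball z (e/2)"
            then have vb: "v \<in> ball z e" using sub by blast
            have "inverse (norm (f (s (t n)) v)) < 1 / (\<bar>B\<bar> + 1)"
              using elim v h0[OF vb] by (force simp: F_def norm_inverse)
            then have "\<bar>B\<bar> + 1 < norm (f (s (t n)) v)"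
              using nz[OF vb, of "t n"] by (simp add: field_simps)
            then show "B < norm (f (s (t n)) v)" by linarith
          qed
        qed
      qed
      then show ?thesis by (simp add: uniform_limit_or_infinity_def)
    next
      case False
      have "continuous_on (cball z (e/2)) (\<lambda>w. norm (h w))"
        by (intro continuous_intros continuous_on_subset[OF holomorphic_on_imp_continuous_on[OF ht(1)] sub])
      then obtain w0 where w0: "w0 \<in> cball z (e/2)" "\<And>w. w \<in> cball z (e/2) \<Longrightarrow> norm (h w0) \<le> norm (h w)"
        using continuous_attains_inf[of "cball z (e/2)" "\<lambda>w. norm (h w)"] e by auto
      have "0 < norm (h w0)" using False w0(1) sub by auto
      then have "uniform_limit (cball z (e/2)) (\<lambda>n w. inverse ((F \<circ> t) n w)) (inverse \<circ> h) sequentially"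
        using uniform_lim_inverse[OF lim w0(2)] by blast
      then have "uniform_limit (cball z (e/2)) (f \<circ> (s \<circ> t)) (inverse \<circ> h) sequentially"
        by (simp add: F_def o_def)
      then show ?thesis unfolding uniform_limit_or_infinity_def by blast
    qed
    then have "uniform_limit_or_infinity (ball z (e/2)) (f \<circ> (s \<circ> t))"
      using uniform_limit_or_infinity_mono ball_subset_cball by blast
    then show ?thesis using s(1) ht(2) e(1) strict_mono_o by (metis half_gt_zero)
  qed
qed

text \<open>The set of points near which the sequence converges to a finite limit and the set of points
  near which it tends to infinity are open and disjoint, so one of them is the whole domain.\<close>

lemma converges_on_compacts_if_locally:
  assumes conn: "connected U"
    and loc: "\<And>z. z \<in> U \<Longrightarrow> \<exists>V. open V \<and> z \<in> V \<and> uniform_limit_or_infinity V h"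
  shows "converges_on_compacts U h"
proof -
  define fin where "fin V \<longleftrightarrow> (\<exists>g. uniform_limit V h g sequentially)" for V
  define inf where "inf V \<longleftrightarrow> (\<forall>B. \<forall>\<^sub>F n in sequentially. \<forall>z\<in>V. B < norm (h n z))" for V
  define W1 W2 where "W1 = \<Union>{V. open V \<and> fin V}" and "W2 = \<Union>{V. open V \<and> inf V}"
  have "W1 \<inter> W2 = {}"
  proof (rule ccontr)
    assume "W1 \<inter> W2 \<noteq> {}"
    then obtain z V1 V2 where z: "z \<in> V1" "z \<in> V2" "fin V1" "inf V2" by (auto simp: W1_def W2_def)
    then obtain g where "uniform_limit V1 h g sequentially" by (auto simp: fin_def)
    then have "(\<lambda>n. h n z) \<longlonglongrightarrow> g z" using z by (metis tendsto_uniform_limitI)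
    then have "\<forall>\<^sub>F n in sequentially. dist (h n z) (g z) < 1" by (rule tendstoD) simp
    moreover have "\<forall>\<^sub>F n in sequentially. norm (g z) + 1 < norm (h n z)"
      using z(4) unfolding inf_def by (rule allE[of _ "norm (g z) + 1"]) (auto elim: eventually_mono simp: z(2))
    ultimately have "\<forall>\<^sub>F n in sequentially. False"
    proof eventually_elim
      case (elim n)
      then show ?case using norm_triangle_ineq2[of "h n z" "g z"] by (simp add: dist_norm)
    qed
    then show False by simp
  qed
  moreover have "open W1" "open W2" by (auto simp: W1_def W2_def)
  moreover have "U \<subseteq> W1 \<union> W2"
    using loc by (fastforce simp: W1_def W2_def fin_def inf_def uniform_limit_or_infinity_def)
  ultimately have "W1 \<inter> U = {} \<or> W2 \<inter> U = {}" using connectedD[OF conn] by blast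
  then have "U \<subseteq> W1 \<or> U \<subseteq> W2" using \<open>U \<subseteq> W1 \<union> W2\<close> by blast
  then show ?thesis
  proof
    assume U: "U \<subseteq> W1"
    define g where "g z = lim (\<lambda>n. h n z)" for z
    have finV: "uniform_limit V h g sequentially" if V: "fin V" for V
    proof -
      obtain g' where g': "uniform_limit V h g' sequentially" using V by (auto simp: fin_def)
      have "g' z = g z" if "z \<in> V" for z
        using limI[OF tendsto_uniform_limitI[OF g' that]] by (simp add: g_def)
      then show ?thesis using g' uniform_limit_cong'[of V h h g' g] by blast
    qed
    have "uniform_limit K h g sequentially" if K: "compact K" "K \<subseteq> U" for K
    proof -
      have "K \<subseteq> \<Union>{V. open V \<and> fin V}" using K U by (simp add: W1_def)
      then obtain \<V> where \<V>: "\<V> \<subseteq> {V. open V \<and> fin V}" "finite \<V>" "K \<subseteq> \<Union>\<V>"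
        using compactE[OF K(1)] by (metis (no_types, lifting) mem_Collect_eq)
      have "uniform_limit (\<Union>\<V>) h g sequentially"
        by (rule uniform_limit_on_Union[OF \<V>(2)]) (use \<V>(1) finV in blast)
      then show ?thesis using \<V>(3) uniform_limit_on_subset by blast
    qed
    then show ?thesis unfolding converges_on_compacts_def by blast
  next
    assume U: "U \<subseteq> W2"
    have "\<forall>\<^sub>F n in sequentially. \<forall>z\<in>K. B < cmod (h n z)" if K: "compact K" "K \<subseteq> U" for K B
    proof -
      have "K \<subseteq> \<Union>{V. open V \<and> inf V}" using K U by (simp add: W2_def)
      then obtain \<V> where \<V>: "\<V> \<subseteq> {V. open V \<and> inf V}" "finite \<V>" "K \<subseteq> \<Union>\<V>"
        using compactE[OF K(1)] by (metis (no_types, lifting) mem_Collect_eq)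
      have "\<forall>\<^sub>F n in sequentially. \<forall>V\<in>\<V>. \<forall>z\<in>V. B < norm (h n z)"
        by (intro eventually_ball_finite \<V>(2)) (use \<V>(1) in \<open>auto simp: inf_def\<close>)
      then show ?thesis by eventually_elim (use \<V>(3) in blast)
    qed
    then show ?thesis unfolding converges_on_compacts_def by blast
  qed
qed

text \<open>The diagonal sequence is taken over a countable base of the topology: for each member of the
  base pass to a subsequence that converges on it, whenever there is one.\<close>

lemma ex_subseq_converges_on_compacts:
  fixes f :: "nat \<Rightarrow> complex \<Rightarrow> complex"
  assumes conn: "connected U"
    and loc: "\<And>z r. z \<in> U \<Longrightarrow> strict_mono r \<Longrightarrow>
       \<exists>s e. strict_mono (s :: nat \<Rightarrow> nat) \<and> 0 < e \<and> uniform_limit_or_infinity (ball z e) (f \<circ> r \<circ> s)"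
  shows "\<exists>r. strict_mono (r :: nat \<Rightarrow> nat) \<and> converges_on_compacts U (f \<circ> r)"
proof -
  obtain \<B> :: "complex set set" where \<B>: "countable \<B>" "topological_basis \<B>"
    using ex_countable_basis by blast
  have ne: "\<B> \<noteq> {}" using \<B>(2) by (metis UNIV_I empty_iff open_UNIV topological_basisE)
  define V where "V = from_nat_into \<B>"
  define P where "P i s \<longleftrightarrow> uniform_limit_or_infinity (V i) (f \<circ> s) \<or>
     (\<forall>s'. strict_mono s' \<longrightarrow> \<not> uniform_limit_or_infinity (V i) (f \<circ> s \<circ> s'))"
    for i and s :: "nat \<Rightarrow> nat"
  have P_dest: "uniform_limit_or_infinity (V i) (f \<circ> s)"
    if "P i s" "strict_mono s'" "uniform_limit_or_infinity (V i) (f \<circ> s \<circ> s')" for i s s'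
    using that unfolding P_def by blast
  interpret subseqs P
  proof
    fix i and s :: "nat \<Rightarrow> nat" assume "strict_mono s"
    show "\<exists>r'. strict_mono r' \<and> P i (s \<circ> r')"
    proof (cases "\<exists>r'. strict_mono r' \<and> uniform_limit_or_infinity (V i) (f \<circ> s \<circ> r')")
      case True
      then show ?thesis by (auto simp: P_def o_assoc)
    next
      case False
      then have "P i (s \<circ> id)" by (auto simp: P_def)
      then show ?thesis by (metis strict_mono_id)
    qed
  qed
  have stable: "P i (s \<circ> r)" if "strict_mono r" "P i s" for r s i
    using that uniform_limit_or_infinity_subseq[of "V i" "f \<circ> s" r] strict_mono_o[of r]
    unfolding P_def by (metis (no_types, lifting) comp_assoc)
  have holds: "P i (diagseq \<circ> (+) (Suc i))" for i by (rule diagseq_holds[OF stable])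
  have "\<exists>W. open W \<and> z \<in> W \<and> uniform_limit_or_infinity W (f \<circ> diagseq)" if z: "z \<in> U" for z
  proof -
    obtain s e where s: "strict_mono s" "0 < e" "uniform_limit_or_infinity (ball z e) (f \<circ> diagseq \<circ> s)"
      using loc[OF z subseq_diagseq] by blast
    obtain B where B: "B \<in> \<B>" "z \<in> B" "B \<subseteq> ball z e"
      using topological_basisE[OF \<B>(2) open_ball centre_in_ball[THEN iffD2, OF s(2)]] by blast
    obtain i where i: "V i = B" unfolding V_def using from_nat_into_surj[OF \<B>(1) B(1)] by blast
    define s' where "s' n = s (Suc i + n) - Suc i" for n
    have ge: "Suc i \<le> s (Suc i + n)" for n using seq_suble[OF s(1), of "Suc i + n"] by simp
    have mono: "strict_mono s'"
      unfolding strict_mono_Suc_iff s'_def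
    proof
      fix n show "s (Suc i + n) - Suc i < s (Suc i + Suc n) - Suc i"
        using strict_monoD[OF s(1), of "Suc i + n" "Suc i + Suc n"] ge[of n] by simp
    qed
    have "f \<circ> (diagseq \<circ> (+) (Suc i)) \<circ> s' = f \<circ> diagseq \<circ> s \<circ> (+) (Suc i)"
    proof
      fix n show "(f \<circ> (diagseq \<circ> (+) (Suc i)) \<circ> s') n = (f \<circ> diagseq \<circ> s \<circ> (+) (Suc i)) n"
        using ge[of n] by (simp add: s'_def)
    qed
    moreover have "strict_mono ((+) (Suc i))" by (simp add: strict_mono_def)
    ultimately have "uniform_limit_or_infinity (ball z e) (f \<circ> (diagseq \<circ> (+) (Suc i)) \<circ> s')"
      using uniform_limit_or_infinity_subseq[OF s(3), of "(+) (Suc i)"] by (simp only:)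
    then have "uniform_limit_or_infinity (V i) (f \<circ> (diagseq \<circ> (+) (Suc i)) \<circ> s')"
      by (rule uniform_limit_or_infinity_mono) (simp only: i B(3))
    then have "uniform_limit_or_infinity (V i) (f \<circ> (diagseq \<circ> (+) (Suc i)))"
      by (rule P_dest[OF holds mono])
    moreover have "f \<circ> (diagseq \<circ> (+) (Suc i)) = (\<lambda>n. (f \<circ> diagseq) (n + Suc i))"
      by (rule ext) (simp add: add.commute)
    ultimately have "uniform_limit_or_infinity (V i) (\<lambda>n. (f \<circ> diagseq) (n + Suc i))" by (simp only:)
    then have "uniform_limit_or_infinity (V i) (f \<circ> diagseq)"
      by (rule uniform_limit_or_infinity_shift)
    then show ?thesis using topological_basis_open[OF \<B>(2) B(1)] B(2) i by blast
  qed
  then have "converges_on_compacts U (f \<circ> diagseq)" by (rule converges_on_compacts_if_locally[OF conn])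
  then show ?thesis using subseq_diagseq by blast
qed

section \<open>Rescaling at a point of non-normality\<close>

text \<open>The size of \<open>a\<close> at the scale \<open>\<rho>\<close> around \<open>z\<close>, but never less than \<open>\<rho> ^ k\<close>. Dividing by it makes
  the rescalings of \<open>a\<close> converge, along subsequences, to a
  polynomial of degree at most \<open>k\<close>, whatever the order of
  vanishing of \<open>a\<close> may be. For \<open>a = 0\<close> it is the normalising factor of the Zalcman--Pang lemma.\<close>

definition weight :: "nat \<Rightarrow> (complex \<Rightarrow> complex) \<Rightarrow> complex \<Rightarrow> real \<Rightarrow> real" where
  "weight k a z \<rho> = \<rho> ^ k + (\<Sum>j<k. norm ((deriv ^^ j) a z) * \<rho> ^ j)"

text \<open>This is the spherical derivative at the origin of
  \<open>\<zeta> \<mapsto> F (z + \<rho> \<zeta>) / weight k a z \<rho>\<close>.\<close>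

definition rescaled_spherical_derivative ::
    "nat \<Rightarrow> (complex \<Rightarrow> complex) \<Rightarrow> (complex \<Rightarrow> complex) \<Rightarrow> complex \<Rightarrow> real \<Rightarrow> real" where
  "rescaled_spherical_derivative k a F z \<rho> =
     \<rho> * norm (deriv F z) * weight k a z \<rho> / ((weight k a z \<rho>)\<^sup>2 + (norm (F z))\<^sup>2)"

lemma weight_ge_power: "0 < \<rho> \<Longrightarrow> \<rho> ^ k \<le> weight k a z \<rho>"
  by (simp add: weight_def sum_nonneg)

lemma weight_pos: "0 < \<rho> \<Longrightarrow> 0 < weight k a z \<rho>"
  using weight_ge_power[of \<rho> k a z] zero_less_power[of \<rho> k] by linarith

lemma weight_ge_term: "j < k \<Longrightarrow> 0 < \<rho> \<Longrightarrow> norm ((deriv ^^ j) a z) * \<rho> ^ j \<le> weight k a z \<rho>"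
  unfolding weight_def
  by (rule order_trans[OF member_le_sum[of j "{..<k}" "\<lambda>j. norm ((deriv ^^ j) a z) * \<rho> ^ j"]]) auto

lemma continuous_on_weight:
  assumes "a holomorphic_on D" "open D"
  shows "continuous_on (D \<times> UNIV) (\<lambda>x. weight k a (fst x) (snd x))"
proof -
  have "continuous_on (D \<times> UNIV) (\<lambda>x. (deriv ^^ j) a (fst x))" for j
    by (rule continuous_on_compose2[OF holomorphic_on_imp_continuous_on[OF holomorphic_higher_deriv[OF assms]]])
       (auto intro!: continuous_intros)
  then show ?thesis unfolding weight_def by (intro continuous_intros)
qed

lemma continuous_on_rescaled_spherical_derivative:
  assumes a: "a holomorphic_on D" and D: "open D" and F: "F holomorphic_on D" and S: "S \<subseteq> D \<times> UNIV"
    and nz: "\<And>z \<rho>. (z, \<rho>) \<in> S \<Longrightarrow> F z \<noteq> 0 \<or> 0 < \<rho>"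
  shows "continuous_on S (\<lambda>x. rescaled_spherical_derivative k a F (fst x) (snd x))"
proof -
  have c: "continuous_on S (\<lambda>x. h (fst x))" if "h holomorphic_on D" for h :: "complex \<Rightarrow> complex"
    by (rule continuous_on_compose2[OF holomorphic_on_imp_continuous_on[OF that]]) (use S in \<open>auto intro!: continuous_intros\<close>)
  have w: "continuous_on S (\<lambda>x. weight k a (fst x) (snd x))"
    by (rule continuous_on_subset[OF continuous_on_weight[OF a D] S])
  have ne: "(weight k a z \<rho>)\<^sup>2 + (norm (F z))\<^sup>2 \<noteq> 0" if "(z, \<rho>) \<in> S" for z \<rho>
    using nz[OF that] weight_pos[of \<rho> k a z]
    by (metis add_nonneg_eq_0_iff less_irrefl norm_eq_zero power2_eq_iff_nonneg zero_le_power2 zero_eq_power2)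
  show ?thesis unfolding rescaled_spherical_derivative_def
    by (intro continuous_intros c w F holomorphic_deriv D) (use ne in auto)
qed

lemma rescaled_spherical_derivative_le_weight:
  assumes "0 < \<rho>"
  shows "rescaled_spherical_derivative k a F z \<rho> \<le> \<rho> * norm (deriv F z) / weight k a z \<rho>"
proof -
  define W where "W = weight k a z \<rho>"
  have W: "0 < W" using assms by (simp add: W_def weight_pos)
  have "\<rho> * norm (deriv F z) * W / (W\<^sup>2 + (norm (F z))\<^sup>2) \<le> \<rho> * norm (deriv F z) * W / W\<^sup>2"
    using W assms by (intro divide_left_mono mult_nonneg_nonneg mult_pos_pos) (auto simp: add_pos_nonneg)
  also have "\<dots> = \<rho> * norm (deriv F z) / W" using W by (simp add: power2_eq_square)
  finally show ?thesis by (simp add: rescaled_spherical_derivative_def W_def)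
qed

lemma rescaled_spherical_derivative_le_value:
  assumes "0 < \<rho>" "F z \<noteq> 0"
  shows "rescaled_spherical_derivative k a F z \<rho> \<le> \<rho> * norm (deriv F z) / (2 * norm (F z))"
proof -
  define W where "W = weight k a z \<rho>"
  have W: "0 < W" using assms by (simp add: W_def weight_pos)
  have F: "0 < norm (F z)" using assms by simp
  have "2 * W * norm (F z) \<le> W\<^sup>2 + (norm (F z))\<^sup>2" by (rule sum_squares_bound)
  then have "\<rho> * norm (deriv F z) * W / (W\<^sup>2 + (norm (F z))\<^sup>2) \<le> \<rho> * norm (deriv F z) * W / (2 * W * norm (F z))"
    using W F assms by (intro divide_left_mono mult_nonneg_nonneg mult_pos_pos) (auto simp: add_pos_nonneg)
  also have "\<dots> = \<rho> * norm (deriv F z) / (2 * norm (F z))" using W by simp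
  finally show ?thesis by (simp add: rescaled_spherical_derivative_def W_def)
qed

text \<open>The condition on the zeros that keeps the rescaled spherical derivative of a single function below
  \<open>N\<close> at small scales. Either \<open>F\<close> vanishes to an order greater than the order \<open>j\<close> of the weight as a
  function of the scale, or both orders are 1 and the derivative itself is smaller than \<open>N\<close>.\<close>

definition admissible_zero :: "nat \<Rightarrow> (complex \<Rightarrow> complex) \<Rightarrow> real \<Rightarrow> (complex \<Rightarrow> complex) \<Rightarrow> complex \<Rightarrow> bool" where
  "admissible_zero k a N F z \<longleftrightarrow>
     (\<exists>j. (\<forall>i\<le>j. (deriv ^^ i) F z = 0) \<and> (j = k \<or> j < k \<and> (deriv ^^ j) a z \<noteq> 0)) \<or>
     k = 1 \<and> norm (deriv F z) < N"

text \<open>Write \<open>F w = (w - z) ^ s * v w\<close>. If \<open>\<bar>w - z\<bar>\<close> is large compared to \<open>\<rho>\<close>, then the logarithmic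
  derivative of \<open>F\<close>, which is of the order of \<open>1 / \<bar>w - z\<bar>\<close>, gives the bound. Otherwise \<open>\<rho> \<bar>F'\<bar>\<close> is of
  the order of \<open>\<rho> ^ s\<close>, which is small compared to the weight.\<close>

lemma rescaled_spherical_derivative_small_near:
  assumes a: "a holomorphic_on D" and D: "open D" "z \<in> D" and F: "F holomorphic_on D" and N: "0 < N"
    and zero: "F z = 0 \<Longrightarrow> admissible_zero k a N F z"
  shows "\<exists>\<delta>>0. \<forall>w \<in> ball z \<delta>. \<forall>\<rho>. 0 < \<rho> \<and> \<rho> < \<delta> \<longrightarrow> rescaled_spherical_derivative k a F w \<rho> < N"
proof (cases "F z = 0")
  case False
  define S where "S = {w \<in> D. F w \<noteq> 0} \<times> (UNIV :: real set)"
  have oF: "open {w \<in> D. F w \<noteq> 0}"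
    using continuous_open_preimage[OF holomorphic_on_imp_continuous_on[OF F] D(1), of "- {0}"]
    by (simp add: vimage_def Int_def open_Compl)
  have "open S" unfolding S_def by (intro open_Times oF) auto
  moreover have "continuous_on S (\<lambda>x. rescaled_spherical_derivative k a F (fst x) (snd x))"
    by (rule continuous_on_rescaled_spherical_derivative[OF a D(1) F]) (auto simp: S_def)
  ultimately have "open {x \<in> S. rescaled_spherical_derivative k a F (fst x) (snd x) < N}"
    using continuous_open_preimage[of S _ "{..<N}"] by (fastforce simp: vimage_def Int_def)
  moreover have "(z, 0) \<in> {x \<in> S. rescaled_spherical_derivative k a F (fst x) (snd x) < N}"
    using False D N by (simp add: S_def rescaled_spherical_derivative_def)
  ultimately obtain A B where AB: "open A" "open B" "z \<in> A" "0 \<in> B"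
    "A \<times> B \<subseteq> {x \<in> S. rescaled_spherical_derivative k a F (fst x) (snd x) < N}"
    by (rule open_prod_elim) auto
  obtain e1 e2 where e: "0 < e1" "ball z e1 \<subseteq> A" "0 < e2" "ball 0 e2 \<subseteq> B" using AB openE by metis
  show ?thesis
  proof (intro exI[of _ "min e1 e2"] conjI ballI allI impI)
    fix w \<rho> assume "w \<in> ball z (min e1 e2)" "0 < \<rho> \<and> \<rho> < min e1 e2"
    then have "w \<in> A" "\<rho> \<in> B" using e by auto
    then have "(w, \<rho>) \<in> {x \<in> S. rescaled_spherical_derivative k a F (fst x) (snd x) < N}" using AB(5) by blast
    then show "rescaled_spherical_derivative k a F w \<rho> < N" by simp
  qed (use e in auto)
next
  case 0: True
  from zero[OF 0] consider
      (simple) "k = 1" "norm (deriv F z) < N"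
    | (multiple) j where "\<And>i. i \<le> j \<Longrightarrow> (deriv ^^ i) F z = 0" "j = k \<or> j < k \<and> (deriv ^^ j) a z \<noteq> 0"
    unfolding admissible_zero_def by blast
  then show ?thesis
  proof cases
    case simple
    have "continuous_on D (\<lambda>w. norm (deriv F w))"
      by (intro continuous_intros holomorphic_on_imp_continuous_on holomorphic_deriv F D)
    then have "open {w \<in> D. norm (deriv F w) < N}"
      using continuous_open_preimage[of D "\<lambda>w. norm (deriv F w)" "{..<N}"] D by (simp add: vimage_def Int_def)
    then obtain \<delta> where \<delta>: "\<delta> > 0" "ball z \<delta> \<subseteq> {w \<in> D. norm (deriv F w) < N}"
      using simple D openE by (metis (mono_tags, lifting) mem_Collect_eq)
    show ?thesis
    proof (intro exI[of _ \<delta>] conjI ballI allI impI \<delta>(1))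
      fix w \<rho> assume w: "w \<in> ball z \<delta>" and \<rho>: "0 < \<rho> \<and> \<rho> < \<delta>"
      have "rescaled_spherical_derivative k a F w \<rho> \<le> \<rho> * norm (deriv F w) / weight k a w \<rho>"
        using \<rho> by (intro rescaled_spherical_derivative_le_weight) auto
      also have "\<dots> \<le> \<rho> * norm (deriv F w) / \<rho>"
        using \<rho> weight_ge_power[of \<rho> k a w] simple(1) weight_pos[of \<rho> k a w] by (intro divide_left_mono) auto
      also have "\<dots> < N" using \<rho> w \<delta> by auto
      finally show "rescaled_spherical_derivative k a F w \<rho> < N" .
    qed
  next
    case multiple
    have "\<exists>c>0. \<exists>\<delta>>0. \<forall>w \<in> ball z \<delta>. \<forall>\<rho>>0. c * \<rho> ^ j \<le> weight k a w \<rho>"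
    proof (cases "j = k")
      case True
      then show ?thesis using weight_ge_power by (intro exI[of _ 1] conjI) auto
    next
      case False
      with multiple have j: "j < k" "(deriv ^^ j) a z \<noteq> 0" by auto
      define c where "c = norm ((deriv ^^ j) a z) / 2"
      have c: "0 < c" "c < norm ((deriv ^^ j) a z)" using j by (auto simp: c_def)
      have "continuous_on D (\<lambda>w. norm ((deriv ^^ j) a w))"
        by (intro continuous_intros holomorphic_on_imp_continuous_on holomorphic_higher_deriv a D)
      then have "open {w \<in> D. c < norm ((deriv ^^ j) a w)}"
        using continuous_open_preimage[of D "\<lambda>w. norm ((deriv ^^ j) a w)" "{c<..}"] D by (simp add: vimage_def Int_def)
      then obtain \<delta> where \<delta>: "\<delta> > 0" "ball z \<delta> \<subseteq> {w \<in> D. c < norm ((deriv ^^ j) a w)}"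
        using c D openE by (metis (mono_tags, lifting) mem_Collect_eq)
      have "c * \<rho> ^ j \<le> weight k a w \<rho>" if "w \<in> ball z \<delta>" "\<rho> > 0" for w \<rho>
      proof -
        have "c * \<rho> ^ j \<le> norm ((deriv ^^ j) a w) * \<rho> ^ j"
          using that \<delta>(2) by (intro mult_right_mono) (auto intro: less_imp_le)
        then show ?thesis using weight_ge_term[OF j(1) that(2), of a w] by linarith
      qed
      then show ?thesis using c \<delta> by blast
    qed
    then obtain c \<delta>1 where c: "0 < c" "0 < \<delta>1" "\<And>w \<rho>. w \<in> ball z \<delta>1 \<Longrightarrow> 0 < \<rho> \<Longrightarrow> c * \<rho> ^ j \<le> weight k a w \<rho>"
      by blast
    obtain r0 where r0: "0 < r0" "ball z r0 \<subseteq> D" using D openE by blast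
    have Fb: "F holomorphic_on ball z r0" using F r0 holomorphic_on_subset by blast
    show ?thesis
    proof (cases "\<exists>n. (deriv ^^ n) F z \<noteq> 0")
      case False
      have Fz: "F w = 0" if "w \<in> ball z r0" for w
        by (rule holomorphic_fun_eq_0_on_connected[OF Fb open_ball connected_ball _ _ that, of z]) (use False r0 in auto)
      show ?thesis
      proof (intro exI[of _ r0] conjI ballI allI impI r0)
        fix w \<rho> assume w: "w \<in> ball z r0"
        have "deriv F w = deriv (\<lambda>_. 0) w"
          by (rule complex_derivative_transform_within_open[OF Fb _ open_ball w]) (use Fz in auto)
        then show "rescaled_spherical_derivative k a F w \<rho> < N"
          using N by (simp add: rescaled_spherical_derivative_def)
      qed
    next
      case True
      define s where "s = (LEAST n. (deriv ^^ n) F z \<noteq> 0)"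
      have s: "(deriv ^^ s) F z \<noteq> 0" "\<And>i. i < s \<Longrightarrow> (deriv ^^ i) F z = 0"
        using LeastI_ex[OF True] not_less_Least[of _ "\<lambda>n. (deriv ^^ n) F z \<noteq> 0"]
        by (auto simp: s_def)
      have sj: "j < s" using s(1) multiple(1) by (meson not_le)
      then obtain s' where s': "s = Suc s'" by (metis less_imp_Suc_add)
      obtain v r where v: "0 < r" "v holomorphic_on ball z r"
        "\<And>w. w \<in> ball z r \<Longrightarrow> F w - F z = (w - z) ^ s * v w" "\<And>w. w \<in> ball z r \<Longrightarrow> v w \<noteq> 0"
        by (rule holomorphic_factor_order_of_zero[OF F D(1,2) _ s(1)]) (use sj s(2) in auto)
      define u where "u w = of_nat s * v w + (w - z) * deriv v w" for w
      have dF: "deriv F w = (w - z) ^ s' * u w" if w: "w \<in> ball z r" for w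
      proof -
        have "(v has_field_derivative deriv v w) (at w)" by (rule holomorphic_derivI[OF v(2) open_ball w])
        moreover have "((\<lambda>w. w - z) has_field_derivative 1) (at w)" by (auto intro!: derivative_eq_intros)
        then have "((\<lambda>w. (w - z) ^ Suc s') has_field_derivative (1 + of_nat s') * (1 * (w - z) ^ s')) (at w)"
          by (rule DERIV_power_Suc)
        ultimately have "((\<lambda>w. (w - z) ^ Suc s' * v w) has_field_derivative
            (1 + of_nat s') * (1 * (w - z) ^ s') * v w + deriv v w * (w - z) ^ Suc s') (at w)"
          by (intro DERIV_mult)
        then have "((\<lambda>w. (w - z) ^ s * v w) has_field_derivative (w - z) ^ s' * u w) (at w)"
          unfolding s' u_def by (simp add: algebra_simps)
        moreover have "\<forall>\<^sub>F x in nhds w. F x = (x - z) ^ s * v x"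
          using eventually_nhds_in_open[OF open_ball w] by eventually_elim (use v(3) 0 in auto)
        ultimately have "(F has_field_derivative (w - z) ^ s' * u w) (at w)"
          by (rule DERIV_cong_ev[OF refl _ refl, THEN iffD2, rotated])
        then show ?thesis by (rule DERIV_imp_deriv)
      qed
      have sub: "cball z (r / 2) \<subseteq> ball z r" using v(1) by auto
      have contv: "continuous_on (cball z (r / 2)) (\<lambda>w. norm (v w))"
        by (intro continuous_intros continuous_on_subset[OF holomorphic_on_imp_continuous_on[OF v(2)] sub])
      obtain w0 where w0: "w0 \<in> cball z (r / 2)" "\<And>w. w \<in> cball z (r / 2) \<Longrightarrow> norm (v w0) \<le> norm (v w)"
        using continuous_attains_inf[OF compact_cball _ contv] v(1) by auto
      define c1 where "c1 = norm (v w0)"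
      have c1: "0 < c1" "\<And>w. w \<in> cball z (r / 2) \<Longrightarrow> c1 \<le> norm (v w)"
        using w0 v(4) sub by (auto simp: c1_def)
      have "continuous_on (cball z (r / 2)) u"
        unfolding u_def
        by (intro continuous_intros continuous_on_subset[OF holomorphic_on_imp_continuous_on sub] holomorphic_deriv v) auto
      then have "bounded (u ` cball z (r / 2))"
        by (intro compact_imp_bounded compact_continuous_image) auto
      then obtain C1 where C1: "0 < C1" "\<And>w. w \<in> cball z (r / 2) \<Longrightarrow> norm (u w) \<le> C1"
        unfolding bounded_pos by auto
      \<comment> \<open>the ratio \<open>\<bar>w - z\<bar> / \<rho>\<close> beyond which the logarithmic derivative gives the bound \<open>N / 2\<close>\<close>
      define K where "K = C1 / (c1 * N)"
      have K: "0 < K" using C1 c1 N by (simp add: K_def)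
      define M where "M = C1 * K ^ s' / c"
      have M: "0 < M" using C1 K c by (simp add: M_def)
      define \<delta> where "\<delta> = min (min 1 \<delta>1) (min (r / 2) (N / M))"
      have \<delta>: "0 < \<delta>" using c v(1) N M by (simp add: \<delta>_def)
      have \<delta>_le: "\<delta> \<le> 1" "\<delta> \<le> \<delta>1" "\<delta> \<le> r / 2" "\<delta> \<le> N / M" unfolding \<delta>_def by linarith+
      show ?thesis
      proof (intro exI[of _ \<delta>] conjI ballI allI impI \<delta>)
        fix w \<rho> assume w: "w \<in> ball z \<delta>" and \<rho>: "0 < \<rho> \<and> \<rho> < \<delta>"
        define x where "x = norm (w - z)"
        have wr: "w \<in> cball z (r / 2)" "w \<in> ball z r" using w \<delta>_le v(1) by auto
        have dFx: "norm (deriv F w) \<le> x ^ s' * C1"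
          using C1(2)[OF wr(1)] by (simp add: dF[OF wr(2)] norm_mult norm_power x_def mult_left_mono)
        show "rescaled_spherical_derivative k a F w \<rho> < N"
        proof (cases "x \<le> K * \<rho>")
          case True
          have "\<rho> * norm (deriv F w) \<le> \<rho> * ((K * \<rho>) ^ s' * C1)"
            using True \<rho> C1 dFx by (intro mult_left_mono order_trans[OF dFx] mult_right_mono power_mono) (auto simp: x_def)
          also have "\<dots> = C1 * K ^ s' * \<rho> ^ s" by (simp add: s' power_mult_distrib mult_ac)
          also have "\<rho> ^ s \<le> \<rho> ^ Suc j" using sj \<rho> \<delta>_le by (intro power_decreasing) auto
          finally have 1: "\<rho> * norm (deriv F w) \<le> C1 * K ^ s' * \<rho> ^ Suc j" using C1 K by simp
          have "rescaled_spherical_derivative k a F w \<rho> \<le> \<rho> * norm (deriv F w) / weight k a w \<rho>"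
            using \<rho> by (intro rescaled_spherical_derivative_le_weight) auto
          also have "\<dots> \<le> (C1 * K ^ s' * \<rho> ^ Suc j) / (c * \<rho> ^ j)"
            using 1 c(1) c(3)[of w \<rho>] w \<rho> \<delta>_le C1 K by (intro frac_le) auto
          also have "\<dots> = M * \<rho>" using \<rho> c(1) by (simp add: M_def)
          also have "\<dots> < M * \<delta>" using \<rho> M by simp
          also have "\<dots> \<le> N" using \<delta>_le(4) M by (simp add: field_simps)
          finally show ?thesis .
        next
          case False
          then have x: "K * \<rho> < x" "0 < x" using K \<rho> by (auto intro: less_trans[of 0 "K * \<rho>"])
          have Fx: "c1 * x ^ s \<le> norm (F w)"
            using v(3)[OF wr(2)] 0 mult_right_mono[OF c1(2)[OF wr(1)], of "norm (w - z) ^ s"]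
            by (simp add: norm_mult norm_power x_def mult.commute)
          moreover have "0 < c1 * x ^ s" using c1(1) x by simp
          ultimately have Fnz: "0 < norm (F w)" by linarith
          have "rescaled_spherical_derivative k a F w \<rho> \<le> \<rho> * norm (deriv F w) / (2 * norm (F w))"
            using \<rho> Fnz by (intro rescaled_spherical_derivative_le_value) auto
          also have "\<dots> \<le> \<rho> * (x ^ s' * C1) / (2 * (c1 * x ^ s))"
            using Fx dFx \<rho> c1(1) x C1(1) by (intro frac_le mult_left_mono) auto
          also have "\<dots> = (\<rho> / x) * (C1 / (2 * c1))" using x by (simp add: s')
          also have "\<dots> \<le> (1 / K) * (C1 / (2 * c1))"
            using x K \<rho> C1 c1 by (intro mult_right_mono) (auto simp: field_simps)
          also have "\<dots> = N / 2" using C1 c1 N by (simp add: K_def)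
          also have "\<dots> < N" using N by simp
          finally show ?thesis .
        qed
      qed
    qed
  qed
qed

lemma rescaled_spherical_derivative_small:
  assumes a: "a holomorphic_on D" and D: "open D" and F: "F holomorphic_on D" and N: "0 < N"
    and zero: "\<And>z. z \<in> D \<Longrightarrow> F z = 0 \<Longrightarrow> admissible_zero k a N F z"
    and K: "compact K" "K \<subseteq> D"
  shows "\<exists>\<delta>>0. \<forall>w \<in> K. \<forall>\<rho>. 0 < \<rho> \<and> \<rho> < \<delta> \<longrightarrow> rescaled_spherical_derivative k a F w \<rho> < N"
proof -
  have "\<forall>z\<in>K. \<exists>\<delta>>0. \<forall>w \<in> ball z \<delta>. \<forall>\<rho>. 0 < \<rho> \<and> \<rho> < \<delta> \<longrightarrow> rescaled_spherical_derivative k a F w \<rho> < N"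
    using rescaled_spherical_derivative_small_near[OF a D _ F N zero] K(2) by blast
  then obtain \<delta> where \<delta>: "\<And>z. z \<in> K \<Longrightarrow> 0 < \<delta> z"
    "\<And>z w \<rho>. z \<in> K \<Longrightarrow> w \<in> ball z (\<delta> z) \<Longrightarrow> 0 < \<rho> \<Longrightarrow> \<rho> < \<delta> z \<Longrightarrow> rescaled_spherical_derivative k a F w \<rho> < N"
    by metis
  have "K \<subseteq> (\<Union>z\<in>K. ball z (\<delta> z))" using \<delta>(1) by force
  then obtain T where T: "T \<subseteq> K" "finite T" "K \<subseteq> (\<Union>z\<in>T. ball z (\<delta> z))"
    by (rule compactE_image[OF K(1), rotated]) auto
  define d where "d = Min (insert 1 (\<delta> ` T))"
  have "0 < d" using T \<delta>(1) by (auto simp: d_def)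
  moreover have "d \<le> \<delta> z" if "z \<in> T" for z using T that by (auto simp: d_def)
  ultimately show ?thesis using T(1,3) \<delta>(2) by (intro exI[of _ d]) fastforce
qed

text \<open>Among all scales \<open>t * (r - dist z0 w)\<close> choose the smallest \<open>t\<close> for which the supremum over the
  disc still reaches the level \<open>N\<close>.\<close>

lemma ex_critical_scale:
  fixes H :: "complex \<Rightarrow> real \<Rightarrow> real"
  assumes cont: "continuous_on (cball z0 r \<times> {0<..}) (\<lambda>x. H (fst x) (snd x))"
    and \<delta>: "0 < \<delta>" and small: "\<And>w \<rho>. w \<in> cball z0 r \<Longrightarrow> 0 < \<rho> \<Longrightarrow> \<rho> < \<delta> \<Longrightarrow> H w \<rho> < N"
    and t0: "0 < t0" and z: "z \<in> ball z0 r" "N < H z (t0 * (r - dist z0 z))"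
  obtains z1 t1 where "z1 \<in> ball z0 r" "0 < t1" "t1 \<le> t0" "H z1 (t1 * (r - dist z0 z1)) = N"
    "\<And>w. w \<in> ball z0 r \<Longrightarrow> H w (t1 * (r - dist z0 w)) \<le> N"
proof -
  define \<rho> where "\<rho> x = snd x * (r - dist z0 (fst x))" for x :: "complex \<times> real"
  define Y where "Y = {x \<in> cball z0 r \<times> {0..t0}. \<delta> \<le> \<rho> x}"
  define X where "X = {x \<in> Y. N \<le> H (fst x) (\<rho> x)}"
  have cp: "compact (cball z0 r \<times> {0..t0})" by (intro compact_Times) auto
  have c\<rho>: "continuous_on A \<rho>" for A unfolding \<rho>_def by (intro continuous_intros)
  have clY: "closed Y" unfolding Y_def
    by (intro continuous_on_closed_Collect_le c\<rho> continuous_intros compact_imp_closed cp)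
  have "continuous_on Y (\<lambda>x. (fst x, \<rho> x))" by (intro continuous_intros c\<rho>)
  moreover have "(\<lambda>x. (fst x, \<rho> x)) ` Y \<subseteq> cball z0 r \<times> {0<..}" using \<delta> by (auto simp: Y_def)
  ultimately have cH: "continuous_on Y (\<lambda>x. H (fst x) (\<rho> x))"
    using continuous_on_compose2[OF cont, of Y "\<lambda>x. (fst x, \<rho> x)"] by simp
  have "closed X" unfolding X_def by (intro continuous_on_closed_Collect_le cH clY continuous_intros)
  moreover have "X \<subseteq> cball z0 r \<times> {0..t0}" by (auto simp: X_def Y_def)
  ultimately have "compact X" using cp by (metis compact_Int_closed inf.absorb2)
  have zc: "z \<in> cball z0 r" using z(1) by auto
  have pos: "0 < t0 * (r - dist z0 z)" using t0 z(1) by simp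
  then have "\<delta> \<le> t0 * (r - dist z0 z)" using small[OF zc pos] z(2) by force
  then have "(z, t0) \<in> X" using zc t0 z by (auto simp: X_def Y_def \<rho>_def)
  then have "X \<noteq> {}" by auto
  then obtain x where x: "x \<in> X" "\<And>y. y \<in> X \<Longrightarrow> snd x \<le> snd y"
    using continuous_attains_inf[OF \<open>compact X\<close>, of snd] continuous_on_snd[OF continuous_on_id] by blast
  obtain z1 t1 where zt: "x = (z1, t1)" by (cases x)
  have x1: "z1 \<in> cball z0 r" "0 \<le> t1" "t1 \<le> t0" "\<delta> \<le> t1 * (r - dist z0 z1)" "N \<le> H z1 (t1 * (r - dist z0 z1))"
    using x(1) by (auto simp: X_def Y_def zt \<rho>_def)
  have p1: "0 < t1 * (r - dist z0 z1)" using x1(4) \<delta> by linarith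
  then have t1: "0 < t1" "z1 \<in> ball z0 r" using x1(1,2) by (auto simp: zero_less_mult_iff)
  have less: "H w (t * (r - dist z0 w)) < N" if w: "w \<in> ball z0 r" and t: "0 < t" "t < t1" for w t
  proof (rule ccontr)
    assume *: "\<not> H w (t * (r - dist z0 w)) < N"
    have "0 < t * (r - dist z0 w)" using w t by simp
    then have "\<delta> \<le> t * (r - dist z0 w)" using small[of w "t * (r - dist z0 w)"] * w by force
    then have "(w, t) \<in> X" using * w t x1(3) by (auto simp: X_def Y_def \<rho>_def)
    then show False using x(2)[of "(w, t)"] t by (simp add: zt)
  qed
  have le: "H w (t1 * (r - dist z0 w)) \<le> N" if w: "w \<in> ball z0 r" for w
  proof -
    have "continuous_on {0<..} (\<lambda>t. (w, t * (r - dist z0 w)))" by (intro continuous_intros)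
    moreover have "(\<lambda>t. (w, t * (r - dist z0 w))) ` {0<..} \<subseteq> cball z0 r \<times> {0<..}" using w by auto
    ultimately have "continuous_on {0<..} (\<lambda>t. H w (t * (r - dist z0 w)))"
      using continuous_on_compose2[OF cont, of "{0<..}" "\<lambda>t. (w, t * (r - dist z0 w))"] by simp
    then have "isCont (\<lambda>t. H w (t * (r - dist z0 w))) t1"
      using t1 continuous_on_eq_continuous_at open_greaterThan by (metis greaterThan_iff)
    then have "((\<lambda>t. H w (t * (r - dist z0 w))) \<longlongrightarrow> H w (t1 * (r - dist z0 w))) (at_left t1)"
      unfolding continuous_at by (rule filterlim_mono) (auto simp: at_le)
    moreover have "\<forall>\<^sub>F t in at_left t1. H w (t * (r - dist z0 w)) \<le> N"
      using eventually_at_left_field[of "\<lambda>t. H w (t * (r - dist z0 w)) \<le> N" t1] t1 less[OF w] by (force intro: less_imp_le)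
    ultimately show ?thesis by (intro tendsto_upperbound) auto
  qed
  show ?thesis using that[OF t1(2,1) x1(3) _ le] le[OF t1(2)] x1(5) by linarith
qed

lemma convergent_subseq_if_rescaled_spherical_derivative_bounded:
  fixes F :: "nat \<Rightarrow> complex \<Rightarrow> complex"
  assumes a: "a holomorphic_on D" and D: "open D" "cball z0 r \<subseteq> D" and r: "0 < r" and t: "0 < t"
    and F: "\<And>n. F n holomorphic_on D"
    and bd: "\<And>n w. w \<in> ball z0 r \<Longrightarrow> rescaled_spherical_derivative k a (F n) w (t * (r - dist z0 w)) \<le> N"
    and N: "0 < N"
  shows "\<exists>s e. strict_mono (s :: nat \<Rightarrow> nat) \<and> 0 < e \<and> uniform_limit_or_infinity (ball z0 e) (F \<circ> s)"
proof -
  define I where "I = {t * r / 2..t * r}"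
  have "continuous_on (cball z0 r \<times> I) (\<lambda>x. weight k a (fst x) (snd x))"
    by (rule continuous_on_subset[OF continuous_on_weight[OF a D(1)]]) (use D in auto)
  moreover have "compact (cball z0 r \<times> I)" unfolding I_def by (intro compact_Times) auto
  ultimately have "bounded ((\<lambda>x. weight k a (fst x) (snd x)) ` (cball z0 r \<times> I))"
    by (intro compact_imp_bounded compact_continuous_image)
  then obtain M where M0: "0 < M" "\<forall>x \<in> (\<lambda>x. weight k a (fst x) (snd x)) ` (cball z0 r \<times> I). norm x \<le> M"
    unfolding bounded_pos by blast
  have M: "weight k a w \<rho> \<le> M" if "w \<in> cball z0 r" "\<rho> \<in> I" for w \<rho>
  proof -
    have "weight k a w \<rho> \<in> (\<lambda>x. weight k a (fst x) (snd x)) ` (cball z0 r \<times> I)"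
      using that by (intro image_eqI[of _ _ "(w, \<rho>)"]) auto
    then show ?thesis using M0(2) by force
  qed
  define p where "p = t * r / 2"
  have p: "0 < p" using t r by (simp add: p_def)
  define C where "C = N * (M\<^sup>2 + 1) / (p * p ^ k)"
  have r2: "0 < r / 2" using r by simp
  have "\<forall>\<^sub>F n in sequentially. F n holomorphic_on ball z0 (r / 2) \<and>
        (\<forall>w\<in>ball z0 (r / 2). norm (deriv (F n) w) \<le> C * (1 + (norm (F n w))\<^sup>2))"
  proof (intro always_eventually allI conjI ballI)
      fix n
      have "ball z0 (r / 2) \<subseteq> D" using D(2) r by (auto simp: subset_iff)
      then show "F n holomorphic_on ball z0 (r / 2)" using F holomorphic_on_subset by blast
      fix w assume w: "w \<in> ball z0 (r / 2)"
      define \<rho> where "\<rho> = t * (r - dist z0 w)"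
      define W where "W = weight k a w \<rho>"
      have "t * (r / 2) \<le> t * (r - dist z0 w)" using w t by (intro mult_left_mono) auto
      then have \<rho>: "p \<le> \<rho>" by (simp add: p_def \<rho>_def)
      have "t * (r - dist z0 w) \<le> t * r" using t by (intro mult_left_mono) auto
      with \<rho> have "\<rho> \<in> I" by (simp add: I_def p_def \<rho>_def)
      moreover have wr: "w \<in> ball z0 r" using w r by auto
      ultimately have W: "W \<le> M" unfolding W_def by (intro M) auto
      have "p ^ k \<le> \<rho> ^ k" using \<rho> p by (intro power_mono) auto
      then have Wp: "p ^ k \<le> W" using weight_ge_power[of \<rho> k a w] \<rho> p by (simp add: W_def)
      have Wpos: "0 < W" using weight_pos[of \<rho> k a w] \<rho> p by (simp add: W_def)
      define G where "G = (norm (F n w))\<^sup>2"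
      have G: "0 \<le> G" by (simp add: G_def)
      have "\<rho> * norm (deriv (F n) w) * W / (W\<^sup>2 + G) \<le> N"
        using bd[OF wr, of n] by (simp add: rescaled_spherical_derivative_def W_def \<rho>_def G_def)
      then have "\<rho> * norm (deriv (F n) w) * W \<le> N * (W\<^sup>2 + G)"
        using Wpos G by (simp add: divide_le_eq add_pos_nonneg)
      then have "norm (deriv (F n) w) \<le> N * (W\<^sup>2 + G) / (\<rho> * W)"
        using Wpos \<rho> p by (simp add: le_divide_eq mult_ac)
      also have "\<dots> \<le> N * (M\<^sup>2 + G) / (p * p ^ k)"
      proof (rule frac_le)
        have "W\<^sup>2 \<le> M\<^sup>2" using W Wpos by (intro power_mono) auto
        then show "N * (W\<^sup>2 + G) \<le> N * (M\<^sup>2 + G)" using N by simp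
        show "p * p ^ k \<le> \<rho> * W" using \<rho> Wp p by (intro mult_mono) auto
      qed (use N G p in auto)
      also have "\<dots> \<le> N * ((M\<^sup>2 + 1) * (1 + G)) / (p * p ^ k)"
      proof (rule divide_right_mono)
        have "M\<^sup>2 + G \<le> (M\<^sup>2 + 1) * (1 + G)" using G by (simp add: algebra_simps)
        then show "N * (M\<^sup>2 + G) \<le> N * ((M\<^sup>2 + 1) * (1 + G))" using N by simp
      qed (use p in simp)
      also have "\<dots> = C * (1 + G)" by (simp add: C_def)
      finally show "norm (deriv (F n) w) \<le> C * (1 + (norm (F n w))\<^sup>2)" by (simp only: G_def)
  qed
  then show ?thesis by (rule Marty_criterion[OF r2])
qed

lemma ex_strict_mono_if_eventually:
  assumes ev: "\<And>m. \<forall>\<^sub>F n in sequentially. P m n"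
  shows "\<exists>s. strict_mono (s :: nat \<Rightarrow> nat) \<and> (\<forall>m. P m (s m))"
proof -
  have step: "\<exists>n'. P m n' \<and> n < n'" for m n
    by (rule eventually_happens'[OF sequentially_bot eventually_conj[OF ev[of m] eventually_gt_at_top[of n]]])
  have "\<exists>s. \<forall>m. P m (s m) \<and> s m < s (Suc m)"
    by (rule dependent_nat_choice) (use step in blast)+
  then show ?thesis by (auto simp: strict_mono_Suc_iff)
qed

lemma ex_common_subseq:
  fixes Q :: "nat \<Rightarrow> (nat \<Rightarrow> nat) \<Rightarrow> bool"
  assumes ex: "\<And>j (s :: nat \<Rightarrow> nat). strict_mono s \<Longrightarrow> \<exists>r. strict_mono r \<and> Q j (s \<circ> r)"
    and stable: "\<And>j (s :: nat \<Rightarrow> nat) r. strict_mono r \<Longrightarrow> Q j s \<Longrightarrow> Q j (s \<circ> r)"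
  shows "\<exists>r. strict_mono r \<and> (\<forall>j<k. Q j r)"
proof (induction k)
  case 0
  show ?case by (rule exI[of _ id]) (simp add: strict_mono_def)
next
  case (Suc k)
  then obtain r where r: "strict_mono r" "\<And>j. j < k \<Longrightarrow> Q j r" by blast
  obtain r' where r': "strict_mono r'" "Q k (r \<circ> r')" using ex[OF r(1)] by blast
  have "Q j (r \<circ> r')" if "j < Suc k" for j
  proof (cases "j = k")
    case True
    then show ?thesis using r'(2) by simp
  next
    case False
    then show ?thesis using stable[OF r'(1) r(2)] that by simp
  qed
  then show ?case using strict_mono_o[OF r(1) r'(1)] by blast
qed

text \<open>For fixed positive scales a bound for the rescaled spherical derivatives would give a convergent
  subsequence by Marty's criterion. So, on discs of radius tending to 0 and for scale parameters
  tending to 0, almost all functions exceed the level \<open>N\<close>, and a critical scale exists.\<close>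

lemma ex_rescaling_points:
  fixes F :: "nat \<Rightarrow> complex \<Rightarrow> complex"
  assumes a: "a holomorphic_on D" and D: "open D" "z0 \<in> D"
    and F: "\<And>n. F n holomorphic_on D" and N: "0 < N"
    and zero: "\<And>n z. z \<in> D \<Longrightarrow> F n z = 0 \<Longrightarrow> admissible_zero k a N (F n) z"
    and no: "\<And>s e. strict_mono (s :: nat \<Rightarrow> nat) \<Longrightarrow> 0 < e \<Longrightarrow> \<not> uniform_limit_or_infinity (ball z0 e) (F \<circ> s)"
  obtains s z t r where "strict_mono (s :: nat \<Rightarrow> nat)" "r \<longlonglongrightarrow> (0::real)" "t \<longlonglongrightarrow> 0"
    "\<And>m. 0 < t m" "\<And>m. z m \<in> ball z0 (r m)" "\<And>m. cball z0 (r m) \<subseteq> D"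
    "\<And>m. rescaled_spherical_derivative k a (F (s m)) (z m) (t m * (r m - dist z0 (z m))) = N"
    "\<And>m w. w \<in> ball z0 (r m) \<Longrightarrow> rescaled_spherical_derivative k a (F (s m)) w (t m * (r m - dist z0 w)) \<le> N"
proof -
  obtain R where R: "0 < R" "cball z0 R \<subseteq> D" using D open_contains_cball by blast
  define r where "r m = R / real (Suc m)" for m
  define t0 where "t0 m = 1 / real (Suc m)" for m
  have r: "0 < r m" "r m \<le> R" for m using R by (auto simp: r_def field_simps)
  have sub: "cball z0 (r m) \<subseteq> D" for m using R(2) r(2)[of m] by (meson subset_cball subset_trans)
  have t0: "0 < t0 m" for m by (simp add: t0_def)
  define P where "P m n \<longleftrightarrow> (\<exists>z t. z \<in> ball z0 (r m) \<and> 0 < t \<and> t \<le> t0 m \<and>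
      rescaled_spherical_derivative k a (F n) z (t * (r m - dist z0 z)) = N \<and>
      (\<forall>w\<in>ball z0 (r m). rescaled_spherical_derivative k a (F n) w (t * (r m - dist z0 w)) \<le> N))" for m n
  have "\<forall>\<^sub>F n in sequentially. P m n" for m
  proof -
    have "\<forall>\<^sub>F n in sequentially. \<exists>w \<in> ball z0 (r m). N < rescaled_spherical_derivative k a (F n) w (t0 m * (r m - dist z0 w))"
    proof (rule ccontr)
      assume "\<not> (\<forall>\<^sub>F n in sequentially. \<exists>w \<in> ball z0 (r m). N < rescaled_spherical_derivative k a (F n) w (t0 m * (r m - dist z0 w)))"
      then have "\<exists>\<^sub>F n in sequentially. \<forall>w \<in> ball z0 (r m). rescaled_spherical_derivative k a (F n) w (t0 m * (r m - dist z0 w)) \<le> N"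
        by (simp add: not_eventually not_less)
      then have "infinite {n. \<forall>w \<in> ball z0 (r m). rescaled_spherical_derivative k a (F n) w (t0 m * (r m - dist z0 w)) \<le> N}"
        by (simp add: frequently_cofinite flip: cofinite_eq_sequentially)
      then obtain s :: "nat \<Rightarrow> nat" where s: "strict_mono s"
        "\<forall>n. s n \<in> {n. \<forall>w \<in> ball z0 (r m). rescaled_spherical_derivative k a (F n) w (t0 m * (r m - dist z0 w)) \<le> N}"
        using infinite_enumerate by blast
      obtain s' e where s': "strict_mono (s' :: nat \<Rightarrow> nat)" "0 < e" "uniform_limit_or_infinity (ball z0 e) ((\<lambda>n. F (s n)) \<circ> s')"
        using convergent_subseq_if_rescaled_spherical_derivative_bounded
          [OF a D(1) sub[of m] r(1)[of m] t0[of m], where F = "\<lambda>n. F (s n)" and N = N and k = k] F s(2) N by auto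
      have "(\<lambda>n. F (s n)) \<circ> s' = F \<circ> (s \<circ> s')" by auto
      then show False using no[OF strict_mono_o[OF s(1) s'(1)] s'(2)] s'(3) by simp
    qed
    then show ?thesis
    proof eventually_elim
      case (elim n)
      then obtain w where w: "w \<in> ball z0 (r m)" "N < rescaled_spherical_derivative k a (F n) w (t0 m * (r m - dist z0 w))"
        by blast
      obtain \<delta> where \<delta>: "0 < \<delta>" "\<And>w \<rho>. w \<in> cball z0 (r m) \<Longrightarrow> 0 < \<rho> \<Longrightarrow> \<rho> < \<delta> \<Longrightarrow> rescaled_spherical_derivative k a (F n) w \<rho> < N"
        using rescaled_spherical_derivative_small[OF a D(1) F[of n] N zero compact_cball sub[of m]] by blast
      have cont: "continuous_on (cball z0 (r m) \<times> {0<..}) (\<lambda>x. rescaled_spherical_derivative k a (F n) (fst x) (snd x))"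
        by (rule continuous_on_rescaled_spherical_derivative[OF a D(1) F]) (use sub[of m] in auto)
      show ?case unfolding P_def by (rule ex_critical_scale[OF cont \<delta> t0 w]) blast+
    qed
  qed
  then obtain s where s: "strict_mono (s :: nat \<Rightarrow> nat)" "\<And>m. P m (s m)"
    using ex_strict_mono_if_eventually[of P] by blast
  then obtain z t where zt: "\<And>m. z m \<in> ball z0 (r m)" "\<And>m. 0 < t m" "\<And>m. t m \<le> t0 m"
    "\<And>m. rescaled_spherical_derivative k a (F (s m)) (z m) (t m * (r m - dist z0 (z m))) = N"
    "\<And>m w. w \<in> ball z0 (r m) \<Longrightarrow> rescaled_spherical_derivative k a (F (s m)) w (t m * (r m - dist z0 w)) \<le> N"
    unfolding P_def by metis
  have "t0 \<longlonglongrightarrow> 0" unfolding t0_def by (rule lim_1_over_n[THEN LIMSEQ_Suc])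
  then have t: "t \<longlonglongrightarrow> 0"
    by (rule tendsto_sandwich[OF _ _ tendsto_const, rotated 2]) (use zt(2)[THEN less_imp_le] zt(3) in \<open>auto intro!: always_eventually\<close>)
  have "(\<lambda>m. R * t0 m) \<longlonglongrightarrow> R * 0" by (intro tendsto_mult tendsto_const \<open>t0 \<longlonglongrightarrow> 0\<close>)
  then have "r \<longlonglongrightarrow> 0" by (simp add: r_def[abs_def] t0_def)
  then show ?thesis using that[OF s(1) _ t zt(2,1) sub zt(4,5)] by blast
qed

definition rescale :: "(complex \<Rightarrow> complex) \<Rightarrow> complex \<Rightarrow> real \<Rightarrow> real \<Rightarrow> complex \<Rightarrow> complex" where
  "rescale f z \<rho> \<mu> \<zeta> = f (z + of_real \<rho> * \<zeta>) / of_real \<mu>"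

lemma rescale_holomorphic:
  assumes "f holomorphic_on S" "\<And>\<zeta>. \<zeta> \<in> T \<Longrightarrow> z + of_real \<rho> * \<zeta> \<in> S" "\<mu> \<noteq> 0"
  shows "rescale f z \<rho> \<mu> holomorphic_on T"
proof -
  have "(f \<circ> (\<lambda>\<zeta>. z + of_real \<rho> * \<zeta>)) holomorphic_on T"
    by (rule holomorphic_on_compose_gen[OF _ assms(1)]) (use assms(2) in \<open>auto intro!: holomorphic_intros\<close>)
  then show ?thesis unfolding rescale_def[abs_def] o_def using assms(3) by (intro holomorphic_intros) auto
qed

lemma rescale_higher_deriv:
  assumes f: "f holomorphic_on S" and S: "open S" and \<zeta>: "z + of_real \<rho> * \<zeta> \<in> S" and \<mu>: "\<mu> \<noteq> 0"
  shows "(deriv ^^ j) (rescale f z \<rho> \<mu>) \<zeta> = of_real (\<rho> ^ j / \<mu>) * (deriv ^^ j) f (z + of_real \<rho> * \<zeta>)"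
proof -
  define T where "T = (\<lambda>\<zeta>. z + of_real \<rho> * \<zeta>) -` S"
  have T: "open T" unfolding T_def by (intro open_vimage S continuous_intros)
  have sub: "of_real \<rho> * w + z \<in> S" if "w \<in> T" for w using that by (simp add: T_def add.commute)
  have \<zeta>T: "\<zeta> \<in> T" using \<zeta> by (simp add: T_def)
  have "rescale f z \<rho> 1 holomorphic_on T" by (rule rescale_holomorphic[OF f]) (auto simp: T_def)
  then have "(deriv ^^ j) (\<lambda>w. (1 / of_real \<mu>) * rescale f z \<rho> 1 w) \<zeta> = (1 / of_real \<mu>) * (deriv ^^ j) (rescale f z \<rho> 1) \<zeta>"
    by (rule higher_deriv_cmult[OF _ \<zeta>T T])
  moreover have "(\<lambda>w. (1 / of_real \<mu>) * rescale f z \<rho> 1 w) = rescale f z \<rho> \<mu>" by (simp add: rescale_def fun_eq_iff)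
  moreover have "(deriv ^^ j) (rescale f z \<rho> 1) \<zeta> = of_real \<rho> ^ j * (deriv ^^ j) f (of_real \<rho> * \<zeta> + z)"
    using higher_deriv_compose_linear'[OF f T S \<zeta>T sub, of j] by (simp add: rescale_def[abs_def] add.commute)
  ultimately show ?thesis by (simp add: add.commute)
qed

text \<open>The derivatives of the rescalings of \<open>a\<close> at the origin are bounded by the choice of the weight,
  and the remainder of the Taylor expansion of order \<open>k\<close> tends to 0.\<close>

lemma rescaled_target_converges:
  assumes a: "a holomorphic_on D" and D: "open D" "z0 \<in> D"
    and z: "z \<longlonglongrightarrow> z0" and \<rho>: "\<rho> \<longlonglongrightarrow> 0" "\<And>m. 0 < \<rho> m"
  obtains r A \<kappa> where "strict_mono (r :: nat \<Rightarrow> nat)" "0 \<le> \<kappa>"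
    "(\<lambda>m. \<rho> (r m) ^ k / weight k a (z (r m)) (\<rho> (r m))) \<longlonglongrightarrow> \<kappa>"
    "plane_limit (\<lambda>m. rescale a (z (r m)) (\<rho> (r m)) (weight k a (z (r m)) (\<rho> (r m)))) (poly A)"
    "\<kappa> + (\<Sum>j<k. norm ((deriv ^^ j) (poly A) 0)) = 1"
    "\<And>\<zeta>. (deriv ^^ k) (poly A) \<zeta> = of_real \<kappa> * (deriv ^^ k) a z0"
proof -
  define W where "W m = weight k a (z m) (\<rho> m)" for m
  have W: "0 < W m" for m using \<rho>(2) by (simp add: W_def weight_pos)
  define c where "c j m = of_real (\<rho> m ^ j / W m) * (if j = k then 1 else (deriv ^^ j) a (z m))" for j m
  have norm_c: "norm (c j m) = (if j = k then \<rho> m ^ k else norm ((deriv ^^ j) a (z m)) * \<rho> m ^ j) / W m" for j m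
    using W[of m] \<rho>(2)[of m] by (auto simp: c_def norm_mult norm_divide norm_power)
  have c1: "norm (c j m) \<le> 1" if "j < Suc k" for j m
    using that W[of m] \<rho>(2)[of m] weight_ge_power[of "\<rho> m" k a "z m"] weight_ge_term[of j k "\<rho> m" a "z m"]
    by (auto simp: norm_c W_def divide_le_eq_1)
  have "\<exists>r. strict_mono r \<and> (\<forall>j<Suc k. j < Suc k \<longrightarrow> convergent (\<lambda>m. c j (r m)))"
  proof (rule ex_common_subseq)
    fix j and s :: "nat \<Rightarrow> nat" assume "strict_mono s"
    show "\<exists>r. strict_mono r \<and> (j < Suc k \<longrightarrow> convergent (\<lambda>m. c j ((s \<circ> r) m)))"
    proof (cases "j < Suc k")
      case True
      have "compact (cball (0::complex) 1)" by simp
      moreover have "\<forall>m. c j (s m) \<in> cball 0 1" using c1[OF True] by simp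
      ultimately obtain l r where "strict_mono (r :: nat \<Rightarrow> nat)" "((\<lambda>m. c j (s m)) \<circ> r) \<longlonglongrightarrow> l"
        by (metis compact_def)
      then show ?thesis by (auto simp: convergent_def o_def)
    next
      case False
      then show ?thesis by (intro exI[of _ id]) (simp add: strict_mono_def)
    qed
  next
    fix j and s r :: "nat \<Rightarrow> nat" assume "strict_mono r" "j < Suc k \<longrightarrow> convergent (\<lambda>m. c j (s m))"
    then show "j < Suc k \<longrightarrow> convergent (\<lambda>m. c j ((s \<circ> r) m))"
      using convergent_subseq_convergent[of "\<lambda>m. c j (s m)" r] by (simp add: o_def)
  qed
  then obtain r where r: "strict_mono r" "\<And>j. j \<le> k \<Longrightarrow> convergent (\<lambda>m. c j (r m))" by auto
  then obtain l where l: "\<And>j. j \<le> k \<Longrightarrow> (\<lambda>m. c j (r m)) \<longlonglongrightarrow> l j" unfolding convergent_def by metis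
  have zr: "(\<lambda>m. z (r m)) \<longlonglongrightarrow> z0" and \<rho>r: "(\<lambda>m. \<rho> (r m)) \<longlonglongrightarrow> 0"
    using LIMSEQ_subseq_LIMSEQ[OF z r(1)] LIMSEQ_subseq_LIMSEQ[OF \<rho>(1) r(1)] by (auto simp: o_def)
  define \<kappa> where "\<kappa> = norm (l k)"
  have \<kappa>lim: "(\<lambda>m. \<rho> (r m) ^ k / W (r m)) \<longlonglongrightarrow> \<kappa>"
    using tendsto_norm[OF l[of k]] by (simp add: norm_c \<kappa>_def)
  have lk: "l k = of_real \<kappa>"
  proof (rule LIMSEQ_unique[OF l[of k]])
    show "(\<lambda>m. c k (r m)) \<longlonglongrightarrow> of_real \<kappa>" using tendsto_of_real[OF \<kappa>lim, where 'a = complex] by (simp add: c_def)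
  qed simp
  have a_lim: "(\<lambda>m. (deriv ^^ j) a (z (r m))) \<longlonglongrightarrow> (deriv ^^ j) a z0" for j
    by (rule continuous_on_tendsto_compose[OF holomorphic_on_imp_continuous_on[OF holomorphic_higher_deriv[OF a D(1)]] zr D(2)])
       (use topological_tendstoD[OF zr D] in auto)
  define b where "b j m = of_real (\<rho> m ^ j / W m) * (deriv ^^ j) a (z m)" for j m
  define l' where "l' j = (if j = k then of_real \<kappa> * (deriv ^^ k) a z0 else l j)" for j
  have b: "(\<lambda>m. b j (r m)) \<longlonglongrightarrow> l' j" if "j \<le> k" for j
  proof (cases "j = k")
    case True
    then show ?thesis
      using tendsto_mult[OF tendsto_of_real[OF \<kappa>lim, where 'a = complex] a_lim[of k]] by (simp add: b_def l'_def)
  next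
    case False
    then show ?thesis using l[OF that] by (simp add: b_def c_def l'_def)
  qed
  define A where "A = (\<Sum>j\<le>k. monom (l' j / fact j) j)"
  define \<alpha> where "\<alpha> m = rescale a (z m) (\<rho> m) (W m)" for m
  define T where "T m \<zeta> = (\<Sum>j\<le>k. b j m / fact j * \<zeta> ^ j)" for m \<zeta>
  have "plane_limit (\<lambda>m \<zeta>. \<Sum>j\<le>k. b j (r m) / fact j * \<zeta> ^ j) (\<lambda>\<zeta>. \<Sum>j\<le>k. l' j / fact j * \<zeta> ^ j)"
    by (intro plane_limit_sum plane_limit_mult plane_limit_const plane_limit_fixed tendsto_divide b tendsto_const holomorphic_intros) auto
  moreover have "poly A = (\<lambda>\<zeta>. \<Sum>j\<le>k. l' j / fact j * \<zeta> ^ j)"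
    by (rule ext) (simp add: A_def poly_sum poly_monom)
  moreover have "(\<lambda>m. T (r m)) = (\<lambda>m \<zeta>. \<Sum>j\<le>k. b j (r m) / fact j * \<zeta> ^ j)"
    by (simp add: T_def[abs_def])
  ultimately have Tlim: "plane_limit (\<lambda>m. T (r m)) (poly A)" by (simp only:)
  obtain R0 where R0: "0 < R0" "cball z0 R0 \<subseteq> D" using D open_contains_cball by blast
  have "continuous_on (cball z0 R0) ((deriv ^^ Suc k) a)"
    by (rule continuous_on_subset[OF holomorphic_on_imp_continuous_on[OF holomorphic_higher_deriv[OF a D(1)]] R0(2)])
  then have "bounded ((deriv ^^ Suc k) a ` cball z0 R0)"
    by (intro compact_imp_bounded compact_continuous_image) auto
  then obtain B where B: "0 < B" "\<And>w. w \<in> cball z0 R0 \<Longrightarrow> norm ((deriv ^^ Suc k) a w) \<le> B"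
    unfolding bounded_pos by auto
  have inside: "\<forall>\<^sub>F m in sequentially. \<forall>\<zeta>\<in>cball 0 R. z (r m) + of_real (\<rho> (r m)) * \<zeta> \<in> cball z0 R0" for R
  proof -
    have "plane_limit (\<lambda>m \<zeta>. (\<lambda>w. w) (z (r m) + of_real (\<rho> (r m)) * \<zeta>)) (\<lambda>\<zeta>. z0)"
      by (rule plane_limit_rescaled_coefficient[OF _ open_UNIV UNIV_I zr \<rho>r]) (intro holomorphic_intros)
    then have "\<forall>\<^sub>F m in sequentially. \<forall>\<zeta>\<in>cball 0 R. dist (z (r m) + of_real (\<rho> (r m)) * \<zeta>) z0 < R0"
      unfolding plane_limit_def using uniform_limitD R0(1) by blast
    then show ?thesis by eventually_elim (auto simp: dist_commute intro: less_imp_le)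
  qed
  have rem: "norm (\<alpha> m \<zeta> - T m \<zeta>) \<le> B * norm \<zeta> ^ Suc k * \<rho> m"
    if w: "z m \<in> cball z0 R0" and v: "z m + of_real (\<rho> m) * \<zeta> \<in> cball z0 R0" for m \<zeta>
  proof -
    define h where "h = of_real (\<rho> m) * \<zeta>"
    define X where "X = a (z m + h) - (\<Sum>i\<le>k. (deriv ^^ i) a (z m) * h ^ i / fact i)"
    have "norm ((deriv ^^ 0) a (z m + h) - (\<Sum>i\<le>k. (deriv ^^ i) a (z m) * ((z m + h) - z m) ^ i / fact i))
        \<le> B * norm ((z m + h) - z m) ^ Suc k / fact k"
    proof (rule complex_Taylor[of "cball z0 R0"])
      show "((deriv ^^ i) a has_field_derivative (deriv ^^ Suc i) a x) (at x within cball z0 R0)"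
        if "x \<in> cball z0 R0" for i x
        by (rule DERIV_subset[OF has_field_derivative_higher_deriv[OF a D(1)]]) (use that R0 in auto)
    qed (use B w v in \<open>auto simp: h_def\<close>)
    then have X1: "norm X \<le> B * norm h ^ Suc k / fact k"
      by (simp only: X_def add_diff_cancel_left' funpow_0)
    have X2: "\<alpha> m \<zeta> - T m \<zeta> = X / of_real (W m)" unfolding X_def
      by (simp add: \<alpha>_def rescale_def T_def b_def h_def diff_divide_distrib sum_divide_distrib power_mult_distrib mult_ac)
    have "norm (\<alpha> m \<zeta> - T m \<zeta>) = norm X / W m"
      using W[of m] unfolding X2 by (simp add: norm_divide)
    also have "\<dots> \<le> (B * norm h ^ Suc k / fact k) / W m"
      by (rule divide_right_mono[OF X1]) (use W[of m] in simp)
    also have "\<dots> = B * norm \<zeta> ^ Suc k * \<rho> m * (\<rho> m ^ k / W m) / fact k"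
      using \<rho>(2)[of m] by (simp add: h_def norm_mult power_mult_distrib mult_ac)
    also have "\<dots> \<le> B * norm \<zeta> ^ Suc k * \<rho> m * 1 / 1"
    proof (rule frac_le)
      have "\<rho> m ^ k / W m \<le> 1"
        using W[of m] weight_ge_power[OF \<rho>(2)[of m], of k a "z m"] by (simp add: W_def)
      then show "B * norm \<zeta> ^ Suc k * \<rho> m * (\<rho> m ^ k / W m) \<le> B * norm \<zeta> ^ Suc k * \<rho> m * 1"
        using B(1) less_imp_le[OF \<rho>(2)[of m]] by (intro mult_left_mono mult_nonneg_nonneg) auto
      show "0 \<le> B * norm \<zeta> ^ Suc k * \<rho> m * 1"
        using B(1) less_imp_le[OF \<rho>(2)[of m]] by (intro mult_nonneg_nonneg) auto
    qed (auto simp: fact_ge_1)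
    finally show ?thesis by simp
  qed
  have E: "plane_limit (\<lambda>m \<zeta>. \<alpha> (r m) \<zeta> - T (r m) \<zeta>) (\<lambda>\<zeta>. 0)"
    unfolding plane_limit_def
  proof (intro allI conjI)
    fix R
    show "\<forall>\<^sub>F m in sequentially. (\<lambda>\<zeta>. \<alpha> (r m) \<zeta> - T (r m) \<zeta>) holomorphic_on ball 0 R"
      using inside[of R]
    proof eventually_elim
      case (elim m)
      have "\<alpha> (r m) holomorphic_on ball 0 R" unfolding \<alpha>_def
        by (rule rescale_holomorphic[OF a]) (use elim R0 W[of "r m"] in auto)
      then show ?case unfolding T_def by (intro holomorphic_intros) auto
    qed
    show "uniform_limit (cball 0 R) (\<lambda>m \<zeta>. \<alpha> (r m) \<zeta> - T (r m) \<zeta>) (\<lambda>\<zeta>. 0) sequentially"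
    proof (rule uniform_limitI)
      fix e :: real assume e: "0 < e"
      define Q where "Q = B * \<bar>R\<bar> ^ Suc k"
      have "(\<lambda>m. Q * \<rho> (r m)) \<longlonglongrightarrow> Q * 0" by (intro tendsto_mult tendsto_const \<rho>r)
      then have "\<forall>\<^sub>F m in sequentially. Q * \<rho> (r m) < e" using e by (intro order_tendstoD(2)) auto
      then show "\<forall>\<^sub>F m in sequentially. \<forall>\<zeta>\<in>cball 0 R. dist (\<alpha> (r m) \<zeta> - T (r m) \<zeta>) 0 < e"
        using inside[of R]
      proof eventually_elim
        case (elim m)
        show ?case
        proof
          fix \<zeta> :: complex assume \<zeta>: "\<zeta> \<in> cball 0 R"
          then have "0 \<le> R" by (auto intro: order_trans[OF norm_ge_zero])
          then have "z (r m) \<in> cball z0 R0" using elim(2)[rule_format, of 0] by simp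
          then have "norm (\<alpha> (r m) \<zeta> - T (r m) \<zeta>) \<le> B * norm \<zeta> ^ Suc k * \<rho> (r m)"
            using rem elim(2) \<zeta> by blast
          also have "\<dots> \<le> Q * \<rho> (r m)" unfolding Q_def
          proof (rule mult_right_mono)
            have "norm \<zeta> ^ Suc k \<le> \<bar>R\<bar> ^ Suc k" using \<zeta> by (intro power_mono) auto
            then show "B * norm \<zeta> ^ Suc k \<le> B * \<bar>R\<bar> ^ Suc k" using B(1) by (intro mult_left_mono) auto
          qed (use \<rho>(2)[of "r m"] in simp)
          finally show "dist (\<alpha> (r m) \<zeta> - T (r m) \<zeta>) 0 < e" using elim(1) by simp
        qed
      qed
    qed
  qed
  have \<alpha>lim: "plane_limit (\<lambda>m. \<alpha> (r m)) (poly A)" using plane_limit_add[OF E Tlim] by simp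
  have deriv_\<alpha>: "(deriv ^^ j) (\<alpha> m) \<zeta> = of_real (\<rho> m ^ j / W m) * (deriv ^^ j) a (z m + of_real (\<rho> m) * \<zeta>)"
    if "z m + of_real (\<rho> m) * \<zeta> \<in> D" for j m \<zeta>
    unfolding \<alpha>_def by (rule rescale_higher_deriv[OF a D(1) that]) (use W[of m] in simp)
  have A0: "norm ((deriv ^^ j) (poly A) 0) = norm (l j)" if j: "j < k" for j
  proof -
    have "(\<lambda>m. (deriv ^^ j) (\<alpha> (r m)) 0) \<longlonglongrightarrow> (deriv ^^ j) (poly A) 0"
      by (rule plane_limit_tendsto[OF plane_limit_higher_deriv[OF \<alpha>lim]])
    moreover have "\<forall>\<^sub>F m in sequentially. (deriv ^^ j) (\<alpha> (r m)) 0 = c j (r m)"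
      using inside[of 0] by eventually_elim (use R0 j in \<open>auto simp: deriv_\<alpha> c_def\<close>)
    ultimately have "(\<lambda>m. c j (r m)) \<longlonglongrightarrow> (deriv ^^ j) (poly A) 0" by (rule Lim_transform_eventually)
    then show ?thesis using LIMSEQ_unique l[of j] j by (metis less_imp_le)
  qed
  have "\<kappa> + (\<Sum>j<k. norm (l j)) = 1"
  proof (rule LIMSEQ_unique)
    show "(\<lambda>m. norm (c k (r m)) + (\<Sum>j<k. norm (c j (r m)))) \<longlonglongrightarrow> \<kappa> + (\<Sum>j<k. norm (l j))"
      unfolding \<kappa>_def by (intro tendsto_intros l) auto
    have "norm (c k m) + (\<Sum>j<k. norm (c j m)) = 1" for m
      using W[of m] by (simp add: norm_c sum_divide_distrib[symmetric] add_divide_distrib[symmetric] W_def weight_def)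
    then show "(\<lambda>m. norm (c k (r m)) + (\<Sum>j<k. norm (c j (r m)))) \<longlonglongrightarrow> 1" by simp
  qed
  then have sum1: "\<kappa> + (\<Sum>j<k. norm ((deriv ^^ j) (poly A) 0)) = 1" using A0 by simp
  have Ak: "(deriv ^^ k) (poly A) \<zeta> = of_real \<kappa> * (deriv ^^ k) a z0" for \<zeta>
  proof (rule LIMSEQ_unique[OF plane_limit_tendsto[OF plane_limit_higher_deriv[OF \<alpha>lim]]])
    have "(\<lambda>m. (deriv ^^ k) a (z (r m) + of_real (\<rho> (r m)) * \<zeta>)) \<longlonglongrightarrow> (deriv ^^ k) a z0"
      by (rule plane_limit_tendsto[OF plane_limit_rescaled_coefficient[OF holomorphic_higher_deriv[OF a D(1)] D zr \<rho>r]])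
    then have "(\<lambda>m. of_real (\<rho> (r m) ^ k / W (r m)) * (deriv ^^ k) a (z (r m) + of_real (\<rho> (r m)) * \<zeta>)) \<longlonglongrightarrow> of_real \<kappa> * (deriv ^^ k) a z0"
      by (intro tendsto_mult tendsto_of_real \<kappa>lim)
    then show "(\<lambda>m. (deriv ^^ k) (\<alpha> (r m)) \<zeta>) \<longlonglongrightarrow> of_real \<kappa> * (deriv ^^ k) a z0"
    proof (rule Lim_transform_eventually)
      show "\<forall>\<^sub>F m in sequentially. of_real (\<rho> (r m) ^ k / W (r m)) * (deriv ^^ k) a (z (r m) + of_real (\<rho> (r m)) * \<zeta>) = (deriv ^^ k) (\<alpha> (r m)) \<zeta>"
        using inside[of "norm \<zeta>"] by eventually_elim (use R0 in \<open>auto simp: deriv_\<alpha> subset_iff\<close>)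
    qed
  qed
  have "0 \<le> \<kappa>" by (simp add: \<kappa>_def)
  then show ?thesis using that[OF r(1) _ \<kappa>lim[unfolded W_def] \<alpha>lim[unfolded \<alpha>_def W_def] sum1 Ak] by blast
qed

lemma plane_limit_subseq:
  assumes "plane_limit P Q" "strict_mono r"
  shows "plane_limit (\<lambda>m. P (r m)) Q"
  using assms uniform_limit_subseq[OF _ filterlim_subseq[OF assms(2)]]
    eventually_compose_filterlim[OF _ filterlim_subseq[OF assms(2)]]
  unfolding plane_limit_def by blast

text \<open>Zalcman's rescaling with the weight. On the scale \<open>\<rho> m\<close> the admissible scale
  \<open>t m * (r m - dist z0 w)\<close> varies by a factor tending to 1, so that the bound for the rescaled
  spherical derivative survives in the limit; there the weight becomes
  \<open>\<kappa> + \<bar>A\<bar> + \<bar>A'\<bar> + \<dots>\<close>.\<close>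

theorem rescaling_limit:
  fixes F :: "nat \<Rightarrow> complex \<Rightarrow> complex"
  assumes a: "a holomorphic_on D" and D: "open D" "z0 \<in> D"
    and F: "\<And>n. F n holomorphic_on D" and N: "0 < N"
    and zero: "\<And>n z. z \<in> D \<Longrightarrow> F n z = 0 \<Longrightarrow> admissible_zero k a N (F n) z"
    and no: "\<And>s e. strict_mono (s :: nat \<Rightarrow> nat) \<Longrightarrow> 0 < e \<Longrightarrow> \<not> uniform_limit_or_infinity (ball z0 e) (F \<circ> s)"
  obtains s z \<rho> A \<kappa> G where "strict_mono (s :: nat \<Rightarrow> nat)" "z \<longlonglongrightarrow> z0" "\<rho> \<longlonglongrightarrow> 0" "\<And>m. 0 < \<rho> m" "0 \<le> \<kappa>"
    "(\<lambda>m. \<rho> m ^ k / weight k a (z m) (\<rho> m)) \<longlonglongrightarrow> \<kappa>"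
    "plane_limit (\<lambda>m. rescale a (z m) (\<rho> m) (weight k a (z m) (\<rho> m))) (poly A)"
    "plane_limit (\<lambda>m. rescale (F (s m)) (z m) (\<rho> m) (weight k a (z m) (\<rho> m))) G"
    "\<kappa> + (\<Sum>j<k. norm ((deriv ^^ j) (poly A) 0)) = 1"
    "norm (deriv G 0) = N * (1 + (norm (G 0))\<^sup>2)"
    "\<And>\<zeta>. norm (deriv G \<zeta>) * (\<kappa> + (\<Sum>j<k. norm ((deriv ^^ j) (poly A) \<zeta>))) \<le>
        N * ((\<kappa> + (\<Sum>j<k. norm ((deriv ^^ j) (poly A) \<zeta>)))\<^sup>2 + (norm (G \<zeta>))\<^sup>2)"
proof -
  obtain s0 z1 t1 r1 where
    P1: "\<And>m. rescaled_spherical_derivative k a (F (s0 m)) (z1 m) (t1 m * (r1 m - dist z0 (z1 m))) = N"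
    and P0: "strict_mono (s0 :: nat \<Rightarrow> nat)" "r1 \<longlonglongrightarrow> (0::real)" "t1 \<longlonglongrightarrow> 0"
    "\<And>m. 0 < t1 m" "\<And>m. z1 m \<in> ball z0 (r1 m)" "\<And>m. cball z0 (r1 m) \<subseteq> D"
    "\<And>m w. w \<in> ball z0 (r1 m) \<Longrightarrow> rescaled_spherical_derivative k a (F (s0 m)) w (t1 m * (r1 m - dist z0 w)) \<le> N"
    by (rule ex_rescaling_points[OF a D F N zero no]) (assumption | rule that)+
  define \<rho>1 where "\<rho>1 m = t1 m * (r1 m - dist z0 (z1 m))" for m
  have \<rho>1_pos: "0 < \<rho>1 m" for m using P0(4,5)[of m] by (simp add: \<rho>1_def)
  have z1: "z1 \<longlonglongrightarrow> z0"
  proof (rule tendsto_dist_iff[THEN iffD2], rule tendsto_sandwich[OF _ _ tendsto_const P0(2)])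
    show "\<forall>\<^sub>F m in sequentially. dist (z1 m) z0 \<le> r1 m"
      using P0(5) by (intro always_eventually) (auto simp: dist_commute intro: less_imp_le)
  qed auto
  have \<rho>1: "\<rho>1 \<longlonglongrightarrow> 0"
  proof -
    have "(\<lambda>m. dist z0 (z1 m)) \<longlonglongrightarrow> dist z0 z0" by (intro tendsto_intros z1)
    then have "(\<lambda>m. t1 m * (r1 m - dist z0 (z1 m))) \<longlonglongrightarrow> 0 * (0 - 0)"
      by (intro tendsto_mult tendsto_diff P0(2,3)) simp
    then show ?thesis by (simp add: \<rho>1_def[abs_def])
  qed
  obtain q A \<kappa> where q: "strict_mono (q :: nat \<Rightarrow> nat)" "0 \<le> \<kappa>"
    "(\<lambda>m. \<rho>1 (q m) ^ k / weight k a (z1 (q m)) (\<rho>1 (q m))) \<longlonglongrightarrow> \<kappa>"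
    "plane_limit (\<lambda>m. rescale a (z1 (q m)) (\<rho>1 (q m)) (weight k a (z1 (q m)) (\<rho>1 (q m)))) (poly A)"
    "\<kappa> + (\<Sum>j<k. norm ((deriv ^^ j) (poly A) 0)) = 1"
    "\<And>\<zeta>. (deriv ^^ k) (poly A) \<zeta> = of_real \<kappa> * (deriv ^^ k) a z0"
    by (rule rescaled_target_converges[OF a D z1 \<rho>1 \<rho>1_pos, where k = k]) (assumption | rule that)+
  define z \<rho> t r f where "z m = z1 (q m)" and "\<rho> m = \<rho>1 (q m)" and "t m = t1 (q m)" and "r m = r1 (q m)"
    and "f m = F (s0 (q m))" for m
  define \<mu> where "\<mu> m = weight k a (z m) (\<rho> m)" for m
  have \<rho>_def': "\<rho> m = t m * (r m - dist z0 (z m))" for m by (simp add: \<rho>_def \<rho>1_def t_def r_def z_def)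
  have \<rho>_pos: "0 < \<rho> m" and t_pos: "0 < t m" and zr: "z m \<in> ball z0 (r m)" and rD: "cball z0 (r m) \<subseteq> D" for m
    using \<rho>1_pos P0 by (auto simp: \<rho>_def t_def z_def r_def)
  have \<mu>: "0 < \<mu> m" for m using \<rho>_pos by (simp add: \<mu>_def weight_pos)
  have z: "z \<longlonglongrightarrow> z0" and \<rho>: "\<rho> \<longlonglongrightarrow> 0" and t: "t \<longlonglongrightarrow> 0"
    using LIMSEQ_subseq_LIMSEQ[OF z1 q(1)] LIMSEQ_subseq_LIMSEQ[OF \<rho>1 q(1)] LIMSEQ_subseq_LIMSEQ[OF P0(3) q(1)]
    by (simp_all add: o_def z_def[abs_def] \<rho>_def[abs_def] t_def[abs_def])
  have fD: "f m holomorphic_on D" for m by (simp add: f_def F)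
  have f_eq: "rescaled_spherical_derivative k a (f m) (z m) (\<rho> m) = N" for m
    using P1[of "q m"] by (simp add: f_def z_def \<rho>_def \<rho>1_def)
  have f_le: "rescaled_spherical_derivative k a (f m) w (t m * (r m - dist z0 w)) \<le> N" if "w \<in> ball z0 (r m)" for m w
    using P0(7)[of w "q m"] that by (simp add: f_def t_def r_def)
  define \<alpha> where "\<alpha> m = rescale a (z m) (\<rho> m) (\<mu> m)" for m
  define g where "g m = rescale (f m) (z m) (\<rho> m) (\<mu> m)" for m
  have \<kappa>: "(\<lambda>m. \<rho> m ^ k / \<mu> m) \<longlonglongrightarrow> \<kappa>" using q(3) by (simp add: \<rho>_def \<mu>_def z_def)
  have \<alpha>: "plane_limit \<alpha> (poly A)" using q(4) by (simp add: \<alpha>_def[abs_def] \<rho>_def \<mu>_def z_def)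
  define \<omega> where "\<omega> \<zeta> = \<kappa> + (\<Sum>j<k. norm ((deriv ^^ j) (poly A) \<zeta>))" for \<zeta>
  have polyA: "poly A holomorphic_on S" for S by (intro holomorphic_intros)
  have \<omega>_pos: "0 < \<omega> \<zeta>" for \<zeta>
  proof (rule ccontr)
    assume "\<not> 0 < \<omega> \<zeta>"
    then have "\<kappa> = 0" and sum0: "(\<Sum>j<k. norm ((deriv ^^ j) (poly A) \<zeta>)) = 0"
      using q(2) sum_nonneg[of "{..<k}" "\<lambda>j. norm ((deriv ^^ j) (poly A) \<zeta>)"] by (auto simp: \<omega>_def)
    have low: "(deriv ^^ j) (poly A) \<zeta> = 0" if "j < k" for j
      using sum0 that by (simp add: sum_nonneg_eq_0_iff)
    have "(deriv ^^ k) (poly A) = (\<lambda>_. 0)" using q(6) \<open>\<kappa> = 0\<close> by auto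
    then have "(deriv ^^ (i + k)) (poly A) = (\<lambda>_. 0)" for i by (induction i) auto
    then have "(deriv ^^ j) (poly A) \<zeta> = 0" for j
      using low[of j] by (metis le_add_diff_inverse2 not_less)
    then have "poly A w = 0" for w
      using holomorphic_fun_eq_0_on_connected[OF polyA[of UNIV], of \<zeta> w] by auto
    then have "poly A = (\<lambda>_. 0)" by auto
    then have "(deriv ^^ j) (poly A) 0 = 0" for j by simp
    then show False using q(5) \<open>\<kappa> = 0\<close> by simp
  qed
  \<comment> \<open>\<open>\<sigma>\<close> is the ratio of the scale at \<open>z m + \<rho> m \<zeta>\<close> to the scale at \<open>z m\<close>, and \<open>v\<close> the ratio of the weights\<close>
  define \<sigma> where "\<sigma> m \<zeta> = t m * (r m - dist z0 (z m + of_real (\<rho> m) * \<zeta>)) / \<rho> m" for m \<zeta>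
  define v where "v m \<zeta> = \<sigma> m \<zeta> ^ k * (\<rho> m ^ k / \<mu> m) + (\<Sum>j<k. \<sigma> m \<zeta> ^ j * norm ((deriv ^^ j) (\<alpha> m) \<zeta>))" for m \<zeta>
  have \<sigma>1: "\<bar>\<sigma> m \<zeta> - 1\<bar> \<le> t m * norm \<zeta>" for m \<zeta>
  proof -
    have "\<sigma> m \<zeta> - 1 = t m * (dist z0 (z m) - dist z0 (z m + of_real (\<rho> m) * \<zeta>)) / \<rho> m"
      using \<rho>_pos[of m] \<rho>_def'[of m] by (simp add: \<sigma>_def field_simps)
    then have "\<bar>\<sigma> m \<zeta> - 1\<bar> = t m * \<bar>dist z0 (z m) - dist z0 (z m + of_real (\<rho> m) * \<zeta>)\<bar> / \<rho> m"
      using \<rho>_pos[of m] t_pos[of m] by (simp add: abs_mult)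
    also have "\<bar>dist z0 (z m) - dist z0 (z m + of_real (\<rho> m) * \<zeta>)\<bar> \<le> norm (of_real (\<rho> m) * \<zeta>)"
      using abs_dist_diff_le[of "z m" z0 "z m + of_real (\<rho> m) * \<zeta>"] by (simp add: dist_norm norm_minus_commute)
    also have "norm (of_real (\<rho> m) * \<zeta>) = \<rho> m * norm \<zeta>" using \<rho>_pos[of m] by (simp add: norm_mult)
    finally show ?thesis using t_pos[of m] \<rho>_pos[of m] by (simp add: mult_left_mono divide_right_mono)
  qed
  have in_ball: "z m + of_real (\<rho> m) * \<zeta> \<in> ball z0 (r m)" if "t m * norm \<zeta> < 1" for m \<zeta>
  proof -
    have "0 < \<sigma> m \<zeta>" using \<sigma>1[of m \<zeta>] that by linarith
    then have "0 < t m * (r m - dist z0 (z m + of_real (\<rho> m) * \<zeta>))"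
      using \<rho>_pos[of m] by (simp add: \<sigma>_def zero_less_divide_iff)
    then show ?thesis using t_pos[of m] by (simp add: zero_less_mult_iff)
  qed
  have in_D: "z m + of_real (\<rho> m) * \<zeta> \<in> D" if "t m * norm \<zeta> < 1" for m \<zeta>
    using in_ball[OF that] rD[of m] by auto
  have g_bound: "\<sigma> m \<zeta> * norm (deriv (g m) \<zeta>) * v m \<zeta> \<le> N * ((v m \<zeta>)\<^sup>2 + (norm (g m \<zeta>))\<^sup>2)"
    if \<zeta>: "t m * norm \<zeta> < 1" for m \<zeta>
  proof -
    define w where "w = z m + of_real (\<rho> m) * \<zeta>"
    define \<tau> where "\<tau> = t m * (r m - dist z0 w)"
    define W where "W = weight k a w \<tau>"
    have wb: "w \<in> ball z0 (r m)" and wD: "w \<in> D" using in_ball[OF \<zeta>] in_D[OF \<zeta>] by (auto simp: w_def)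
    have \<tau>: "\<tau> = \<sigma> m \<zeta> * \<rho> m" using \<rho>_pos[of m] by (simp add: \<tau>_def \<sigma>_def w_def)
    have \<tau>_pos: "0 < \<tau>" using wb t_pos[of m] by (simp add: \<tau>_def)
    have W: "0 < W" using \<tau>_pos by (simp add: W_def weight_pos)
    have \<mu>0: "\<mu> m \<noteq> 0" using \<mu>[of m] by simp
    have d\<alpha>: "(deriv ^^ j) (\<alpha> m) \<zeta> = of_real (\<rho> m ^ j / \<mu> m) * (deriv ^^ j) a w" for j
      unfolding \<alpha>_def w_def by (rule rescale_higher_deriv[OF a D(1) in_D[OF \<zeta>] \<mu>0])
    have "(deriv ^^ 1) (g m) \<zeta> = of_real (\<rho> m ^ 1 / \<mu> m) * (deriv ^^ 1) (f m) w"
      unfolding g_def w_def by (rule rescale_higher_deriv[OF fD D(1) in_D[OF \<zeta>] \<mu>0])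
    then have dg: "norm (deriv (g m) \<zeta>) = \<rho> m / \<mu> m * norm (deriv (f m) w)"
      using \<mu>[of m] \<rho>_pos[of m] by (simp add: norm_mult norm_divide)
    have gz: "norm (g m \<zeta>) = norm (f m w) / \<mu> m" using \<mu>[of m] by (simp add: g_def rescale_def w_def norm_divide)
    have "norm ((deriv ^^ j) (\<alpha> m) \<zeta>) * \<mu> m = \<rho> m ^ j * norm ((deriv ^^ j) a w)" for j
      using \<mu>[of m] \<rho>_pos[of m] by (simp add: d\<alpha> norm_mult norm_divide norm_power)
    then have "v m \<zeta> * \<mu> m = W"
      using \<mu>0 unfolding v_def W_def weight_def \<tau>
      by (simp add: distrib_right sum_distrib_right mult.assoc power_mult_distrib) (simp add: mult_ac)
    then have v: "v m \<zeta> = W / \<mu> m" using \<mu>0 by (simp add: field_simps)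
    have "\<tau> * norm (deriv (f m) w) * W / (W\<^sup>2 + (norm (f m w))\<^sup>2) \<le> N"
      using f_le[OF wb] by (simp add: rescaled_spherical_derivative_def W_def \<tau>_def)
    moreover have "0 < W\<^sup>2 + (norm (f m w))\<^sup>2" using W by (simp add: add_pos_nonneg)
    ultimately have "\<tau> * norm (deriv (f m) w) * W \<le> N * (W\<^sup>2 + (norm (f m w))\<^sup>2)"
      by (simp add: divide_le_eq)
    then have "\<tau> * norm (deriv (f m) w) * W / (\<mu> m)\<^sup>2 \<le> N * (W\<^sup>2 + (norm (f m w))\<^sup>2) / (\<mu> m)\<^sup>2"
      by (rule divide_right_mono) simp
    moreover have "\<sigma> m \<zeta> * norm (deriv (g m) \<zeta>) * v m \<zeta> = \<tau> * norm (deriv (f m) w) * W / (\<mu> m)\<^sup>2"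
      unfolding dg v \<tau> by (simp add: power2_eq_square)
    moreover have "N * ((v m \<zeta>)\<^sup>2 + (norm (g m \<zeta>))\<^sup>2) = N * (W\<^sup>2 + (norm (f m w))\<^sup>2) / (\<mu> m)\<^sup>2"
      unfolding v gz by (simp add: power_divide add_divide_distrib[symmetric])
    ultimately show ?thesis by simp
  qed
  have g_eq: "norm (deriv (g m) 0) = N * (1 + (norm (g m 0))\<^sup>2)" for m
  proof -
    have \<mu>0: "\<mu> m \<noteq> 0" using \<mu>[of m] by simp
    have zD: "z m + of_real (\<rho> m) * 0 \<in> D" using in_D[of m 0] by simp
    have "(deriv ^^ 1) (g m) 0 = of_real (\<rho> m ^ 1 / \<mu> m) * (deriv ^^ 1) (f m) (z m + of_real (\<rho> m) * 0)"
      unfolding g_def by (rule rescale_higher_deriv[OF fD D(1) zD \<mu>0])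
    then have dg: "norm (deriv (g m) 0) = \<rho> m / \<mu> m * norm (deriv (f m) (z m))"
      using \<mu>[of m] \<rho>_pos[of m] by (simp add: norm_mult norm_divide)
    have gz: "norm (g m 0) = norm (f m (z m)) / \<mu> m" using \<mu>[of m] by (simp add: g_def rescale_def norm_divide)
    have "\<rho> m * norm (deriv (f m) (z m)) * \<mu> m / ((\<mu> m)\<^sup>2 + (norm (f m (z m)))\<^sup>2) = N"
      using f_eq[of m] by (simp add: rescaled_spherical_derivative_def \<mu>_def)
    moreover have "0 < (\<mu> m)\<^sup>2 + (norm (f m (z m)))\<^sup>2" using \<mu>[of m] by (simp add: add_pos_nonneg)
    then have "(\<mu> m)\<^sup>2 + (norm (f m (z m)))\<^sup>2 \<noteq> 0" by linarith
    ultimately have "\<rho> m * norm (deriv (f m) (z m)) * \<mu> m = N * ((\<mu> m)\<^sup>2 + (norm (f m (z m)))\<^sup>2)"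
      by (metis nonzero_divide_eq_eq)
    then show ?thesis unfolding dg gz using \<mu>0 by (simp add: field_simps power2_eq_square)
  qed
  have t_small: "\<forall>\<^sub>F m in sequentially. \<forall>\<zeta> \<in> cball (0 :: complex) R. t m * norm \<zeta> < 1 / 2" for R
  proof -
    have "(\<lambda>m. t m * \<bar>R\<bar>) \<longlonglongrightarrow> 0 * \<bar>R\<bar>" by (intro tendsto_mult tendsto_const t)
    then have "\<forall>\<^sub>F m in sequentially. t m * \<bar>R\<bar> < 1 / 2" by (intro order_tendstoD(2)) auto
    then show ?thesis
    proof eventually_elim
      case (elim m)
      show ?case
      proof
        fix \<zeta> :: complex assume "\<zeta> \<in> cball 0 R"
        then have "norm \<zeta> \<le> \<bar>R\<bar>" by auto
        then have "t m * norm \<zeta> \<le> t m * \<bar>R\<bar>" using t_pos[of m] by (intro mult_left_mono) auto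
        then show "t m * norm \<zeta> < 1 / 2" using elim by linarith
      qed
    qed
  qed
  have g_hol: "\<forall>\<^sub>F m in sequentially. g m holomorphic_on ball 0 R" for R
    using t_small[of R]
  proof eventually_elim
    case (elim m)
    have "z m + of_real (\<rho> m) * \<zeta> \<in> D" if "\<zeta> \<in> ball 0 R" for \<zeta>
    proof (rule in_D)
      have "\<zeta> \<in> cball 0 R" using that by auto
      then show "t m * norm \<zeta> < 1" using elim by force
    qed
    then show ?case unfolding g_def by (intro rescale_holomorphic[OF fD]) (use \<mu>[of m] in auto)
  qed
  have Marty: "\<exists>C. \<forall>\<^sub>F m in sequentially. \<forall>\<zeta> \<in> cball 0 R. norm (deriv (g m) \<zeta>) \<le> C * (1 + (norm (g m \<zeta>))\<^sup>2)" for R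
  proof -
    define \<omega>' where "\<omega>' m \<zeta> = \<rho> m ^ k / \<mu> m + (\<Sum>j<k. norm ((deriv ^^ j) (\<alpha> m) \<zeta>))" for m \<zeta>
    have "uniform_limit (cball 0 R) (\<lambda>m \<zeta>. \<rho> m ^ k / \<mu> m) (\<lambda>\<zeta>. \<kappa>) sequentially"
      using \<kappa> by (auto simp: uniform_limit_iff tendsto_iff)
    moreover have "uniform_limit (cball 0 R) (\<lambda>m. (deriv ^^ j) (\<alpha> m)) ((deriv ^^ j) (poly A)) sequentially" for j
      using plane_limit_higher_deriv[OF \<alpha>] unfolding plane_limit_def by blast
    then have "uniform_limit (cball 0 R) (\<lambda>m \<zeta>. \<Sum>j\<in>J. norm ((deriv ^^ j) (\<alpha> m) \<zeta>)) (\<lambda>\<zeta>. \<Sum>j\<in>J. norm ((deriv ^^ j) (poly A) \<zeta>)) sequentially"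
      for J by (induction J rule: infinite_finite_induct) (auto intro!: uniform_limit_intros)
    ultimately have lim: "uniform_limit (cball 0 R) \<omega>' \<omega> sequentially"
      unfolding \<omega>'_def[abs_def] \<omega>_def[abs_def] by (rule uniform_limit_add)
    have cont: "continuous_on (cball 0 R) \<omega>" unfolding \<omega>_def
      by (intro continuous_intros holomorphic_on_imp_continuous_on[OF holomorphic_on_subset[OF holomorphic_higher_deriv[OF polyA open_UNIV]]]) auto
    show ?thesis
    proof (cases "cball (0::complex) R = {}")
      case True
      then show ?thesis by simp
    next
      case False
      obtain \<zeta>1 :: complex where \<zeta>1: "\<And>\<zeta>. \<zeta> \<in> cball 0 R \<Longrightarrow> \<omega> \<zeta>1 \<le> \<omega> \<zeta>"
        using continuous_attains_inf[OF compact_cball False cont] by blast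
      obtain \<zeta>2 :: complex where \<zeta>2: "\<And>\<zeta>. \<zeta> \<in> cball 0 R \<Longrightarrow> \<omega> \<zeta> \<le> \<omega> \<zeta>2"
        using continuous_attains_sup[OF compact_cball False cont] by blast
      define c M where "c = (1 / 2) ^ k * (\<omega> \<zeta>1 / 2)" and "M = 2 ^ k * (\<omega> \<zeta>2 + \<omega> \<zeta>1)"
      have c: "0 < c" using \<omega>_pos[of \<zeta>1] by (simp add: c_def)
      define C where "C = 2 * N * (M\<^sup>2 + 1) / c"
      have "\<forall>\<^sub>F m in sequentially. \<forall>\<zeta>\<in>cball 0 R. dist (\<omega>' m \<zeta>) (\<omega> \<zeta>) < \<omega> \<zeta>1 / 2"
        by (rule uniform_limitD[OF lim]) (use \<omega>_pos[of \<zeta>1] in simp)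
      then have "\<forall>\<^sub>F m in sequentially. \<forall>\<zeta> \<in> cball 0 R. norm (deriv (g m) \<zeta>) \<le> C * (1 + (norm (g m \<zeta>))\<^sup>2)"
        using t_small[of R]
      proof eventually_elim
        case (elim m)
        show ?case
        proof
          fix \<zeta> :: complex assume \<zeta>: "\<zeta> \<in> cball 0 R"
          have ts: "t m * norm \<zeta> < 1 / 2" using elim(2) \<zeta> by blast
          then have \<sigma>: "1 / 2 \<le> \<sigma> m \<zeta>" "\<sigma> m \<zeta> \<le> 2" using \<sigma>1[of m \<zeta>] by linarith+
          have \<sigma>j: "(1 / 2) ^ k \<le> \<sigma> m \<zeta> ^ j" "\<sigma> m \<zeta> ^ j \<le> 2 ^ k" if "j \<le> k" for j
          proof -
            have "(1 / 2) ^ k \<le> (1 / 2 :: real) ^ j" using that by (intro power_decreasing) auto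
            also have "\<dots> \<le> \<sigma> m \<zeta> ^ j" using \<sigma> by (intro power_mono) auto
            finally show "(1 / 2) ^ k \<le> \<sigma> m \<zeta> ^ j" .
            have "\<sigma> m \<zeta> ^ j \<le> 2 ^ j" using \<sigma> by (intro power_mono) auto
            also have "\<dots> \<le> (2::real) ^ k" using that by (intro power_increasing) auto
            finally show "\<sigma> m \<zeta> ^ j \<le> 2 ^ k" .
          qed
          have \<rho>\<mu>: "0 \<le> \<rho> m ^ k / \<mu> m" using \<rho>_pos[of m] \<mu>[of m] by simp
          have "(1 / 2) ^ k * \<omega>' m \<zeta> \<le> v m \<zeta>" unfolding \<omega>'_def v_def distrib_left sum_distrib_left
            by (intro add_mono sum_mono mult_right_mono \<sigma>j \<rho>\<mu>) auto
          moreover have "v m \<zeta> \<le> 2 ^ k * \<omega>' m \<zeta>" unfolding \<omega>'_def v_def distrib_left sum_distrib_left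
            by (intro add_mono sum_mono mult_right_mono \<sigma>j \<rho>\<mu>) auto
          moreover have *: "\<bar>\<omega>' m \<zeta> - \<omega> \<zeta>\<bar> < \<omega> \<zeta>1 / 2" using elim(1) \<zeta> by (simp add: dist_real_def)
          have "\<omega> \<zeta>1 / 2 \<le> \<omega>' m \<zeta>" "\<omega>' m \<zeta> \<le> \<omega> \<zeta>2 + \<omega> \<zeta>1"
            using * \<zeta>1[OF \<zeta>] \<zeta>2[OF \<zeta>] \<omega>_pos[of \<zeta>1] by linarith+
          then have "(1 / 2) ^ k * (\<omega> \<zeta>1 / 2) \<le> (1 / 2) ^ k * \<omega>' m \<zeta>"
            "2 ^ k * \<omega>' m \<zeta> \<le> 2 ^ k * (\<omega> \<zeta>2 + \<omega> \<zeta>1)"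
            by (simp_all add: mult_left_mono)
          ultimately have vb: "c \<le> v m \<zeta>" "v m \<zeta> \<le> M" unfolding c_def M_def by linarith+
          then have v0: "0 < v m \<zeta>" using c by linarith
          define X where "X = (norm (g m \<zeta>))\<^sup>2"
          have X: "0 \<le> X" by (simp add: X_def)
          have "\<sigma> m \<zeta> * norm (deriv (g m) \<zeta>) * v m \<zeta> \<le> N * ((v m \<zeta>)\<^sup>2 + X)"
            using g_bound[of m \<zeta>] ts by (simp add: X_def)
          moreover have "(1 / 2) * norm (deriv (g m) \<zeta>) * v m \<zeta> \<le> \<sigma> m \<zeta> * norm (deriv (g m) \<zeta>) * v m \<zeta>"
            using \<sigma> v0 by (intro mult_right_mono) auto
          moreover have "N * ((v m \<zeta>)\<^sup>2 + X) \<le> N * (M\<^sup>2 + X)"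
          proof (rule mult_left_mono)
            have "(v m \<zeta>)\<^sup>2 \<le> M\<^sup>2" using vb v0 by (intro power_mono) auto
            then show "(v m \<zeta>)\<^sup>2 + X \<le> M\<^sup>2 + X" by simp
          qed (use N in simp)
          moreover have "N * (M\<^sup>2 + X) \<le> N * ((M\<^sup>2 + 1) * (1 + X))"
          proof (rule mult_left_mono)
            show "M\<^sup>2 + X \<le> (M\<^sup>2 + 1) * (1 + X)" using X by (simp add: algebra_simps)
          qed (use N in simp)
          moreover have "(1 / 2) * norm (deriv (g m) \<zeta>) * c \<le> (1 / 2) * norm (deriv (g m) \<zeta>) * v m \<zeta>"
            using vb by (intro mult_left_mono) auto
          ultimately have "(1 / 2) * norm (deriv (g m) \<zeta>) * c \<le> N * ((M\<^sup>2 + 1) * (1 + X))" by linarith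
          then show "norm (deriv (g m) \<zeta>) \<le> C * (1 + (norm (g m \<zeta>))\<^sup>2)"
            using c by (simp add: C_def X_def field_simps)
        qed
      qed
      then show ?thesis by blast
    qed
  qed
  have loc: "\<exists>s e. strict_mono (s :: nat \<Rightarrow> nat) \<and> 0 < e \<and> uniform_limit_or_infinity (ball \<zeta> e) (g \<circ> p \<circ> s)"
    if p: "strict_mono p" for \<zeta> and p :: "nat \<Rightarrow> nat"
  proof -
    define R where "R = norm \<zeta> + 1"
    have sub: "ball \<zeta> 1 \<subseteq> ball 0 R"
    proof
      fix x assume "x \<in> ball \<zeta> 1"
      then show "x \<in> ball 0 R"
        using norm_triangle_ineq2[of x \<zeta>] by (simp add: R_def dist_norm norm_minus_commute)
    qed
    obtain C where "\<forall>\<^sub>F m in sequentially. \<forall>\<zeta> \<in> cball 0 R. norm (deriv (g m) \<zeta>) \<le> C * (1 + (norm (g m \<zeta>))\<^sup>2)"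
      using Marty by blast
    then have "\<forall>\<^sub>F m in sequentially. g m holomorphic_on ball \<zeta> 1 \<and>
        (\<forall>w\<in>ball \<zeta> 1. norm (deriv (g m) w) \<le> C * (1 + (norm (g m w))\<^sup>2))"
      using g_hol[of R]
    proof eventually_elim
      case (elim m)
      have "w \<in> cball 0 R" if "w \<in> ball \<zeta> 1" for w using sub that by fastforce
      then show ?case using elim sub holomorphic_on_subset by blast
    qed
    then have "\<forall>\<^sub>F m in sequentially. (g \<circ> p) m holomorphic_on ball \<zeta> 1 \<and>
        (\<forall>w\<in>ball \<zeta> 1. norm (deriv ((g \<circ> p) m) w) \<le> C * (1 + (norm ((g \<circ> p) m w))\<^sup>2))"
      unfolding o_def by (rule eventually_compose_filterlim[OF _ filterlim_subseq[OF p]])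
    then show ?thesis by (rule Marty_criterion[OF zero_less_one])
  qed
  obtain p where p: "strict_mono (p :: nat \<Rightarrow> nat)" "converges_on_compacts UNIV (g \<circ> p)"
    using ex_subseq_converges_on_compacts[OF connected_UNIV loc] by blast
  have "\<not> (\<forall>K. compact K \<longrightarrow> K \<subseteq> UNIV \<longrightarrow> (\<forall>B. \<forall>\<^sub>F n in sequentially. \<forall>z\<in>K. B < norm ((g \<circ> p) n z)))"
  proof
    assume inf: "\<forall>K. compact K \<longrightarrow> K \<subseteq> UNIV \<longrightarrow> (\<forall>B. \<forall>\<^sub>F n in sequentially. \<forall>z\<in>K. B < norm ((g \<circ> p) n z))"
    \<comment> \<open>\<open>1 / g\<close> would tend to 0 together with its derivative, but it has the same spherical derivative at 0 as \<open>g\<close>\<close>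
    define B where "B = 2 / N + 1"
    have B: "0 < B" using N by (simp add: B_def add_pos_pos)
    have "\<forall>\<^sub>F n in sequentially. \<forall>z\<in>cball 0 1. B < norm (g (p n) z)" using inf by auto
    moreover have "\<forall>\<^sub>F n in sequentially. g (p n) holomorphic_on ball 0 2"
      using eventually_compose_filterlim[OF g_hol[of 2] filterlim_subseq[OF p(1)]] .
    ultimately have "\<forall>\<^sub>F n in sequentially. False"
    proof eventually_elim
      case (elim n)
      define h where "h w = inverse (g (p n) w)" for w
      have nz: "g (p n) w \<noteq> 0" if "w \<in> cball 0 1" for w using elim(1) that B by fastforce
      have gh: "g (p n) holomorphic_on cball 0 1" by (rule holomorphic_on_subset[OF elim(2)]) auto
      have hh: "h holomorphic_on cball 0 1" unfolding h_def using gh nz by (intro holomorphic_on_inverse) auto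
      have "norm ((deriv ^^ 1) h 0) \<le> fact 1 * (1 / B) / 1 ^ 1"
      proof (rule Cauchy_inequality)
        show "h holomorphic_on ball 0 1" by (rule holomorphic_on_subset[OF hh]) auto
        show "continuous_on (cball 0 1) h" by (rule holomorphic_on_imp_continuous_on[OF hh])
        fix x :: complex assume "norm (0 - x) = 1"
        then have "B < norm (g (p n) x)" using elim(1) by simp
        then show "norm (h x) \<le> 1 / B"
          using B le_imp_inverse_le[of B "norm (g (p n) x)"] by (simp add: h_def norm_inverse inverse_eq_divide norm_divide)
      qed simp
      moreover have "deriv h 0 = - deriv (g (p n)) 0 / (g (p n) 0)\<^sup>2"
      proof -
        have "(g (p n) has_field_derivative deriv (g (p n)) 0) (at 0)"
          by (rule holomorphic_derivI[OF elim(2)]) auto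
        then have "(h has_field_derivative - deriv (g (p n)) 0 / (g (p n) 0)\<^sup>2) (at 0)"
          unfolding h_def using nz[of 0]
          by (auto intro!: derivative_eq_intros simp: power2_eq_square field_simps)
        then show ?thesis by (rule DERIV_imp_deriv)
      qed
      ultimately have "norm (deriv (g (p n)) 0) / (norm (g (p n) 0))\<^sup>2 \<le> 1 / B"
        by (simp add: norm_divide norm_power)
      moreover have "N \<le> norm (deriv (g (p n)) 0) / (norm (g (p n) 0))\<^sup>2"
        using nz[of 0] N by (simp add: g_eq field_simps)
      moreover have "1 / B < N"
      proof -
        have "N * B = 2 + N" using N by (simp add: B_def field_simps)
        then have "1 < N * B" using N by linarith
        then show ?thesis using B by (simp add: divide_less_eq)
      qed
      ultimately show ?case by linarith
    qed
    then show False by simp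
  qed
  then obtain G where G: "\<And>K. compact K \<Longrightarrow> uniform_limit K (g \<circ> p) G sequentially"
    using p(2) unfolding converges_on_compacts_def by auto
  have limG: "plane_limit (\<lambda>m. g (p m)) G"
    unfolding plane_limit_def
  proof (intro allI conjI)
    show "\<forall>\<^sub>F n in sequentially. g (p n) holomorphic_on ball 0 R" for R
      by (rule eventually_compose_filterlim[OF g_hol filterlim_subseq[OF p(1)]])
    show "uniform_limit (cball 0 R) (\<lambda>m. g (p m)) G sequentially" for R
      using G[OF compact_cball, of 0 R] by (simp add: o_def)
  qed
  have dG: "(\<lambda>m. deriv (g (p m)) \<zeta>) \<longlonglongrightarrow> deriv G \<zeta>" for \<zeta>
    by (rule plane_limit_tendsto[OF plane_limit_deriv[OF limG]])
  have G0: "norm (deriv G 0) = N * (1 + (norm (G 0))\<^sup>2)"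
  proof (rule LIMSEQ_unique)
    show "(\<lambda>m. norm (deriv (g (p m)) 0)) \<longlonglongrightarrow> norm (deriv G 0)" by (intro tendsto_norm dG)
    have "(\<lambda>m. N * (1 + (norm (g (p m) 0))\<^sup>2)) \<longlonglongrightarrow> N * (1 + (norm (G 0))\<^sup>2)"
      by (intro tendsto_intros plane_limit_tendsto[OF limG])
    then show "(\<lambda>m. norm (deriv (g (p m)) 0)) \<longlonglongrightarrow> N * (1 + (norm (G 0))\<^sup>2)" by (simp only: g_eq)
  qed
  have tp: "(\<lambda>m. t (p m)) \<longlonglongrightarrow> 0" using LIMSEQ_subseq_LIMSEQ[OF t p(1)] by (simp add: o_def)
  have \<alpha>p: "plane_limit (\<lambda>m. \<alpha> (p m)) (poly A)" by (rule plane_limit_subseq[OF \<alpha> p(1)])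
  have \<kappa>p: "(\<lambda>m. \<rho> (p m) ^ k / \<mu> (p m)) \<longlonglongrightarrow> \<kappa>" using LIMSEQ_subseq_LIMSEQ[OF \<kappa> p(1)] by (simp add: o_def)
  have Gbound: "norm (deriv G \<zeta>) * \<omega> \<zeta> \<le> N * ((\<omega> \<zeta>)\<^sup>2 + (norm (G \<zeta>))\<^sup>2)" for \<zeta>
  proof -
    have "(\<lambda>m. t (p m) * norm \<zeta>) \<longlonglongrightarrow> 0 * norm \<zeta>" by (intro tendsto_mult tendsto_const tp)
    then have "(\<lambda>m. \<sigma> (p m) \<zeta> - 1) \<longlonglongrightarrow> 0"
      by (intro Lim_null_comparison[of "\<lambda>m. \<sigma> (p m) \<zeta> - 1" "\<lambda>m. t (p m) * norm \<zeta>"]) (auto simp: \<sigma>1 intro!: always_eventually)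
    then have \<sigma>p: "(\<lambda>m. \<sigma> (p m) \<zeta>) \<longlonglongrightarrow> 1" by (simp add: LIM_zero_iff)
    have "(\<lambda>m. \<sigma> (p m) \<zeta> ^ k * (\<rho> (p m) ^ k / \<mu> (p m)) + (\<Sum>j<k. \<sigma> (p m) \<zeta> ^ j * norm ((deriv ^^ j) (\<alpha> (p m)) \<zeta>))) \<longlonglongrightarrow>
        1 ^ k * \<kappa> + (\<Sum>j<k. 1 ^ j * norm ((deriv ^^ j) (poly A) \<zeta>))"
      by (intro tendsto_add tendsto_mult tendsto_sum tendsto_power tendsto_norm \<sigma>p \<kappa>p
          plane_limit_tendsto[OF plane_limit_higher_deriv[OF \<alpha>p]])
    then have vp: "(\<lambda>m. v (p m) \<zeta>) \<longlonglongrightarrow> \<omega> \<zeta>" by (simp add: v_def \<omega>_def)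
    have "1 * norm (deriv G \<zeta>) * \<omega> \<zeta> \<le> N * ((\<omega> \<zeta>)\<^sup>2 + (norm (G \<zeta>))\<^sup>2)"
    proof (rule tendsto_le[OF sequentially_bot])
      show "(\<lambda>m. \<sigma> (p m) \<zeta> * norm (deriv (g (p m)) \<zeta>) * v (p m) \<zeta>) \<longlonglongrightarrow> 1 * norm (deriv G \<zeta>) * \<omega> \<zeta>"
        by (intro tendsto_mult tendsto_norm \<sigma>p vp dG)
      show "(\<lambda>m. N * ((v (p m) \<zeta>)\<^sup>2 + (norm (g (p m) \<zeta>))\<^sup>2)) \<longlonglongrightarrow> N * ((\<omega> \<zeta>)\<^sup>2 + (norm (G \<zeta>))\<^sup>2)"
        by (intro tendsto_intros vp plane_limit_tendsto[OF limG])
      have "\<forall>\<^sub>F m in sequentially. t m * norm \<zeta> < 1"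
        using t_small[of "norm \<zeta>"] by eventually_elim force
      then have "\<forall>\<^sub>F m in sequentially. t (p m) * norm \<zeta> < 1"
        by (rule eventually_compose_filterlim[OF _ filterlim_subseq[OF p(1)]])
      then show "\<forall>\<^sub>F m in sequentially. \<sigma> (p m) \<zeta> * norm (deriv (g (p m)) \<zeta>) * v (p m) \<zeta> \<le> N * ((v (p m) \<zeta>)\<^sup>2 + (norm (g (p m) \<zeta>))\<^sup>2)"
        by eventually_elim (rule g_bound)
    qed
    then show ?thesis by simp
  qed
  show ?thesis
  proof (rule that)
    show "strict_mono (s0 \<circ> q \<circ> p)" by (intro strict_mono_o P0(1) q(1) p(1))
    show "(\<lambda>m. z (p m)) \<longlonglongrightarrow> z0" using LIMSEQ_subseq_LIMSEQ[OF z p(1)] by (simp add: o_def)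
    show "(\<lambda>m. \<rho> (p m)) \<longlonglongrightarrow> 0" using LIMSEQ_subseq_LIMSEQ[OF \<rho> p(1)] by (simp add: o_def)
    show "plane_limit (\<lambda>m. rescale (F ((s0 \<circ> q \<circ> p) m)) (z (p m)) (\<rho> (p m)) (weight k a (z (p m)) (\<rho> (p m)))) G"
      using limG by (simp add: g_def f_def \<mu>_def)
    show "plane_limit (\<lambda>m. rescale a (z (p m)) (\<rho> (p m)) (weight k a (z (p m)) (\<rho> (p m)))) (poly A)"
      using \<alpha>p by (simp add: \<alpha>_def \<mu>_def)
    show "(\<lambda>m. \<rho> (p m) ^ k / weight k a (z (p m)) (\<rho> (p m))) \<longlonglongrightarrow> \<kappa>" using \<kappa>p by (simp add: \<mu>_def)
    show "norm (deriv G \<zeta>) * (\<kappa> + (\<Sum>j<k. norm ((deriv ^^ j) (poly A) \<zeta>))) \<le>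
        N * ((\<kappa> + (\<Sum>j<k. norm ((deriv ^^ j) (poly A) \<zeta>)))\<^sup>2 + (norm (G \<zeta>))\<^sup>2)" for \<zeta>
      using Gbound[of \<zeta>] by (simp only: \<omega>_def)
  qed (use \<rho>_pos q(2,5) G0 in auto)
qed

text \<open>Near infinity the weight is comparable to the power \<open>\<zeta> ^ degree A\<close>, so the bound is one for the
  spherical derivative of the quotient of \<open>G\<close> by this power, which is holomorphic outside a disc.\<close>

lemma exponential_growth_if_weighted_bound:
  fixes G :: "complex \<Rightarrow> complex"
  assumes G: "G holomorphic_on UNIV" and k: "0 < k" and N: "0 < N" and \<kappa>: "0 \<le> \<kappa>"
    and sum1: "\<kappa> + (\<Sum>j<k. norm ((deriv ^^ j) (poly A) 0)) = 1"
    and bd: "\<And>\<zeta>. norm (deriv G \<zeta>) * (\<kappa> + (\<Sum>j<k. norm ((deriv ^^ j) (poly A) \<zeta>))) \<le>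
        N * ((\<kappa> + (\<Sum>j<k. norm ((deriv ^^ j) (poly A) \<zeta>)))\<^sup>2 + (norm (G \<zeta>))\<^sup>2)"
  shows "\<exists>B K. 0 \<le> K \<and> (\<forall>\<zeta>. norm (G \<zeta>) \<le> B * exp (K * norm \<zeta>))"
proof -
  define \<omega> where "\<omega> \<zeta> = \<kappa> + (\<Sum>j<k. norm ((deriv ^^ j) (poly A) \<zeta>))" for \<zeta>
  define d where "d = degree A"
  have "\<exists>c>0. \<exists>R\<ge>1. \<forall>\<zeta>. R \<le> norm \<zeta> \<longrightarrow> c * norm \<zeta> ^ d \<le> \<omega> \<zeta>"
  proof (cases "A = 0")
    case True
    then have "poly A = (\<lambda>_. 0)" by auto
    then have "\<omega> \<zeta> = 1" for \<zeta> using sum1 by (simp add: \<omega>_def)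
    then show ?thesis using True by (intro exI[of _ 1] conjI) (auto simp: d_def)
  next
    case False
    have "norm ((deriv ^^ 0) (poly A) \<zeta>) \<le> (\<Sum>j<k. norm ((deriv ^^ j) (poly A) \<zeta>))" for \<zeta>
      using k by (intro member_le_sum) auto
    then have "norm (poly A \<zeta>) \<le> \<omega> \<zeta>" for \<zeta> using \<kappa> by (simp add: \<omega>_def add_increasing)
    then show ?thesis using poly_norm_lower_bound[OF False] unfolding d_def by (meson order_trans)
  qed
  then obtain c R where c: "0 < c" and R: "1 \<le> R" and low: "\<And>\<zeta>. R \<le> norm \<zeta> \<Longrightarrow> c * norm \<zeta> ^ d \<le> \<omega> \<zeta>"
    by blast
  define M where "M = \<kappa> + (\<Sum>j<k. \<Sum>i\<le>degree ((pderiv ^^ j) A). norm (coeff ((pderiv ^^ j) A) i))"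
  have M0: "0 \<le> M" unfolding M_def by (intro add_nonneg_nonneg sum_nonneg \<kappa>) auto
  have deg: "degree ((pderiv ^^ j) A) \<le> d" for j
    by (induction j) (auto simp: d_def degree_pderiv intro: order_trans[OF diff_le_self])
  have up: "\<omega> \<zeta> \<le> M * norm \<zeta> ^ d" if \<zeta>: "R \<le> norm \<zeta>" for \<zeta>
  proof -
    have z1: "1 \<le> norm \<zeta>" using \<zeta> R by simp
    have "\<kappa> * 1 \<le> \<kappa> * norm \<zeta> ^ d" using z1 \<kappa> by (intro mult_left_mono one_le_power) auto
    moreover have "(\<Sum>j<k. norm ((deriv ^^ j) (poly A) \<zeta>)) \<le>
        (\<Sum>j<k. (\<Sum>i\<le>degree ((pderiv ^^ j) A). norm (coeff ((pderiv ^^ j) A) i)) * norm \<zeta> ^ d)"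
      by (intro sum_mono) (simp only: higher_deriv_poly, rule poly_norm_upper_bound[OF z1 deg])
    ultimately show ?thesis by (simp add: \<omega>_def M_def distrib_right sum_distrib_right)
  qed
  define h where "h \<zeta> = G \<zeta> / \<zeta> ^ d" for \<zeta>
  define C where "C = N * M + N / c + d"
  have C: "0 \<le> C" using N M0 c by (simp add: C_def)
  have hol: "h holomorphic_on {z. R < norm z}" unfolding h_def
    by (intro holomorphic_intros holomorphic_on_subset[OF G]) (use R in auto)
  have hb: "norm (deriv h \<zeta>) \<le> C * (1 + (norm (h \<zeta>))\<^sup>2)" if \<zeta>: "R < norm \<zeta>" for \<zeta>
  proof -
    define P where "P = norm \<zeta> ^ d"
    have z1: "1 \<le> norm \<zeta>" "\<zeta> \<noteq> 0" using \<zeta> R by auto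
    have P: "0 < P" using z1 by (simp add: P_def)
    have cP: "0 < c * P" using c P by simp
    have \<omega>b: "c * P \<le> \<omega> \<zeta>" "\<omega> \<zeta> \<le> M * P" using low[of \<zeta>] up[of \<zeta>] \<zeta> by (auto simp: P_def)
    then have \<omega>0: "0 < \<omega> \<zeta>" using cP by linarith
    have Gh: "norm (G \<zeta>) = norm (h \<zeta>) * P" using z1 by (simp add: h_def P_def norm_divide norm_power)
    have DG: "(G has_field_derivative deriv G \<zeta>) (at \<zeta>)" by (rule holomorphic_derivI[OF G]) auto
    have "((\<lambda>z. z ^ d) has_field_derivative of_nat d * \<zeta> ^ (d - 1)) (at \<zeta>)"
      by (auto intro!: derivative_eq_intros)
    then have "(h has_field_derivative (deriv G \<zeta> * \<zeta> ^ d - G \<zeta> * (of_nat d * \<zeta> ^ (d - 1))) / (\<zeta> ^ d * \<zeta> ^ d)) (at \<zeta>)"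
      unfolding h_def using z1 by (intro DERIV_divide DG) auto
    moreover have "G \<zeta> * (of_nat d * \<zeta> ^ (d - 1)) / (\<zeta> ^ d * \<zeta> ^ d) = of_nat d * h \<zeta> / \<zeta>"
      using z1 by (cases d) (auto simp: h_def mult_ac)
    ultimately have "deriv h \<zeta> = deriv G \<zeta> / \<zeta> ^ d - of_nat d * h \<zeta> / \<zeta>"
      using z1 by (simp add: DERIV_imp_deriv diff_divide_distrib)
    then have "norm (deriv h \<zeta>) \<le> norm (deriv G \<zeta> / \<zeta> ^ d) + norm (of_nat d * h \<zeta> / \<zeta>)"
      by (simp add: norm_triangle_ineq4)
    also have "norm (deriv G \<zeta> / \<zeta> ^ d) \<le> N * M + (N / c) * (norm (h \<zeta>))\<^sup>2"
    proof -
      have "norm (deriv G \<zeta>) \<le> N * ((\<omega> \<zeta>)\<^sup>2 + (norm (G \<zeta>))\<^sup>2) / \<omega> \<zeta>"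
        using bd[of \<zeta>] \<omega>0 by (simp add: \<omega>_def[symmetric] le_divide_eq)
      also have "\<dots> = N * \<omega> \<zeta> + N * (norm (G \<zeta>))\<^sup>2 / \<omega> \<zeta>"
        using \<omega>0 by (simp add: power2_eq_square field_simps)
      also have "\<dots> \<le> N * (M * P) + N * (norm (G \<zeta>))\<^sup>2 / (c * P)"
      proof (rule add_mono)
        show "N * \<omega> \<zeta> \<le> N * (M * P)" using \<omega>b N by simp
        show "N * (norm (G \<zeta>))\<^sup>2 / \<omega> \<zeta> \<le> N * (norm (G \<zeta>))\<^sup>2 / (c * P)"
          using \<omega>b cP \<omega>0 N by (intro divide_left_mono) auto
      qed
      also have "\<dots> = (N * M + (N / c) * (norm (h \<zeta>))\<^sup>2) * P"
        using P c by (simp add: Gh power2_eq_square field_simps)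
      finally show ?thesis using P by (simp add: norm_divide norm_power P_def[symmetric] divide_le_eq)
    qed
    also have "norm (of_nat d * h \<zeta> / \<zeta>) \<le> d * (1 + (norm (h \<zeta>))\<^sup>2)"
    proof -
      have "norm (of_nat d * h \<zeta> / \<zeta>) = d * norm (h \<zeta>) / norm \<zeta>" by (simp add: norm_mult norm_divide)
      also have "\<dots> \<le> d * norm (h \<zeta>) / 1" using z1 by (intro divide_left_mono) auto
      also have "\<dots> \<le> d * (1 + (norm (h \<zeta>))\<^sup>2)"
      proof -
        have "2 * norm (h \<zeta>) \<le> 1 + (norm (h \<zeta>))\<^sup>2" using sum_squares_bound[of 1 "norm (h \<zeta>)"] by simp
        then have "norm (h \<zeta>) \<le> 1 + (norm (h \<zeta>))\<^sup>2" using norm_ge_zero[of "h \<zeta>"] by linarith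
        then show ?thesis by (simp add: mult_left_mono)
      qed
      finally show ?thesis .
    qed
    also have "N * M + (N / c) * (norm (h \<zeta>))\<^sup>2 + d * (1 + (norm (h \<zeta>))\<^sup>2) \<le> C * (1 + (norm (h \<zeta>))\<^sup>2)"
      using N M0 c by (simp add: C_def algebra_simps)
    finally show ?thesis by simp
  qed
  obtain K where K: "0 \<le> K" "\<And>\<zeta>. R + 1 \<le> norm \<zeta> \<Longrightarrow> norm (h \<zeta>) \<le> exp (K * norm \<zeta>)"
    using exponential_growth_if_spherical_derivative_bounded[OF hol _ C hb] R by auto
  have "bounded (G ` cball 0 (R + 1))"
    by (intro compact_imp_bounded compact_continuous_image holomorphic_on_imp_continuous_on holomorphic_on_subset[OF G]) auto
  then obtain B where B: "0 < B" "\<And>\<zeta>. \<zeta> \<in> cball 0 (R + 1) \<Longrightarrow> norm (G \<zeta>) \<le> B"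
    unfolding bounded_pos by auto
  have "norm (G \<zeta>) \<le> (B + 1) * exp ((K + d) * norm \<zeta>)" for \<zeta>
  proof (cases "norm \<zeta> \<le> R + 1")
    case True
    then have "norm (G \<zeta>) \<le> B" using B(2)[of \<zeta>] by simp
    also have "\<dots> \<le> (B + 1) * 1" by simp
    also have "\<dots> \<le> (B + 1) * exp ((K + d) * norm \<zeta>)" using B(1) K(1) by (intro mult_left_mono) auto
    finally show ?thesis .
  next
    case False
    then have z0: "\<zeta> \<noteq> 0" using R by auto
    have "norm (G \<zeta>) = norm (h \<zeta>) * norm \<zeta> ^ d" using z0 by (simp add: h_def norm_divide norm_power)
    also have "\<dots> \<le> exp (K * norm \<zeta>) * exp (norm \<zeta>) ^ d"
    proof (rule mult_mono)
      show "norm \<zeta> ^ d \<le> exp (norm \<zeta>) ^ d"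
      proof (rule power_mono)
        show "norm \<zeta> \<le> exp (norm \<zeta>)" using exp_ge_add_one_self[of "norm \<zeta>"] by linarith
      qed simp
    qed (use K(2)[of \<zeta>] False in auto)
    also have "\<dots> = 1 * exp ((K + d) * norm \<zeta>)"
      by (simp add: exp_of_nat_mult[symmetric] exp_add[symmetric] distrib_right)
    also have "\<dots> \<le> (B + 1) * exp ((K + d) * norm \<zeta>)" using B(1) by (intro mult_right_mono) auto
    finally show ?thesis .
  qed
  then show ?thesis using K(1) by (intro exI[of _ "B + 1"] exI[of _ "K + d"]) auto
qed

section \<open>Rescaling the differential operator\<close>

lemma rescaled_points_in_domain:
  assumes D: "open D" "z0 \<in> D" and z: "z \<longlonglongrightarrow> (z0 :: complex)" and \<rho>: "\<rho> \<longlonglongrightarrow> (0::real)"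
  shows "\<forall>\<^sub>F m in sequentially. \<forall>\<zeta>\<in>ball 0 R. z m + of_real (\<rho> m) * \<zeta> \<in> D"
proof -
  obtain e where e: "e > 0" "ball z0 e \<subseteq> D" using D openE by blast
  have "plane_limit (\<lambda>m \<zeta>. (\<lambda>w. w) (z m + of_real (\<rho> m) * \<zeta>)) (\<lambda>\<zeta>. z0)"
    by (rule plane_limit_rescaled_coefficient[OF _ open_UNIV UNIV_I z \<rho>]) (intro holomorphic_intros)
  then have "\<forall>\<^sub>F m in sequentially. \<forall>\<zeta>\<in>cball 0 R. dist (z m + of_real (\<rho> m) * \<zeta>) z0 < e"
    unfolding plane_limit_def using uniform_limitD e(1) by blast
  then show ?thesis
  proof eventually_elim
    case (elim m)
    show ?case
    proof
      fix \<zeta> :: complex assume "\<zeta> \<in> ball 0 R"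
      then have "\<zeta> \<in> cball 0 R" by auto
      then have "dist (z m + of_real (\<rho> m) * \<zeta>) z0 < e" using elim by blast
      then show "z m + of_real (\<rho> m) * \<zeta> \<in> D" using e(2) by (auto simp: dist_commute)
    qed
  qed
qed

lemma linear_diff_op_holomorphic:
  assumes "\<And>j. j \<le> k \<Longrightarrow> c j holomorphic_on D" "f holomorphic_on D" "open D"
  shows "linear_diff_op c k f holomorphic_on D"
  unfolding linear_diff_op_def[abs_def] using assms by (intro holomorphic_intros holomorphic_higher_deriv) auto

text \<open>The derivative of order \<open>j\<close> acquires the factor \<open>\<rho> ^ (k - j)\<close>, so only the leading term survives.\<close>

lemma rescaled_operator_limit:
  assumes c: "\<And>j. j \<le> k \<Longrightarrow> c j holomorphic_on D" and D: "open D" "z0 \<in> D"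
    and F: "\<And>m. F m holomorphic_on D"
    and z: "z \<longlonglongrightarrow> z0" and \<rho>: "\<rho> \<longlonglongrightarrow> 0" and \<mu>: "\<And>m. \<mu> m \<noteq> 0"
    and g: "plane_limit (\<lambda>m. rescale (F m) (z m) (\<rho> m) (\<mu> m)) G"
  shows "plane_limit (\<lambda>m \<zeta>. of_real (\<rho> m ^ k / \<mu> m) * linear_diff_op c k (F m) (z m + of_real (\<rho> m) * \<zeta>))
     (\<lambda>\<zeta>. c k z0 * (deriv ^^ k) G \<zeta>)"
proof (rule plane_limit_cong)
  have "plane_limit (\<lambda>m \<zeta>. \<Sum>j\<le>k. (c j (z m + of_real (\<rho> m) * \<zeta>) * of_real (\<rho> m ^ (k - j))) *
         (deriv ^^ j) (rescale (F m) (z m) (\<rho> m) (\<mu> m)) \<zeta>)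
      (\<lambda>\<zeta>. \<Sum>j\<le>k. (c j z0 * of_real (0 ^ (k - j))) * (deriv ^^ j) G \<zeta>)"
  proof (intro plane_limit_sum plane_limit_mult plane_limit_const tendsto_of_real tendsto_power \<rho>
      plane_limit_higher_deriv g)
    fix j assume "j \<in> {..k}"
    then show "plane_limit (\<lambda>m \<zeta>. c j (z m + of_real (\<rho> m) * \<zeta>)) (\<lambda>\<zeta>. c j z0)"
      by (intro plane_limit_rescaled_coefficient[OF c D z \<rho>]) auto
  qed
  moreover have "(\<Sum>j\<le>k. (c j z0 * of_real (0 ^ (k - j))) * (deriv ^^ j) G \<zeta>) = c k z0 * (deriv ^^ k) G \<zeta>" for \<zeta>
  proof -
    have "(\<Sum>j\<le>k. (c j z0 * of_real (0 ^ (k - j))) * (deriv ^^ j) G \<zeta>) =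
        (\<Sum>j\<le>k. if j = k then c k z0 * (deriv ^^ k) G \<zeta> else 0)"
      by (intro sum.cong) (auto simp: power_0_left)
    then show ?thesis by simp
  qed
  ultimately show "plane_limit (\<lambda>m \<zeta>. \<Sum>j\<le>k. (c j (z m + of_real (\<rho> m) * \<zeta>) * of_real (\<rho> m ^ (k - j))) *
         (deriv ^^ j) (rescale (F m) (z m) (\<rho> m) (\<mu> m)) \<zeta>) (\<lambda>\<zeta>. c k z0 * (deriv ^^ k) G \<zeta>)"
    by simp
next
  fix R
  show "\<forall>\<^sub>F m in sequentially. \<forall>\<zeta>\<in>ball 0 R.
      (\<Sum>j\<le>k. (c j (z m + of_real (\<rho> m) * \<zeta>) * of_real (\<rho> m ^ (k - j))) *
         (deriv ^^ j) (rescale (F m) (z m) (\<rho> m) (\<mu> m)) \<zeta>) =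
      of_real (\<rho> m ^ k / \<mu> m) * linear_diff_op c k (F m) (z m + of_real (\<rho> m) * \<zeta>)"
    using rescaled_points_in_domain[OF D z \<rho>, of R]
  proof eventually_elim
    case (elim m)
    show ?case
    proof
      fix \<zeta> :: complex assume \<zeta>: "\<zeta> \<in> ball 0 R"
      define w where "w = z m + of_real (\<rho> m) * \<zeta>"
      have "(c j w * of_real (\<rho> m ^ (k - j))) * (deriv ^^ j) (rescale (F m) (z m) (\<rho> m) (\<mu> m)) \<zeta> =
          of_real (\<rho> m ^ k / \<mu> m) * (c j w * (deriv ^^ j) (F m) w)" if "j \<le> k" for j
      proof -
        have "\<rho> m ^ k = \<rho> m ^ (k - j) * \<rho> m ^ j" using that by (simp add: power_add[symmetric])
        moreover have "(deriv ^^ j) (rescale (F m) (z m) (\<rho> m) (\<mu> m)) \<zeta> = of_real (\<rho> m ^ j / \<mu> m) * (deriv ^^ j) (F m) w"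
          unfolding w_def by (rule rescale_higher_deriv[OF F D(1) _ \<mu>]) (use elim \<zeta> in blast)
        ultimately show ?thesis by (simp add: mult_ac)
      qed
      then show "(\<Sum>j\<le>k. (c j (z m + of_real (\<rho> m) * \<zeta>) * of_real (\<rho> m ^ (k - j))) *
         (deriv ^^ j) (rescale (F m) (z m) (\<rho> m) (\<mu> m)) \<zeta>) =
        of_real (\<rho> m ^ k / \<mu> m) * linear_diff_op c k (F m) (z m + of_real (\<rho> m) * \<zeta>)"
        unfolding linear_diff_op_def w_def[symmetric] sum_distrib_left by (intro sum.cong) auto
    qed
  qed
qed

lemma higher_deriv_0_if_zeros_mult_ge:
  assumes f: "f holomorphic_on D" and D: "open D" "z \<in> D" and z: "f z = 0"
    and mult: "zeros_mult_ge k f D" and j: "j < k"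
  shows "(deriv ^^ j) f z = 0"
proof (rule ccontr)
  assume nz: "(deriv ^^ j) f z \<noteq> 0"
  define n where "n = (LEAST n. (deriv ^^ n) f z \<noteq> 0)"
  have n: "(deriv ^^ n) f z \<noteq> 0" "\<And>i. i < n \<Longrightarrow> (deriv ^^ i) f z = 0"
    using LeastI[of "\<lambda>n. (deriv ^^ n) f z \<noteq> 0", OF nz] not_less_Least[of _ "\<lambda>n. (deriv ^^ n) f z \<noteq> 0"]
    by (auto simp: n_def)
  have nj: "n \<le> j" unfolding n_def by (rule Least_le[of "\<lambda>n. (deriv ^^ n) f z \<noteq> 0", OF nz])
  have n0: "0 < n" using n(1) z by (cases n) auto
  obtain g r where g: "0 < r" "g holomorphic_on ball z r"
    "\<And>w. w \<in> ball z r \<Longrightarrow> f w - f z = (w - z) ^ n * g w" "\<And>w. w \<in> ball z r \<Longrightarrow> g w \<noteq> 0"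
    by (rule holomorphic_factor_order_of_zero[OF f D n0 n(1)]) (use n(2) in auto)
  have "zorder f z = int n"
    by (rule zorder_eqI[OF open_ball _ g(2)]) (use g z in \<open>auto simp: mult.commute\<close>)
  moreover have "\<not> (\<forall>\<^sub>F w in nhds z. f w = 0)"
    using nz higher_deriv_cong_ev[of f "\<lambda>_. 0" z z j] by auto
  ultimately show False using mult D(2) z nj j unfolding zeros_mult_ge_def by auto
qed

section \<open>Normality near points without exceptional behaviour\<close>

text \<open>Here the functions themselves are rescaled, with the weight of \<open>a\<close>. Hurwitz's theorem turns the
  hypotheses into properties of the limit \<open>G\<close>: its zeros have multiplicity at least \<open>k\<close>, its \<open>k\<close>-th
  derivative vanishes where \<open>G = A\<close>, and that derivative omits the value \<open>\<beta>\<close> or is identically \<open>\<beta>\<close>.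
  For the last property when \<open>a z0 \<noteq> 0\<close>: then \<open>\<beta> = 0\<close>, and a zero of the derivative would make
  \<open>\<bar>a z0\<bar> G\<close> equal to both \<open>a z0\<close> and \<open>b z0\<close>. Hence \<open>G\<close> is a polynomial or \<open>p + B exp (v \<zeta>)\<close>. In the
  first case \<open>G - A\<close> is constant, contrary to the normalisation with \<open>N = 2\<close>, since \<open>\<bar>G' 0\<bar> \<ge> 2\<close> and
  \<open>\<bar>A' 0\<bar> \<le> 1\<close>. In the second case all zeros of \<open>G\<close> are multiple and thus zeros of \<open>p' - v p\<close>; but there
  are infinitely many of them unless \<open>p = 0\<close>, and then \<open>G\<close> agrees with \<open>A\<close> at a point where the
  \<open>k\<close>-th derivative of \<open>G\<close> is not 0.\<close>

lemma normal_near_point_order_ge_2: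
  fixes f :: "nat \<Rightarrow> complex \<Rightarrow> complex"
  assumes D: "open D" "z0 \<in> D" and k: "2 \<le> k"
    and c: "\<And>j. j \<le> k \<Longrightarrow> c j holomorphic_on D" and ck: "\<And>z. z \<in> D \<Longrightarrow> c k z \<noteq> 0"
    and f: "\<And>n. f n holomorphic_on D" and mult: "\<And>n. zeros_mult_ge k (f n) D"
    and a: "a holomorphic_on D" and b: "b holomorphic_on D"
    and b0: "\<And>z. z \<in> D \<Longrightarrow> b z \<noteq> 0" and ab: "\<And>z. z \<in> D \<Longrightarrow> a z \<noteq> b z"
    and share_a: "\<And>n z. z \<in> D \<Longrightarrow> f n z = a z \<longleftrightarrow> linear_diff_op c k (f n) z = a z"
    and share_b: "\<And>n z. z \<in> D \<Longrightarrow> linear_diff_op c k (f n) z = b z \<Longrightarrow> f n z = b z"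
  shows "\<exists>s e. strict_mono (s :: nat \<Rightarrow> nat) \<and> 0 < e \<and> uniform_limit_or_infinity (ball z0 e) (f \<circ> s)"
proof (rule ccontr)
  assume "\<not> ?thesis"
  then have no: "\<And>s e. strict_mono (s :: nat \<Rightarrow> nat) \<Longrightarrow> 0 < e \<Longrightarrow> \<not> uniform_limit_or_infinity (ball z0 e) (f \<circ> s)"
    by blast
  have zero: "admissible_zero k a 2 (f n) z" if z: "z \<in> D" "f n z = 0" for n z
  proof -
    have low: "(deriv ^^ j) (f n) z = 0" if "j < k" for j
      by (rule higher_deriv_0_if_zeros_mult_ge[OF f D(1) z mult that])
    show ?thesis
    proof (cases "\<exists>j<k. (deriv ^^ j) a z \<noteq> 0")
      case True
      then obtain j where j: "j < k" "(deriv ^^ j) a z \<noteq> 0" by blast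
      then have "\<forall>i\<le>j. (deriv ^^ i) (f n) z = 0" using low by simp
      then show ?thesis unfolding admissible_zero_def using j by blast
    next
      case False
      then have "a z = 0" using k by (metis funpow_0 less_le_trans zero_less_numeral)
      then have "linear_diff_op c k (f n) z = 0" using share_a[OF z(1), of n] z(2) by simp
      moreover have "linear_diff_op c k (f n) z = c k z * (deriv ^^ k) (f n) z"
        unfolding linear_diff_op_def lessThan_Suc_atMost[symmetric] using low by simp
      ultimately have "(deriv ^^ k) (f n) z = 0" using ck[OF z(1)] by simp
      then have "\<forall>i\<le>k. (deriv ^^ i) (f n) z = 0" using low by (metis le_neq_implies_less)
      then show ?thesis unfolding admissible_zero_def by blast
    qed
  qed
  obtain s z \<rho> A \<kappa> G where
    Gb: "\<And>\<zeta>. norm (deriv G \<zeta>) * (\<kappa> + (\<Sum>j<k. norm ((deriv ^^ j) (poly A) \<zeta>))) \<le>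
        2 * ((\<kappa> + (\<Sum>j<k. norm ((deriv ^^ j) (poly A) \<zeta>)))\<^sup>2 + (norm (G \<zeta>))\<^sup>2)"
    and g: "plane_limit (\<lambda>m. rescale (f (s m)) (z m) (\<rho> m) (weight k a (z m) (\<rho> m))) G"
    and \<alpha>: "plane_limit (\<lambda>m. rescale a (z m) (\<rho> m) (weight k a (z m) (\<rho> m))) (poly A)"
    and z: "z \<longlonglongrightarrow> z0" and \<rho>: "\<rho> \<longlonglongrightarrow> 0" "\<And>m. 0 < \<rho> m" and \<kappa>0: "0 \<le> \<kappa>"
    and \<kappa>: "(\<lambda>m. \<rho> m ^ k / weight k a (z m) (\<rho> m)) \<longlonglongrightarrow> \<kappa>"
    and sum1: "\<kappa> + (\<Sum>j<k. norm ((deriv ^^ j) (poly A) 0)) = 1"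
    and G0: "norm (deriv G 0) = 2 * (1 + (norm (G 0))\<^sup>2)"
    by (rule rescaling_limit[OF a D f _ zero no]) (simp | assumption | rule that)+
  define \<mu> where "\<mu> m = weight k a (z m) (\<rho> m)" for m
  have \<mu>: "\<mu> m \<noteq> 0" for m using weight_pos[OF \<rho>(2), of k a "z m" m] by (simp add: \<mu>_def)
  define h where "h m = f (s m)" for m
  have h: "h m holomorphic_on D" for m by (simp add: h_def f)
  define pt where "pt m \<zeta> = z m + of_real (\<rho> m) * \<zeta>" for m \<zeta>
  define g' where "g' m = rescale (h m) (z m) (\<rho> m) (\<mu> m)" for m
  have g': "plane_limit g' G" using g by (simp add: g'_def[abs_def] h_def \<mu>_def)
  have \<alpha>': "plane_limit (\<lambda>m. rescale a (z m) (\<rho> m) (\<mu> m)) (poly A)" using \<alpha> by (simp add: \<mu>_def)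
  have \<kappa>': "(\<lambda>m. \<rho> m ^ k / \<mu> m) \<longlonglongrightarrow> \<kappa>" using \<kappa> by (simp add: \<mu>_def)
  have holG: "G holomorphic_on S" for S by (rule plane_limit_holomorphic[OF g])
  have inD: "\<forall>\<^sub>F m in sequentially. \<forall>\<zeta>\<in>ball 0 R. pt m \<zeta> \<in> D" for R
    unfolding pt_def by (rule rescaled_points_in_domain[OF D z \<rho>(1)])
  have \<mu>lim: "\<mu> \<longlonglongrightarrow> norm (a z0)"
  proof -
    have "(\<lambda>m. (deriv ^^ j) a (z m)) \<longlonglongrightarrow> (deriv ^^ j) a z0" for j
      by (rule continuous_on_tendsto_compose[OF holomorphic_on_imp_continuous_on[OF holomorphic_higher_deriv[OF a D(1)]] z D(2)])
         (use topological_tendstoD[OF z D] in auto)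
    then have "\<mu> \<longlonglongrightarrow> 0 ^ k + (\<Sum>j<k. norm ((deriv ^^ j) a z0) * 0 ^ j)"
      unfolding \<mu>_def[abs_def] weight_def by (intro tendsto_intros \<rho>)
    moreover have "(\<Sum>j<k. norm ((deriv ^^ j) a z0) * 0 ^ j) = (\<Sum>j<k. if j = 0 then norm (a z0) else 0)"
      by (intro sum.cong) (auto simp: power_0_left)
    ultimately show ?thesis using k by (simp add: power_0_left)
  qed
  have \<kappa>a: "\<kappa> * norm (a z0) = 0"
  proof (rule LIMSEQ_unique[OF tendsto_mult[OF \<kappa>' \<mu>lim]])
    have "(\<lambda>m. \<rho> m ^ k) \<longlonglongrightarrow> 0 ^ k" by (intro tendsto_power \<rho>)
    then show "(\<lambda>m. \<rho> m ^ k / \<mu> m * \<mu> m) \<longlonglongrightarrow> 0" using \<mu> k by (simp add: power_0_left)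
  qed
  have Lop: "plane_limit (\<lambda>m \<zeta>. of_real (\<rho> m ^ k / \<mu> m) * linear_diff_op c k (h m) (pt m \<zeta>)) (\<lambda>\<zeta>. c k z0 * (deriv ^^ k) G \<zeta>)"
    unfolding pt_def by (rule rescaled_operator_limit[OF c D h z \<rho>(1) \<mu>]) (use g' in \<open>auto simp: g'_def[abs_def]\<close>)
  have coef: "plane_limit (\<lambda>m \<zeta>. u (pt m \<zeta>)) (\<lambda>\<zeta>. u z0)" if "u holomorphic_on D" for u
    unfolding pt_def by (rule plane_limit_rescaled_coefficient[OF that D z \<rho>(1)])
  have scaled: "plane_limit (\<lambda>m \<zeta>. of_real (\<rho> m ^ k / \<mu> m) * u (pt m \<zeta>)) (\<lambda>\<zeta>. of_real \<kappa> * u z0)" if "u holomorphic_on D" for u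
    by (intro plane_limit_mult plane_limit_const tendsto_of_real \<kappa>' coef that)
  have vals: "plane_limit (\<lambda>m \<zeta>. h m (pt m \<zeta>)) (\<lambda>\<zeta>. of_real (norm (a z0)) * G \<zeta>)"
  proof -
    have "plane_limit (\<lambda>m \<zeta>. of_real (\<mu> m) * g' m \<zeta>) (\<lambda>\<zeta>. of_real (norm (a z0)) * G \<zeta>)"
      by (intro plane_limit_mult plane_limit_const tendsto_of_real \<mu>lim g')
    then show ?thesis using \<mu> by (simp add: g'_def rescale_def pt_def)
  qed
  define ck0 where "ck0 = c k z0"
  have ck0: "ck0 \<noteq> 0" using ck D by (simp add: ck0_def)
  have \<rho>\<mu>: "\<rho> m ^ k / \<mu> m \<noteq> 0" for m using \<rho>(2)[of m] \<mu>[of m] by simp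
  have zeros: "(deriv ^^ j) G \<zeta>0 = 0" if j: "j < k" and \<zeta>0: "G \<zeta>0 = 0" for j \<zeta>0
  proof -
    have "\<exists>\<zeta>1. G \<zeta>1 \<noteq> 0"
    proof (rule ccontr)
      assume "\<nexists>\<zeta>1. G \<zeta>1 \<noteq> 0"
      then have "G = (\<lambda>_. 0)" by auto
      then show False using G0 by simp
    qed
    then obtain \<zeta>1 where \<zeta>1: "G \<zeta>1 \<noteq> 0" by blast
    show ?thesis
    proof (rule plane_limit_zeros_transfer[OF g' plane_limit_higher_deriv[OF g'] _ \<zeta>0 \<zeta>1])
      fix R
      show "\<forall>\<^sub>F m in sequentially. \<forall>\<zeta>\<in>ball 0 R. g' m \<zeta> = 0 \<longrightarrow> (deriv ^^ j) (g' m) \<zeta> = 0"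
        using inD[of R]
      proof eventually_elim
        case (elim m)
        show ?case
        proof (intro ballI impI)
          fix \<zeta> :: complex assume \<zeta>: "\<zeta> \<in> ball 0 R" "g' m \<zeta> = 0"
          then have ptD: "z m + of_real (\<rho> m) * \<zeta> \<in> D" using elim by (auto simp: pt_def)
          have "h m (z m + of_real (\<rho> m) * \<zeta>) = 0" using \<zeta>(2) \<mu>[of m] by (simp add: g'_def rescale_def)
          then have "(deriv ^^ j) (h m) (z m + of_real (\<rho> m) * \<zeta>) = 0"
            using higher_deriv_0_if_zeros_mult_ge[OF h D(1) ptD _ _ j] mult by (simp add: h_def)
          then show "(deriv ^^ j) (g' m) \<zeta> = 0"
            unfolding g'_def by (subst rescale_higher_deriv[OF h D(1) ptD \<mu>]) simp
        qed
      qed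
    qed
  qed
  have GA: "(deriv ^^ k) G \<zeta>0 = 0" if \<zeta>0: "G \<zeta>0 = poly A \<zeta>0" and \<zeta>1: "G \<zeta>1 \<noteq> poly A \<zeta>1" for \<zeta>0 \<zeta>1
  proof -
    have "ck0 * (deriv ^^ k) G \<zeta>0 - of_real \<kappa> * a z0 = 0"
      unfolding ck0_def
    proof (rule plane_limit_zeros_transfer[OF plane_limit_diff[OF g' \<alpha>'] plane_limit_diff[OF Lop scaled[OF a]]])
      fix R
      show "\<forall>\<^sub>F m in sequentially. \<forall>\<zeta>\<in>ball 0 R. g' m \<zeta> - rescale a (z m) (\<rho> m) (\<mu> m) \<zeta> = 0 \<longrightarrow>
         of_real (\<rho> m ^ k / \<mu> m) * linear_diff_op c k (h m) (pt m \<zeta>) - of_real (\<rho> m ^ k / \<mu> m) * a (pt m \<zeta>) = 0"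
        using inD[of R]
      proof eventually_elim
        case (elim m)
        then show ?case using share_a[of _ "s m"] \<mu>[of m] by (auto simp: g'_def rescale_def h_def pt_def)
      qed
    qed (use \<zeta>0 \<zeta>1 in auto)
    moreover have "of_real \<kappa> * a z0 = 0" using \<kappa>a by auto
    ultimately show ?thesis using ck0 by simp
  qed
  define \<beta> where "\<beta> = of_real \<kappa> * b z0 / ck0"
  have omit: "(deriv ^^ k) G \<zeta>0 \<noteq> \<beta>" if \<zeta>1: "(deriv ^^ k) G \<zeta>1 \<noteq> \<beta>" for \<zeta>0 \<zeta>1
  proof
    assume \<zeta>0: "(deriv ^^ k) G \<zeta>0 = \<beta>"
    have "of_real (norm (a z0)) * G \<zeta>0 - b z0 = 0"
    proof (rule plane_limit_zeros_transfer[OF plane_limit_diff[OF Lop scaled[OF b]] plane_limit_diff[OF vals coef[OF b]]])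
      fix R
      show "\<forall>\<^sub>F m in sequentially. \<forall>\<zeta>\<in>ball 0 R.
          of_real (\<rho> m ^ k / \<mu> m) * linear_diff_op c k (h m) (pt m \<zeta>) - of_real (\<rho> m ^ k / \<mu> m) * b (pt m \<zeta>) = 0 \<longrightarrow>
          h m (pt m \<zeta>) - b (pt m \<zeta>) = 0"
        using inD[of R]
      proof eventually_elim
        case (elim m)
        then show ?case using share_b[of _ "s m"] \<rho>\<mu>[of m] by (auto simp: h_def)
      qed
    qed (use \<zeta>0 \<zeta>1 ck0 in \<open>auto simp: \<beta>_def ck0_def[symmetric] field_simps\<close>)
    \<comment> \<open>if \<open>a z0 = 0\<close>, this contradicts \<open>b z0 \<noteq> 0\<close>; otherwise the same point is a zero of \<open>L f - a\<close> in the limit\<close>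
    then have bG: "of_real (norm (a z0)) * G \<zeta>0 = b z0" by simp
    have az: "a z0 \<noteq> 0" using bG b0[OF D(2)] by auto
    then have "\<kappa> = 0" using \<kappa>a by simp
    then have \<beta>0: "\<beta> = 0" by (simp add: \<beta>_def)
    have "of_real (norm (a z0)) * G \<zeta>0 - a z0 = 0"
    proof (rule plane_limit_zeros_transfer[OF plane_limit_diff[OF Lop scaled[OF a]] plane_limit_diff[OF vals coef[OF a]]])
      fix R
      show "\<forall>\<^sub>F m in sequentially. \<forall>\<zeta>\<in>ball 0 R.
          of_real (\<rho> m ^ k / \<mu> m) * linear_diff_op c k (h m) (pt m \<zeta>) - of_real (\<rho> m ^ k / \<mu> m) * a (pt m \<zeta>) = 0 \<longrightarrow>
          h m (pt m \<zeta>) - a (pt m \<zeta>) = 0"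
        using inD[of R]
      proof eventually_elim
        case (elim m)
        then show ?case using share_a[of _ "s m"] \<rho>\<mu>[of m] by (auto simp: h_def)
      qed
    qed (use \<zeta>0 \<zeta>1 ck0 \<beta>0 \<open>\<kappa> = 0\<close> in \<open>auto simp: ck0_def[symmetric]\<close>)
    then show False using bG ab[OF D(2)] by simp
  qed
  have dG0: "2 \<le> norm (deriv G 0)" unfolding G0 by simp
  have dA0: "norm (deriv (poly A) 0) \<le> 1"
  proof -
    have "norm ((deriv ^^ 1) (poly A) 0) \<le> (\<Sum>j<k. norm ((deriv ^^ j) (poly A) 0))"
      using k by (intro member_le_sum) auto
    then show ?thesis using sum1 \<kappa>0 by simp
  qed
  \<comment> \<open>a polynomial \<open>G\<close>, having a zero, has nonzero \<open>k\<close>-th derivative, so \<open>G - A\<close> has no zeros or is 0\<close>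
  have const: False if C0: "\<And>\<zeta>. (deriv ^^ k) G \<zeta> = C0" for C0
  proof -
    have dk: "(deriv ^^ k) G = (\<lambda>_. C0)" using C0 by auto
    then have "(deriv ^^ Suc k) G \<zeta> = 0" for \<zeta> by simp
    then obtain p where p: "G = poly p" using entire_polynomial_if_higher_deriv_0[OF holG] by blast
    have "C0 \<noteq> 0"
    proof
      assume "C0 = 0"
      have "(deriv ^^ (i + k)) G = (\<lambda>_. 0)" for i
        using dk \<open>C0 = 0\<close> by (induction i) auto
      then have high: "(deriv ^^ j) G \<zeta> = 0" if "k \<le> j" for j \<zeta> using that by (metis le_add_diff_inverse2)
      have "\<exists>\<zeta>0. G \<zeta>0 = 0"
      proof (rule ccontr)
        assume "\<nexists>\<zeta>0. G \<zeta>0 = 0"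
        then obtain e where "p = [:e:]" using poly_eq_const_if_no_zeros p by blast
        then have "G = (\<lambda>_. e)" using p by auto
        then show False using dG0 by simp
      qed
      then obtain \<zeta>0 where \<zeta>0: "G \<zeta>0 = 0" by blast
      have "(deriv ^^ j) G \<zeta>0 = 0" for j using zeros[OF _ \<zeta>0] high by (cases "j < k") auto
      then have "G w = 0" for w
        using holomorphic_fun_eq_0_on_connected[OF holG[of UNIV], of \<zeta>0 w] by auto
      then have "G = (\<lambda>_. 0)" by auto
      then show False using dG0 by simp
    qed
    have "\<exists>e. \<forall>\<zeta>. G \<zeta> - poly A \<zeta> = e"
    proof (cases "\<exists>\<zeta>0. G \<zeta>0 = poly A \<zeta>0")
      case True
      then show ?thesis using GA C0 \<open>C0 \<noteq> 0\<close> by (intro exI[of _ 0]) force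
    next
      case False
      then have "poly (p - A) \<zeta> \<noteq> 0" for \<zeta> by (simp add: p)
      then obtain e where e: "p - A = [:e:]" using poly_eq_const_if_no_zeros by blast
      have "G \<zeta> - poly A \<zeta> = e" for \<zeta>
      proof -
        have "G \<zeta> - poly A \<zeta> = poly (p - A) \<zeta>" by (simp add: p)
        then show ?thesis by (simp add: e)
      qed
      then show ?thesis by blast
    qed
    then obtain e where "\<And>\<zeta>. G \<zeta> - poly A \<zeta> = e" by blast
    then have "G \<zeta> = poly A \<zeta> + e" for \<zeta> by (metis add.commute diff_add_cancel)
    then have "G = (\<lambda>\<zeta>. poly A \<zeta> + e)" by auto
    moreover have "((\<lambda>\<zeta>. poly A \<zeta> + e) has_field_derivative poly (pderiv A) 0) (at 0)"
      by (auto intro!: derivative_eq_intros)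
    ultimately have "deriv G 0 = poly (pderiv A) 0" by (simp only: DERIV_imp_deriv)
    moreover have "deriv (poly A) 0 = poly (pderiv A) 0" by (intro DERIV_imp_deriv poly_DERIV)
    ultimately have "deriv G 0 = deriv (poly A) 0" by (simp only:)
    then show False using dG0 dA0 by simp
  qed
  obtain B K where BK: "0 \<le> K" "\<And>\<zeta>. norm (G \<zeta>) \<le> B * exp (K * norm \<zeta>)"
    using exponential_growth_if_weighted_bound[OF holG _ _ \<kappa>0 sum1 Gb] k by auto
  have nz: "(deriv ^^ k) G \<zeta> \<noteq> \<beta>" for \<zeta> using omit const[of \<beta>] by blast
  obtain u v where uv: "\<And>\<zeta>. (deriv ^^ k) G \<zeta> = \<beta> + exp (u + v * \<zeta>)"
    using higher_deriv_eq_const_plus_exp[OF holG BK(2,1) nz] by blast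
  have v: "v \<noteq> 0"
  proof
    assume "v = 0"
    then have "(deriv ^^ k) G \<zeta> = \<beta> + exp u" for \<zeta> using uv[of \<zeta>] by simp
    then show False by (rule const)
  qed
  obtain p B' where p: "B' \<noteq> 0" "\<And>\<zeta>. G \<zeta> = poly p \<zeta> + B' * exp (v * \<zeta>)" "\<And>\<zeta>. (deriv ^^ k) (poly p) \<zeta> = \<beta>"
    by (rule entire_eq_poly_plus_exp[OF holG uv v]) (rule that)
  have "p = 0"
  proof (rule ccontr)
    assume p0: "p \<noteq> 0"
    \<comment> \<open>eliminating the exponential from \<open>G = 0\<close> and \<open>G' = 0\<close>\<close>
    define Q where "Q = pderiv p - smult v p"
    have "coeff Q (degree p) = - v * lead_coeff p" by (simp add: Q_def coeff_pderiv coeff_eq_0)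
    then have "Q \<noteq> 0" using v p0 by auto
    have "poly Q \<zeta> = 0" if "poly p \<zeta> + B' * exp (v * \<zeta>) = 0" for \<zeta>
    proof -
      have "(deriv ^^ 1) G \<zeta> = 0" by (rule zeros) (use k p(2) that in auto)
      moreover have "G = (\<lambda>\<zeta>. poly p \<zeta> + B' * exp (v * \<zeta>))" by (rule ext) (rule p(2))
      moreover have "((\<lambda>\<zeta>. poly p \<zeta> + B' * exp (v * \<zeta>)) has_field_derivative poly (pderiv p) \<zeta> + v * (B' * exp (v * \<zeta>))) (at \<zeta>)"
        by (auto intro!: derivative_eq_intros poly_DERIV)
      then have "deriv (\<lambda>\<zeta>. poly p \<zeta> + B' * exp (v * \<zeta>)) \<zeta> = poly (pderiv p) \<zeta> + v * (B' * exp (v * \<zeta>))"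
        by (rule DERIV_imp_deriv)
      ultimately have "poly (pderiv p) \<zeta> + v * (B' * exp (v * \<zeta>)) = 0" by simp
      moreover have "B' * exp (v * \<zeta>) = - poly p \<zeta>" using that by (metis add_eq_0_iff)
      ultimately show ?thesis by (simp add: Q_def)
    qed
    then have "{\<zeta>. poly p \<zeta> + B' * exp (v * \<zeta>) = 0} \<subseteq> {\<zeta>. poly Q \<zeta> = 0}" by blast
    then show False
      using infinite_zeros_poly_plus_exp[OF p0 p(1) v] poly_roots_finite[OF \<open>Q \<noteq> 0\<close>] finite_subset by blast
  qed
  then have G_exp: "G \<zeta> = B' * exp (v * \<zeta>)" for \<zeta> using p(2)[of \<zeta>] by simp
  have "poly p = (\<lambda>_. 0)" using \<open>p = 0\<close> by auto
  then have "\<beta> = 0" using p(3)[of 0] by simp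
  then have "\<kappa> = 0" using b0[OF D(2)] ck0 by (simp add: \<beta>_def)
  have "A \<noteq> 0"
  proof
    assume "A = 0"
    then have "poly A = (\<lambda>_. 0)" by auto
    then show False using sum1 \<open>\<kappa> = 0\<close> by simp
  qed
  then have "infinite {\<zeta>. poly A \<zeta> + (- B') * exp (v * \<zeta>) = 0}"
    using infinite_zeros_poly_plus_exp p(1) v by (metis neg_equal_0_iff_equal)
  then obtain \<zeta>0 where "poly A \<zeta>0 + (- B') * exp (v * \<zeta>0) = 0" using not_finite_existsD by blast
  then have \<zeta>0: "G \<zeta>0 = poly A \<zeta>0" by (simp add: G_exp)
  have "\<exists>\<zeta>1. G \<zeta>1 \<noteq> poly A \<zeta>1"
  proof (rule ccontr)
    assume "\<nexists>\<zeta>1. G \<zeta>1 \<noteq> poly A \<zeta>1"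
    then have "poly A \<zeta> = B' * exp (v * \<zeta>)" for \<zeta> using G_exp[of \<zeta>] by simp
    then have "exp (v * \<zeta>) = poly (smult (1 / B') A) \<zeta>" for \<zeta> using p(1) by simp
    then show False using exp_not_polynomial v by blast
  qed
  then show False using GA[OF \<zeta>0] nz[of \<zeta>0] \<open>\<beta> = 0\<close> by blast
qed

text \<open>For \<open>k = 1\<close> the differences \<open>F n = f n - a\<close> are rescaled, with the classical weight \<open>\<rho>\<close>: where
  \<open>F n\<close> vanishes, its derivative is prescribed and hence bounded. The limit satisfies \<open>G' = \<gamma>\<close> at its
  zeros, and \<open>G'\<close> omits \<open>\<beta> \<noteq> 0\<close> or is identically \<open>\<beta>\<close>. If \<open>G'\<close> is constant, then \<open>G' = \<gamma>\<close>, contrary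
  to the normalisation. Otherwise \<open>G = p + B exp (v \<zeta>)\<close> with \<open>p' = \<beta>\<close> has infinitely many zeros, and
  at each of them \<open>p\<close> takes the value \<open>(\<beta> - \<gamma>) / v\<close>, which is absurd.\<close>

lemma normal_near_point_order_1:
  fixes f :: "nat \<Rightarrow> complex \<Rightarrow> complex"
  assumes D: "open D" "z0 \<in> D"
    and c: "\<And>j. j \<le> 1 \<Longrightarrow> c j holomorphic_on D" and c1: "\<And>z. z \<in> D \<Longrightarrow> c 1 z \<noteq> 0"
    and f: "\<And>n. f n holomorphic_on D"
    and a: "a holomorphic_on D" and b: "b holomorphic_on D"
    and ab: "\<And>z. z \<in> D \<Longrightarrow> a z \<noteq> b z" and bLa: "\<And>z. z \<in> D \<Longrightarrow> b z - linear_diff_op c 1 a z \<noteq> 0"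
    and share_a: "\<And>n z. z \<in> D \<Longrightarrow> f n z = a z \<Longrightarrow> linear_diff_op c 1 (f n) z = a z"
    and share_b: "\<And>n z. z \<in> D \<Longrightarrow> linear_diff_op c 1 (f n) z = b z \<Longrightarrow> f n z = b z"
  shows "\<exists>s e. strict_mono (s :: nat \<Rightarrow> nat) \<and> 0 < e \<and> uniform_limit_or_infinity (ball z0 e) (f \<circ> s)"
proof (rule ccontr)
  assume not_normal: "\<not> ?thesis"
  define La where "La = linear_diff_op c 1 a"
  have La: "La holomorphic_on D" unfolding La_def by (rule linear_diff_op_holomorphic[OF c a D(1)])
  define F where "F n z = f n z - a z" for n z
  have F: "F n holomorphic_on D" for n unfolding F_def by (intro holomorphic_intros f a)
  have dF: "deriv (F n) z = deriv (f n) z - deriv a z" if "z \<in> D" for n z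
    unfolding F_def by (intro deriv_diff holomorphic_on_imp_differentiable_at[OF f D(1) that]
        holomorphic_on_imp_differentiable_at[OF a D(1) that])
  have LF: "linear_diff_op c 1 (F n) z = linear_diff_op c 1 (f n) z - La z" if "z \<in> D" for n z
  proof -
    have "linear_diff_op c 1 h z = c 0 z * h z + c 1 z * deriv h z" for h by (simp add: linear_diff_op_def)
    then show ?thesis by (simp only: La_def dF[OF that]) (simp add: F_def algebra_simps)
  qed
  obtain R where R: "0 < R" "cball z0 R \<subseteq> D" using D open_contains_cball by blast
  define D' where "D' = ball z0 R"
  have D': "open D'" "z0 \<in> D'" "D' \<subseteq> D" using R by (auto simp: D'_def)
  \<comment> \<open>the value of the derivative of \<open>F n\<close> at its zeros\<close>
  define q where "q z = (a z - La z) / c 1 z" for z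
  have "continuous_on (cball z0 R) q"
    unfolding q_def by (intro continuous_intros continuous_on_subset[OF holomorphic_on_imp_continuous_on R(2)] a La c) (use c1 R in auto)
  then have "bounded (q ` cball z0 R)" by (intro compact_imp_bounded compact_continuous_image) auto
  then obtain M where M: "0 < M" "\<And>z. z \<in> cball z0 R \<Longrightarrow> norm (q z) \<le> M" unfolding bounded_pos by auto
  have "bounded (a ` cball z0 R)"
    by (intro compact_imp_bounded compact_continuous_image continuous_on_subset[OF holomorphic_on_imp_continuous_on[OF a] R(2)]) auto
  then obtain Ma where Ma: "0 < Ma" "\<And>z. z \<in> cball z0 R \<Longrightarrow> norm (a z) \<le> Ma" unfolding bounded_pos by auto
  have no: "\<not> uniform_limit_or_infinity (ball z0 e) (F \<circ> s)" if s: "strict_mono (s :: nat \<Rightarrow> nat)" "0 < e" for s e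
  proof
    assume "uniform_limit_or_infinity (ball z0 e) (F \<circ> s)"
    define d where "d = min e R"
    have d: "0 < d" "ball z0 d \<subseteq> ball z0 e" "ball z0 d \<subseteq> cball z0 R" using s R by (auto simp: d_def)
    then have "uniform_limit_or_infinity (ball z0 d) (F \<circ> s)"
      using \<open>uniform_limit_or_infinity (ball z0 e) (F \<circ> s)\<close> uniform_limit_or_infinity_mono by blast
    then consider G where "uniform_limit (ball z0 d) (F \<circ> s) G sequentially"
      | "\<forall>B. \<forall>\<^sub>F n in sequentially. \<forall>z\<in>ball z0 d. B < norm ((F \<circ> s) n z)"
      unfolding uniform_limit_or_infinity_def by blast
    then have "uniform_limit_or_infinity (ball z0 d) (f \<circ> s)"
    proof cases
      case 1
      have "uniform_limit (ball z0 d) (\<lambda>n z. (F \<circ> s) n z + a z) (\<lambda>z. G z + a z) sequentially"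
        by (intro uniform_limit_add 1 uniform_limit_const)
      moreover have "(\<lambda>n z. (F \<circ> s) n z + a z) = f \<circ> s" by (simp add: F_def fun_eq_iff)
      ultimately show ?thesis unfolding uniform_limit_or_infinity_def by auto
    next
      case 2
      have "\<forall>\<^sub>F n in sequentially. \<forall>z\<in>ball z0 d. B < norm ((f \<circ> s) n z)" for B
        using 2[rule_format, of "B + Ma"]
      proof eventually_elim
        case (elim n)
        show ?case
        proof
          fix z assume z: "z \<in> ball z0 d"
          then have "B + Ma < norm (F (s n) z)" "norm (a z) \<le> Ma" using elim Ma(2) d(3) by auto
          then show "B < norm ((f \<circ> s) n z)" using norm_triangle_ineq4[of "f (s n) z" "a z"] by (simp add: F_def)
        qed
      qed
      then show ?thesis unfolding uniform_limit_or_infinity_def by blast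
    qed
    then show False using not_normal s(1) d(1) by blast
  qed
  define N where "N = M + 1"
  have N: "0 < N" using M by (simp add: N_def)
  have zero: "admissible_zero 1 (\<lambda>_. 0) N (F n) z" if z: "z \<in> D'" "F n z = 0" for n z
  proof -
    have zD: "z \<in> D" using z D' by blast
    have "linear_diff_op c 1 (F n) z = a z - La z"
      using LF[OF zD, of n] share_a[OF zD, of n] z(2) by (simp add: F_def)
    moreover have "linear_diff_op c 1 (F n) z = c 1 z * deriv (F n) z" using z(2) by (simp add: linear_diff_op_def)
    ultimately have "deriv (F n) z = q z" using c1[OF zD] by (simp add: q_def field_simps)
    then show ?thesis using M(2)[of z] z(1) by (auto simp: admissible_zero_def N_def D'_def)
  qed
  obtain s z \<rho> A \<kappa> G where
    Gb: "\<And>\<zeta>. norm (deriv G \<zeta>) * (\<kappa> + (\<Sum>j<(1::nat). norm ((deriv ^^ j) (poly A) \<zeta>))) \<le>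
        N * ((\<kappa> + (\<Sum>j<(1::nat). norm ((deriv ^^ j) (poly A) \<zeta>)))\<^sup>2 + (norm (G \<zeta>))\<^sup>2)"
    and g: "plane_limit (\<lambda>m. rescale (F (s m)) (z m) (\<rho> m) (weight 1 (\<lambda>_. 0) (z m) (\<rho> m))) G"
    and z: "z \<longlonglongrightarrow> z0" and \<rho>: "\<rho> \<longlonglongrightarrow> 0" "\<And>m. 0 < \<rho> m" and \<kappa>0: "0 \<le> \<kappa>"
    and sum1: "\<kappa> + (\<Sum>j<(1::nat). norm ((deriv ^^ j) (poly A) 0)) = 1"
    and G0: "norm (deriv G 0) = N * (1 + (norm (G 0))\<^sup>2)"
    by (rule rescaling_limit[OF holomorphic_on_const D'(1,2) holomorphic_on_subset[OF F D'(3)] N zero no]) (assumption | rule that)+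
  have w: "weight 1 (\<lambda>_. 0) x r = r" for x r by (simp add: weight_def)
  have g': "plane_limit (\<lambda>m. rescale (F (s m)) (z m) (\<rho> m) (\<rho> m)) G" using g by (simp only: w)
  have \<rho>0: "\<rho> m \<noteq> 0" for m using \<rho>(2)[of m] by simp
  have holG: "G holomorphic_on S" for S by (rule plane_limit_holomorphic[OF g])
  define pt where "pt m \<zeta> = z m + of_real (\<rho> m) * \<zeta>" for m \<zeta>
  have inD: "\<forall>\<^sub>F m in sequentially. \<forall>\<zeta>\<in>ball 0 R. pt m \<zeta> \<in> D" for R
    unfolding pt_def by (rule rescaled_points_in_domain[OF D z \<rho>(1)])
  have coef: "plane_limit (\<lambda>m \<zeta>. u (pt m \<zeta>)) (\<lambda>\<zeta>. u z0)" if "u holomorphic_on D" for u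
    unfolding pt_def by (rule plane_limit_rescaled_coefficient[OF that D z \<rho>(1)])
  have Lop1: "plane_limit (\<lambda>m \<zeta>. of_real (\<rho> m ^ 1 / \<rho> m) * linear_diff_op c 1 (F (s m)) (z m + of_real (\<rho> m) * \<zeta>)) (\<lambda>\<zeta>. c 1 z0 * (deriv ^^ 1) G \<zeta>)"
    by (rule rescaled_operator_limit[OF c D F z \<rho>(1) \<rho>0 g'])
  define c0 where "c0 = c 1 z0"
  have c0: "c0 \<noteq> 0" using c1 D by (simp add: c0_def)
  have Lop: "plane_limit (\<lambda>m \<zeta>. linear_diff_op c 1 (F (s m)) (pt m \<zeta>)) (\<lambda>\<zeta>. c0 * deriv G \<zeta>)"
    using Lop1 \<rho>0 by (simp add: pt_def c0_def)
  have vals: "plane_limit (\<lambda>m \<zeta>. F (s m) (pt m \<zeta>)) (\<lambda>\<zeta>. 0)"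
  proof -
    have "plane_limit (\<lambda>m \<zeta>. of_real (\<rho> m) * rescale (F (s m)) (z m) (\<rho> m) (\<rho> m) \<zeta>) (\<lambda>\<zeta>. of_real 0 * G \<zeta>)"
      by (intro plane_limit_mult plane_limit_const tendsto_of_real \<rho> g')
    then show ?thesis using \<rho>0 by (simp add: rescale_def pt_def)
  qed
  define \<beta> \<gamma> where "\<beta> = (b z0 - La z0) / c0" and "\<gamma> = q z0"
  have \<beta>: "\<beta> \<noteq> 0" using bLa[OF D(2)] c0 by (simp add: \<beta>_def La_def)
  have dG: "N \<le> norm (deriv G 0)" using N unfolding G0 by simp
  then have dG_gt: "norm \<gamma> < norm (deriv G 0)" using M(2)[of z0] R by (simp add: N_def \<gamma>_def)
  have \<gamma>: "deriv G \<zeta>0 = \<gamma>" if \<zeta>0: "G \<zeta>0 = 0" for \<zeta>0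
  proof -
    have "\<exists>\<zeta>1. G \<zeta>1 \<noteq> 0"
    proof (rule ccontr)
      assume "\<nexists>\<zeta>1. G \<zeta>1 \<noteq> 0"
      then have "G = (\<lambda>_. 0)" by auto
      then show False using dG N by simp
    qed
    then obtain \<zeta>1 where \<zeta>1: "G \<zeta>1 \<noteq> 0" by blast
    have aLa: "(\<lambda>z. a z - La z) holomorphic_on D" by (intro holomorphic_intros a La)
    have "c0 * deriv G \<zeta>0 - (a z0 - La z0) = 0"
    proof (rule plane_limit_zeros_transfer[OF g' plane_limit_diff[OF Lop coef[OF aLa]] _ \<zeta>0 \<zeta>1])
      fix R
      show "\<forall>\<^sub>F m in sequentially. \<forall>\<zeta>\<in>ball 0 R. rescale (F (s m)) (z m) (\<rho> m) (\<rho> m) \<zeta> = 0 \<longrightarrow>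
          linear_diff_op c 1 (F (s m)) (pt m \<zeta>) - (a (pt m \<zeta>) - La (pt m \<zeta>)) = 0"
        using inD[of R]
      proof eventually_elim
        case (elim m)
        then show ?case using share_a[of _ "s m"] LF[of _ "s m"] \<rho>0[of m] by (auto simp: rescale_def pt_def F_def)
      qed
    qed
    then show ?thesis using c0 by (simp add: \<gamma>_def q_def c0_def field_simps)
  qed
  have omit: "deriv G \<zeta>0 \<noteq> \<beta>" if \<zeta>1: "deriv G \<zeta>1 \<noteq> \<beta>" for \<zeta>0 \<zeta>1
  proof
    assume \<zeta>0: "deriv G \<zeta>0 = \<beta>"
    have bLa': "(\<lambda>z. b z - La z) holomorphic_on D" "(\<lambda>z. b z - a z) holomorphic_on D" by (intro holomorphic_intros a b La)+
    have "0 - (b z0 - a z0) = 0"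
    proof (rule plane_limit_zeros_transfer[OF plane_limit_diff[OF Lop coef[OF bLa'(1)]] plane_limit_diff[OF vals coef[OF bLa'(2)]]])
      fix R
      show "\<forall>\<^sub>F m in sequentially. \<forall>\<zeta>\<in>ball 0 R.
          linear_diff_op c 1 (F (s m)) (pt m \<zeta>) - (b (pt m \<zeta>) - La (pt m \<zeta>)) = 0 \<longrightarrow>
          F (s m) (pt m \<zeta>) - (b (pt m \<zeta>) - a (pt m \<zeta>)) = 0"
        using inD[of R]
      proof eventually_elim
        case (elim m)
        then show ?case using share_b[of _ "s m"] LF[of _ "s m"] by (auto simp: F_def)
      qed
      show "c0 * deriv G \<zeta>0 - (b z0 - La z0) = 0" using \<zeta>0 c0 by (simp add: \<beta>_def)
      show "c0 * deriv G \<zeta>1 - (b z0 - La z0) \<noteq> 0" using \<zeta>1 c0 by (simp add: \<beta>_def field_simps)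
    qed
    then show False using ab[OF D(2)] by simp
  qed
  have const: False if C0: "\<And>\<zeta>. deriv G \<zeta> = C0" for C0
  proof -
    have "deriv G = (\<lambda>_. C0)" using C0 by auto
    then have "(deriv ^^ Suc 1) G \<zeta> = 0" for \<zeta> by simp
    then obtain p where p: "G = poly p" using entire_polynomial_if_higher_deriv_0[OF holG] by blast
    have "\<exists>\<zeta>0. G \<zeta>0 = 0"
    proof (rule ccontr)
      assume "\<nexists>\<zeta>0. G \<zeta>0 = 0"
      then obtain e where "p = [:e:]" using poly_eq_const_if_no_zeros p by blast
      then have "G = (\<lambda>_. e)" using p by auto
      then show False using dG N by simp
    qed
    then have "C0 = \<gamma>" using \<gamma> C0 by metis
    then show False using dG_gt C0[of 0] by simp
  qed
  obtain B K where BK: "0 \<le> K" "\<And>\<zeta>. norm (G \<zeta>) \<le> B * exp (K * norm \<zeta>)"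
    using exponential_growth_if_weighted_bound[OF holG zero_less_one N \<kappa>0 sum1 Gb] by blast
  have "deriv G \<zeta> \<noteq> \<beta>" for \<zeta> using omit const[of \<beta>] by blast
  then have nz: "(deriv ^^ 1) G \<zeta> \<noteq> \<beta>" for \<zeta> by simp
  obtain u v where uv: "\<And>\<zeta>. (deriv ^^ 1) G \<zeta> = \<beta> + exp (u + v * \<zeta>)"
    using higher_deriv_eq_const_plus_exp[OF holG BK(2,1) nz] by blast
  have v: "v \<noteq> 0"
  proof
    assume "v = 0"
    then have "deriv G \<zeta> = \<beta> + exp u" for \<zeta> using uv[of \<zeta>] by simp
    then show False by (rule const)
  qed
  obtain p B' where p: "B' \<noteq> 0" "\<And>\<zeta>. G \<zeta> = poly p \<zeta> + B' * exp (v * \<zeta>)" "\<And>\<zeta>. (deriv ^^ 1) (poly p) \<zeta> = \<beta>"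
    by (rule entire_eq_poly_plus_exp[OF holG uv v]) (rule that)
  have dp: "poly (pderiv p) \<zeta> = \<beta>" for \<zeta> using p(3)[of \<zeta>] higher_deriv_poly[of 1 p] by simp
  \<comment> \<open>eliminating the exponential from \<open>G = 0\<close> and \<open>G' = \<gamma>\<close>\<close>
  define Q where "Q = [:\<beta> - \<gamma>:] - smult v p"
  have "pderiv Q = - smult v (pderiv p)" by (simp add: Q_def pderiv_diff pderiv_smult pderiv_pCons)
  then have "poly (pderiv Q) 0 = - v * \<beta>" by (simp add: dp)
  then have "Q \<noteq> 0" using v \<beta> by auto
  have "p \<noteq> 0" using dp[of 0] \<beta> by auto
  have "poly Q \<zeta> = 0" if \<zeta>: "poly p \<zeta> + B' * exp (v * \<zeta>) = 0" for \<zeta>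
  proof -
    have "deriv G \<zeta> = \<gamma>" by (rule \<gamma>) (use p(2) \<zeta> in auto)
    moreover have "G = (\<lambda>\<zeta>. poly p \<zeta> + B' * exp (v * \<zeta>))" by (rule ext) (rule p(2))
    moreover have "((\<lambda>\<zeta>. poly p \<zeta> + B' * exp (v * \<zeta>)) has_field_derivative poly (pderiv p) \<zeta> + v * (B' * exp (v * \<zeta>))) (at \<zeta>)"
      by (auto intro!: derivative_eq_intros poly_DERIV)
    then have "deriv (\<lambda>\<zeta>. poly p \<zeta> + B' * exp (v * \<zeta>)) \<zeta> = poly (pderiv p) \<zeta> + v * (B' * exp (v * \<zeta>))"
      by (rule DERIV_imp_deriv)
    ultimately have "\<gamma> = \<beta> + v * (B' * exp (v * \<zeta>))" by (simp add: dp)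
    moreover have "B' * exp (v * \<zeta>) = - poly p \<zeta>" using \<zeta> by (metis add_eq_0_iff)
    ultimately show ?thesis by (simp add: Q_def)
  qed
  then have "{\<zeta>. poly p \<zeta> + B' * exp (v * \<zeta>) = 0} \<subseteq> {\<zeta>. poly Q \<zeta> = 0}" by blast
  then show False
    using infinite_zeros_poly_plus_exp[OF \<open>p \<noteq> 0\<close> p(1) v] poly_roots_finite[OF \<open>Q \<noteq> 0\<close>] finite_subset by blast
qed

section \<open>Quasi-normality\<close>

lemma ex_subseq_convergent_or_infinity:
  fixes x :: "nat \<Rightarrow> complex"
  shows "\<exists>r. strict_mono (r :: nat \<Rightarrow> nat) \<and> (convergent (\<lambda>n. x (r n)) \<or> filterlim (\<lambda>n. x (r n)) at_infinity sequentially)"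
proof (cases "filterlim x at_infinity sequentially")
  case True
  then show ?thesis by (intro exI[of _ id]) (simp add: strict_mono_def)
next
  case False
  then obtain B where "\<not> (\<forall>\<^sub>F n in sequentially. B \<le> norm (x n))"
    unfolding filterlim_at_infinity[OF order_refl] by blast
  then have "infinite {n. norm (x n) < B}"
    by (simp add: not_eventually not_le frequently_cofinite flip: cofinite_eq_sequentially)
  then obtain s :: "nat \<Rightarrow> nat" where s: "strict_mono s" "\<forall>n. s n \<in> {n. norm (x n) < B}"
    using infinite_enumerate by blast
  have "compact (cball 0 B :: complex set)" by simp
  moreover have "\<forall>n. x (s n) \<in> cball 0 B" using s(2) by (auto intro: less_imp_le)
  ultimately obtain l r where r: "strict_mono (r :: nat \<Rightarrow> nat)" "((\<lambda>n. x (s n)) \<circ> r) \<longlonglongrightarrow> l"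
    by (metis compact_def)
  then have "convergent (\<lambda>n. x ((s \<circ> r) n))" by (auto simp: convergent_def o_def)
  then show ?thesis using strict_mono_o[OF s(1) r(1)] by blast
qed

text \<open>The limit points of the exceptional sets: after passing to a subsequence, each of the at most \<open>q\<close>
  exceptional points converges or leaves the plane.\<close>

lemma ex_subseq_exceptional_sets:
  fixes Z :: "nat \<Rightarrow> complex set"
  assumes fin: "\<And>n. finite (Z n)" and card: "\<And>n. card (Z n) \<le> q"
  obtains r E where "strict_mono (r :: nat \<Rightarrow> nat)" "E \<subseteq> D" "finite E" "card E \<le> q"
    "\<And>z. z \<in> D - E \<Longrightarrow> \<exists>d>0. \<forall>\<^sub>F n in sequentially. Z (r n) \<inter> ball z d = {}"
proof -
  have "\<exists>p. Z n \<subseteq> p ` {..<q}" for n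
  proof -
    obtain p where p: "bij_betw p {0..<card (Z n)} (Z n)" using ex_bij_betw_nat_finite[OF fin] by blast
    have "{0..<card (Z n)} \<subseteq> {..<q}" using card[of n] by auto
    then have "Z n \<subseteq> p ` {..<q}" using bij_betw_imp_surj_on[OF p] by (metis image_mono)
    then show ?thesis by blast
  qed
  then obtain p where p: "\<And>n. Z n \<subseteq> p n ` {..<q}" by metis
  have "\<exists>r. strict_mono r \<and> (\<forall>j<q. convergent (\<lambda>n. p (r n) j) \<or> filterlim (\<lambda>n. p (r n) j) at_infinity sequentially)"
  proof (rule ex_common_subseq)
    fix j and s :: "nat \<Rightarrow> nat" assume "strict_mono s"
    show "\<exists>r. strict_mono r \<and> (convergent (\<lambda>n. p ((s \<circ> r) n) j) \<or> filterlim (\<lambda>n. p ((s \<circ> r) n) j) at_infinity sequentially)"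
      using ex_subseq_convergent_or_infinity[of "\<lambda>n. p (s n) j"] by simp
  next
    fix j and s r :: "nat \<Rightarrow> nat" assume r: "strict_mono r"
      and s: "convergent (\<lambda>n. p (s n) j) \<or> filterlim (\<lambda>n. p (s n) j) at_infinity sequentially"
    show "convergent (\<lambda>n. p ((s \<circ> r) n) j) \<or> filterlim (\<lambda>n. p ((s \<circ> r) n) j) at_infinity sequentially"
      using s convergent_subseq_convergent[OF _ r, of "\<lambda>n. p (s n) j"]
        filterlim_compose[OF _ filterlim_subseq[OF r], of "\<lambda>n. p (s n) j"] by (auto simp: o_def)
  qed
  then obtain r where r: "strict_mono (r :: nat \<Rightarrow> nat)"
    "\<And>j. j < q \<Longrightarrow> convergent (\<lambda>n. p (r n) j) \<or> filterlim (\<lambda>n. p (r n) j) at_infinity sequentially"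
    by blast
  define E where "E = {l \<in> D. \<exists>j<q. (\<lambda>n. p (r n) j) \<longlonglongrightarrow> l}"
  have sub: "E \<subseteq> (\<lambda>j. lim (\<lambda>n. p (r n) j)) ` {..<q}" unfolding E_def using limI by fastforce
  have "finite E" using finite_subset[OF sub] by simp
  moreover have "card E \<le> q" using card_mono[OF _ sub] card_image_le[of "{..<q}" "\<lambda>j. lim (\<lambda>n. p (r n) j)"] by simp
  moreover have "\<exists>d>0. \<forall>\<^sub>F n in sequentially. Z (r n) \<inter> ball z d = {}" if z: "z \<in> D - E" for z
  proof -
    have "\<exists>d>0. \<forall>\<^sub>F n in sequentially. d \<le> dist z (p (r n) j)" if j: "j < q" for j
      using r(2)[OF j]
    proof
      assume "convergent (\<lambda>n. p (r n) j)"
      then obtain l where l: "(\<lambda>n. p (r n) j) \<longlonglongrightarrow> l" by (auto simp: convergent_def)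
      then have lz: "l \<noteq> z" using z j by (auto simp: E_def)
      have "(\<lambda>n. dist z (p (r n) j)) \<longlonglongrightarrow> dist z l" by (intro tendsto_intros l)
      then have "\<forall>\<^sub>F n in sequentially. dist z l / 2 < dist z (p (r n) j)"
        using lz by (intro order_tendstoD(1)) auto
      then show ?thesis using lz by (intro exI[of _ "dist z l / 2"]) (auto elim: eventually_mono)
    next
      assume "filterlim (\<lambda>n. p (r n) j) at_infinity sequentially"
      then have "\<forall>\<^sub>F n in sequentially. norm z + 1 \<le> norm (p (r n) j)"
        unfolding filterlim_at_infinity[OF order_refl] by (simp add: add_pos_nonneg add.commute)
      then have "\<forall>\<^sub>F n in sequentially. 1 \<le> dist z (p (r n) j)"
      proof eventually_elim
        case (elim n)
        then show ?case using norm_triangle_ineq2[of "p (r n) j" z] by (simp add: dist_norm norm_minus_commute)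
      qed
      then show ?thesis by (intro exI[of _ 1]) auto
    qed
    then obtain d where d: "\<And>j. j < q \<Longrightarrow> 0 < d j" "\<And>j. j < q \<Longrightarrow> \<forall>\<^sub>F n in sequentially. d j \<le> dist z (p (r n) j)"
      by metis
    define d0 where "d0 = Min (insert 1 (d ` {..<q}))"
    have "0 < d0" using d(1) by (auto simp: d0_def)
    moreover have d0: "d0 \<le> d j" if "j < q" for j using that by (auto simp: d0_def)
    have "\<forall>\<^sub>F n in sequentially. \<forall>j\<in>{..<q}. d j \<le> dist z (p (r n) j)"
      by (intro eventually_ball_finite) (use d(2) in auto)
    then have "\<forall>\<^sub>F n in sequentially. Z (r n) \<inter> ball z d0 = {}"
    proof eventually_elim
      case (elim n)
      show ?case
      proof (rule ccontr)
        assume "Z (r n) \<inter> ball z d0 \<noteq> {}"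
        then obtain x where x: "x \<in> Z (r n)" "x \<in> ball z d0" by blast
        then obtain j where j: "j < q" "x = p (r n) j" using p[of "r n"] by blast
        then have "d j \<le> dist z x" using elim by blast
        then show False using x(2) d0[OF j(1)] by simp
      qed
    qed
    ultimately show ?thesis by blast
  qed
  ultimately show ?thesis using that[OF r(1), of E] by (auto simp: E_def)
qed

theorem theorem2p6:
  fixes D :: "complex set" and k q :: nat
    and c :: "nat \<Rightarrow> complex \<Rightarrow> complex"
    and \<F> :: "(complex \<Rightarrow> complex) set"
    and a b :: "complex \<Rightarrow> complex"
  assumes "open D" and "connected D" and "D \<noteq> {}"
    and "k \<ge> 1" and "q \<ge> 1"
    and "\<And>j. j \<le> k \<Longrightarrow> c j holomorphic_on D"
    and "\<And>z. z \<in> D \<Longrightarrow> c k z \<noteq> 0"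
    and "\<And>f. f \<in> \<F> \<Longrightarrow> f holomorphic_on D"
    and "\<And>f. f \<in> \<F> \<Longrightarrow> zeros_mult_ge k f D"
    and "a holomorphic_on D" and "b holomorphic_on D"
    and "\<And>z. z \<in> D \<Longrightarrow> b z \<noteq> 0"
    and "\<And>z. z \<in> D \<Longrightarrow> a z \<noteq> b z"
    and "\<And>z. z \<in> D \<Longrightarrow> b z - linear_diff_op c k a z \<noteq> 0"
    and "\<And>f. f \<in> \<F> \<Longrightarrow>
           \<exists>Z. Z \<subseteq> D \<and> finite Z \<and> card Z \<le> q \<and>
             (\<forall>z\<in>D - Z. (f z = a z \<longleftrightarrow> linear_diff_op c k f z = a z) \<and>
                        (linear_diff_op c k f z = b z \<longrightarrow> f z = b z))"
  shows "quasi_normal_of_order_le q D \<F>"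
  unfolding quasi_normal_of_order_le_def
proof (intro allI impI)
  fix f :: "nat \<Rightarrow> complex \<Rightarrow> complex" assume rng: "range f \<subseteq> \<F>"
  then have fF: "f n \<in> \<F>" for n by blast
  have "\<forall>n. \<exists>Z. finite Z \<and> card Z \<le> q \<and>
      (\<forall>z\<in>D - Z. (f n z = a z \<longleftrightarrow> linear_diff_op c k (f n) z = a z) \<and> (linear_diff_op c k (f n) z = b z \<longrightarrow> f n z = b z))"
    using assms(15)[OF fF] by blast
  then obtain Z where Z: "\<And>n. finite (Z n)" "\<And>n. card (Z n) \<le> q"
    "\<And>n z. z \<in> D - Z n \<Longrightarrow> f n z = a z \<longleftrightarrow> linear_diff_op c k (f n) z = a z"
    "\<And>n z. z \<in> D - Z n \<Longrightarrow> linear_diff_op c k (f n) z = b z \<Longrightarrow> f n z = b z"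
    by metis
  obtain r E where r: "strict_mono (r :: nat \<Rightarrow> nat)" and E: "E \<subseteq> D" "finite E" "card E \<le> q"
    and away: "\<And>z. z \<in> D - E \<Longrightarrow> \<exists>d>0. \<forall>\<^sub>F n in sequentially. Z (r n) \<inter> ball z d = {}"
    using ex_subseq_exceptional_sets[of Z q D] Z(1,2) by blast
  have conn: "connected (D - E)"
    by (rule connected_open_delete_finite[OF assms(1,2) _ E(2)]) simp
  have opE: "open (D - E)" by (intro open_Diff assms(1) finite_imp_closed E(2))
  have "\<exists>s e. strict_mono (s :: nat \<Rightarrow> nat) \<and> 0 < e \<and> uniform_limit_or_infinity (ball z e) ((\<lambda>n. f (r n)) \<circ> p \<circ> s)"
    if z: "z \<in> D - E" and p: "strict_mono p" for z and p :: "nat \<Rightarrow> nat"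
  proof -
    obtain d where d: "d > 0" "\<forall>\<^sub>F n in sequentially. Z (r n) \<inter> ball z d = {}" using away[OF z] by blast
    obtain e where e: "e > 0" "ball z e \<subseteq> D - E" using opE z openE by blast
    define V where "V = ball z (min d e)"
    have V: "open V" "z \<in> V" "V \<subseteq> D" using d(1) e by (auto simp: V_def)
    have "\<forall>\<^sub>F n in sequentially. Z (r (p n)) \<inter> ball z d = {}"
      by (rule eventually_compose_filterlim[OF d(2) filterlim_subseq[OF p]])
    then obtain N where N: "\<And>n. n \<ge> N \<Longrightarrow> Z (r (p n)) \<inter> ball z d = {}" unfolding eventually_sequentially by blast
    define h where "h n = f (r (p (n + N)))" for n
    have Vn: "w \<in> D - Z (r (p (n + N)))" if "w \<in> V" for w n
      using that V N[of "n + N"] by (auto simp: V_def)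
    have share_a: "h n w = a w \<longleftrightarrow> linear_diff_op c k (h n) w = a w" if "w \<in> V" for w n
      using Z(3)[OF Vn[OF that]] by (simp add: h_def)
    have share_b: "h n w = b w" if "w \<in> V" "linear_diff_op c k (h n) w = b w" for w n
      using Z(4)[OF Vn[OF that(1)]] that(2) by (simp add: h_def)
    have hol: "h n holomorphic_on V" for n
      unfolding h_def by (rule holomorphic_on_subset[OF assms(8)[OF fF] V(3)])
    have mult: "zeros_mult_ge k (h n) V" for n
      using assms(9)[OF fF] V(3) by (auto simp: h_def zeros_mult_ge_def)
    have cV: "c j holomorphic_on V" if "j \<le> k" for j using assms(6)[OF that] V(3) holomorphic_on_subset by blast
    have aV: "a holomorphic_on V" and bV: "b holomorphic_on V" using assms(10,11) V(3) holomorphic_on_subset by blast+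
    have "\<exists>s e. strict_mono (s :: nat \<Rightarrow> nat) \<and> 0 < e \<and> uniform_limit_or_infinity (ball z e) (h \<circ> s)"
    proof (cases "k = 1")
      case True
      show ?thesis
      proof (rule normal_near_point_order_1[where c = c and a = a and b = b, OF V(1,2) _ _ hol aV bV])
        show "linear_diff_op c 1 (h n) w = a w" if "w \<in> V" "h n w = a w" for n w
          using share_a[OF that(1), of n] that(2) True by simp
      qed (use True cV assms(7,13,14) share_b V(3) in auto)
    next
      case False
      then have k2: "2 \<le> k" using assms(4) by simp
      show ?thesis
        by (rule normal_near_point_order_ge_2[OF V(1,2) k2 cV _ hol mult aV bV _ _ share_a share_b])
           (use assms(7,12,13) V(3) in auto)
    qed
    then obtain s e' where s: "strict_mono (s :: nat \<Rightarrow> nat)" "0 < e'" "uniform_limit_or_infinity (ball z e') (h \<circ> s)"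
      by blast
    have "h \<circ> s = (\<lambda>n. f (r n)) \<circ> p \<circ> (\<lambda>n. s n + N)" by (simp add: h_def fun_eq_iff)
    moreover have "strict_mono (\<lambda>n. s n + N)" using s(1) by (simp add: strict_mono_def)
    ultimately show ?thesis using s(2,3) by metis
  qed
  then obtain t where t: "strict_mono (t :: nat \<Rightarrow> nat)" "converges_on_compacts (D - E) ((\<lambda>n. f (r n)) \<circ> t)"
    using ex_subseq_converges_on_compacts[OF conn, of "\<lambda>n. f (r n)"] by blast
  have "(\<lambda>n. f (r n)) \<circ> t = f \<circ> (r \<circ> t)" by auto
  then have "strict_mono (r \<circ> t) \<and> E \<subseteq> D \<and> (\<forall>z\<in>D. \<not> z islimpt E) \<and> finite E \<and> card E \<le> q \<and>
      converges_on_compacts (D - E) (f \<circ> (r \<circ> t))"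
    using t E strict_mono_o[OF r t(1)] islimpt_finite[OF E(2)] by simp
  then show "\<exists>r E. strict_mono (r :: nat \<Rightarrow> nat) \<and> E \<subseteq> D \<and> (\<forall>z\<in>D. \<not> z islimpt E) \<and>
      finite E \<and> card E \<le> q \<and> converges_on_compacts (D - E) (f \<circ> r)" by blast
qed

end
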